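(* Let $\lambda$ be a strict partition, let $r=(r_{i,j})$ be complex constants indexed by the pairs $i,j\in I_\lambda$ with $i>|j|$, and let $\tau=\mathrm{Pf}(W_\lambda)$ be the BKP $\tau$-function (for $n=\infty$; for finite $n$, its $B$-Toda analogue) given by the Pfaffian of the skew-symmetric matrix $W_\lambda$. Then $\tau$ has a Schur-$Q$ expansion $\tau=\sum_\mu R_\mu Q_\mu(\mathbf t_B)$ over strict partitions $\mu$. The coefficients $R_\mu$ of the $Q_\mu$ in this expansion satisfy all the Cartan-Plücker relations, i.e. they are the Cartan coordinates of a pure spinor. All pure spinors can be obtained in this way. That is, for any pure spinor $s$, all its Cartan coordinates are Pfaffians of certain minors of a skew-symmetric matrix determined by $s$.
   Context: Throughout, $n\in\{1,2,\dots\}\cup\{\infty\}$: $n=\infty$ is the BKP case, finite $n$ is the case of $\mathfrak{so}_{2n+1}$ ($B$-Toda); for finite $n$ all partitions have parts at most $n$ and all labels have absolute value at most $n$. Schur-$Q$ functions. $\mathbf t_B=(t_1,t_3,t_5,\dots)$ and $\exp(\sum_{k\text{ odd}}t_kz^k)=\sum_{i\ge0}q_i(\mathbf t_B)z^i$. For $a>b\ge1$, $Q_{a,b}=\frac12q_aq_b+\sum_{k=1}^b(-1)^kq_{a+k}q_{b-k}$; $Q_{a,0}=\frac1{\sqrt2}q_a$ for $a\ge1$; $Q_{b,a}=-Q_{a,b}$ and $Q_{a,a}=0$. A strict partition with an odd number of positive parts is augmented by a part $0$; $Q_\mu=\mathrm{Pf}(Q_{\mu_i,\mu_j})$ for the (augmented)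 $\mu$, and $Q_\emptyset=1$. Spinors. $V$ has basis $e_i$ ($i\in\mathbb Z$, $|i|\le n$) and symmetric bilinear form $\Psi(e_i,e_{-j})=(-1)^i\delta_{ij}$. The spin module $S$ is the module over the Clifford algebra of $V$ (relations $xy+yx=\Psi(x,y)$) generated by the highest weight vector $v$ with $e_{-j}v=0$ for $j\ge1$ and $e_0v=\frac1{\sqrt2}v$. For finite $n$, $S$ is the exterior algebra on $e_{-1},\dots,e_{-n}$, with $v=e_{-n}\wedge\dots\wedge e_{-1}$, and each spinor is written $\sum\xi_{i_1,\dots,i_k}e_{-i_1}\wedge\dots\wedge e_{-i_k}$ with $n\ge i_1>\dots>i_k>0$. Elements of $S$ are called spinors, and their coefficients in the basis of weight vectors are their Cartan coordinates. The basis vector attached to a strict partition $\mu=(\mu_1>\dots>\mu_k>0)$ is $e_{\mu_1}\cdots e_{\mu_k}v$; it spans the line of $w_\mu\cdot v$, where $w_\mu$ is the Weyl group element changing the signs of $\varepsilon_{\mu_1},\dots,\varepsilon_{\mu_k}$, and it corresponds to $Q_\mu$ under the type $B$ Boson-Fermion correspondence. A pure spinor is a spinor representing a Lagrangian (maximal totally isotropic) subspace of $V$, namely $\{w\in V: w\cdot s=0\}$; equivalently, an element of $S$ whose class in $\mathbb P(S)$ lies in the orbit of the class of $v$ under the orthogonal group of $V$. Pure spinors are thus regarded as points of $\mathbb P(S)$ and Cartan coordinates as homogeneous coordinates. For $n=\infty$ a suitable infinite-dimensional orthogonal group acting on a suitable completion of $S$ is understood. The Cartan-Plücker relations are the quadratic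 equations in the Cartan coordinates cutting out the locus of pure spinors in $\mathbb P(S)$. The matrix $W_\lambda$. Rows and columns are labelled, in this order, by $\dots,-2,-1,-0,+0,1,2,\dots$ (from $-n$ to $n$ if $n$ is finite), with $-0\ne+0$ interchanged by negation and $|\pm0|=0$; $\tilde E_{i,j}$ are the matrix units. Write $\lambda=(\lambda_1>\dots>\lambda_{2\ell}\ge0)$ (augmented). $I_\lambda$ contains, for each $0\le j\le n$ ($j$ finite), $-j$ if $j\in\{\lambda_1,\dots,\lambda_{2\ell}\}$ and $+j$ otherwise. Then $$W_\lambda=\sum_{j>i\ge0}Q_{j,i}(\mathbf t_B)(\tilde E_{-i,-j}-\tilde E_{-j,-i})+\sum_{i\in I_\lambda,\,i>0}(\tilde E_{-i,i}-\tilde E_{i,-i})+\sum_{i,j\in I_\lambda,\,i>|j|}(-1)^{\min\{0,j\}}r_{i,j}(\tilde E_{i,j}-\tilde E_{j,i})$$ $$+\sum_{j=1}^{\ell}(\tilde E_{\lambda_{2j},\lambda_{2j-1}}-\tilde E_{\lambda_{2j-1},\lambda_{2j}})+(1-\delta_{\lambda_{2\ell},0})(\tilde E_{-0,+0}-\tilde E_{+0,-0}).$$ In the first sum $-i$ with $i=0$ means $-0$; in the $r$-sum an index $\pm0$ keeps its sign in $\tilde E$ and $\min\{0,\pm0\}=0$; a part $0$ of $\lambda$ in the sum over $1\le j\le\ell$ means the label $+0$; for $\lambda=\emptyset$ the factor $1-\delta_{\lambda_{2\ell},0}$ is $1$. For $n=\infty$ the Pfaffian is understood through its Schur-$Q$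 expansion, which is consistent with finite truncations. *)

theory Defs
  imports
    Complex_Main
    "HOL-Library.Extended_Nat"
    "HOL-Library.Groups_Big_Fun"
    "HOL-Combinatorics.Permutations"
    "HOL-Computational_Algebra.Formal_Power_Series"
begin

section \<open>Strict partitions and Pfaffians\<close>

text \<open>A strict partition is encoded by the set of its positive parts.  The rank \<open>n\<close> is an
  extended natural number; \<open>n = \<infinity>\<close> is the BKP case.\<close>

definition strict_partitions :: "enat \<Rightarrow> nat set set" where
  "strict_partitions n = {\<mu>. finite \<mu> \<and> 0 \<notin> \<mu> \<and> (\<forall>m\<in>\<mu>. enat m \<le> n)}"

definition augmented :: "nat set \<Rightarrow> nat list" where
  "augmented \<mu> = rev (sorted_list_of_set (if odd (card \<mu>) then insert 0 \<mu> else \<mu>))"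

text \<open>The Pfaffian of the matrix \<open>A\<close> with rows and columns listed, in this order, by \<open>xs\<close>;
  it is meant for distinct \<open>xs\<close> and for \<open>A\<close> skew-symmetric on \<open>set xs\<close>.\<close>

definition pfaffian :: "'a list \<Rightarrow> ('a \<Rightarrow> 'a \<Rightarrow> complex) \<Rightarrow> complex" where
  "pfaffian xs A =
     (if even (length xs) then
        (\<Sum>\<sigma> | \<sigma> permutes {..<length xs}.
           of_int (sign \<sigma>) * (\<Prod>i<length xs div 2. A (xs ! \<sigma> (2 * i)) (xs ! \<sigma> (2 * i + 1))))
        / (2 ^ (length xs div 2) * fact (length xs div 2))
      else 0)"


section \<open>Schur Q-functions\<close>

text \<open>The variables are \<open>t k\<close> for odd \<open>k\<close>; the values of \<open>t\<close> at even arguments are not used.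
  Polynomials in the variables are represented by the functions of \<open>t\<close> they define.\<close>

definition q_fun :: "(nat \<Rightarrow> complex) \<Rightarrow> nat \<Rightarrow> complex" where
  "q_fun t i = fps_nth (fps_compose (fps_exp 1) (Abs_fps (\<lambda>k. if odd k then t k else 0))) i"

definition Q_desc :: "(nat \<Rightarrow> complex) \<Rightarrow> nat \<Rightarrow> nat \<Rightarrow> complex" where
  "Q_desc t a b =
     (if b = 0 then q_fun t a / complex_of_real (sqrt 2)
      else q_fun t a * q_fun t b / 2 + (\<Sum>k=1..b. (-1) ^ k * q_fun t (a + k) * q_fun t (b - k)))"

definition Q_two :: "(nat \<Rightarrow> complex) \<Rightarrow> nat \<Rightarrow> nat \<Rightarrow> complex" where
  "Q_two t a b = (if a > b then Q_desc t a b else if a < b then - Q_desc t b a else 0)"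

definition schur_Q :: "(nat \<Rightarrow> complex) \<Rightarrow> nat set \<Rightarrow> complex" where
  "schur_Q t \<mu> = pfaffian (augmented \<mu>) (Q_two t)"


section \<open>The vector space with its form, and the spin module\<close>

text \<open>A vector \<open>\<Sum>i. w i e\<^sub>i\<close> is given by its coefficients.  For \<open>n = \<infinity>\<close> it may have infinitely
  many nonzero coefficients at positive indices but only finitely many at negative indices.
  This is what acts on the completed spin module, and the form still reduces to finite sums.
  For finite \<open>n\<close> the finiteness condition is void.\<close>

definition vectors :: "enat \<Rightarrow> (int \<Rightarrow> complex) set" where
  "vectors n = {w. (\<forall>i. w i \<noteq> 0 \<longrightarrow> enat (nat \<bar>i\<bar>) \<le> n) \<and> finite {i. i < 0 \<and> w i \<noteq> 0}}"

definition Psi :: "(int \<Rightarrow> complex) \<Rightarrow> (int \<Rightarrow> complex) \<Rightarrow> complex" where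
  "Psi x y = Sum_any (\<lambda>i. (-1) powi i * x i * y (- i))"

definition linear_subspace :: "enat \<Rightarrow> (int \<Rightarrow> complex) set \<Rightarrow> bool" where
  "linear_subspace n L \<longleftrightarrow> L \<subseteq> vectors n \<and> (\<lambda>i. 0) \<in> L \<and>
     (\<forall>x\<in>L. \<forall>y\<in>L. (\<lambda>i. x i + y i) \<in> L) \<and> (\<forall>c. \<forall>x\<in>L. (\<lambda>i. c * x i) \<in> L)"

definition totally_isotropic :: "enat \<Rightarrow> (int \<Rightarrow> complex) set \<Rightarrow> bool" where
  "totally_isotropic n L \<longleftrightarrow> linear_subspace n L \<and> (\<forall>x\<in>L. \<forall>y\<in>L. Psi x y = 0)"

definition lagrangian :: "enat \<Rightarrow> (int \<Rightarrow> complex) set \<Rightarrow> bool" where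
  "lagrangian n L \<longleftrightarrow> totally_isotropic n L \<and> (\<forall>L'. totally_isotropic n L' \<and> L \<subseteq> L' \<longrightarrow> L' = L)"

text \<open>A spinor \<open>s\<close> is given by its Cartan coordinates: \<open>s \<mu>\<close> is the coefficient of the basis vector
  \<open>e\<^sub>\<mu>\<^sub>1 \<cdots> e\<^sub>\<mu>\<^sub>k v\<close> with \<open>\<mu>\<^sub>1 > \<dots> > \<mu>\<^sub>k > 0\<close> the parts of \<open>\<mu>\<close>.  For \<open>n = \<infinity>\<close> arbitrary infinite
  linear combinations of basis vectors are allowed.\<close>

type_synonym spinor = "nat set \<Rightarrow> complex"

definition spinors :: "enat \<Rightarrow> spinor set" where
  "spinors n = {s. \<forall>\<mu>. \<mu> \<notin> strict_partitions n \<longrightarrow> s \<mu> = 0}"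

definition vacuum :: spinor where
  "vacuum = (\<lambda>\<mu>. if \<mu> = {} then 1 else 0)"

text \<open>The action of \<open>e\<^sub>i\<close>.  It is forced by the Clifford relations and the action on the highest
  weight vector; see the lemmas below.\<close>

definition sign_above :: "nat \<Rightarrow> nat set \<Rightarrow> complex" where
  "sign_above j \<mu> = (-1) ^ card {m \<in> \<mu>. j < m}"

definition clifford_gen :: "int \<Rightarrow> spinor \<Rightarrow> spinor" where
  "clifford_gen i s = (\<lambda>\<mu>.
     let j = nat \<bar>i\<bar> in
     if i = 0 then (-1) ^ card \<mu> / complex_of_real (sqrt 2) * s \<mu>
     else if i > 0 then (if j \<in> \<mu> then sign_above j \<mu> * s (\<mu> - {j}) else 0)
     else (if j \<in> \<mu> then 0 else (-1) ^ j * sign_above j \<mu> * s (insert j \<mu>)))"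

definition clifford :: "(int \<Rightarrow> complex) \<Rightarrow> spinor \<Rightarrow> spinor" where
  "clifford w s = (\<lambda>\<mu>. Sum_any (\<lambda>i. w i * clifford_gen i s \<mu>))"

definition pure_spinor :: "enat \<Rightarrow> spinor \<Rightarrow> bool" where
  "pure_spinor n s \<longleftrightarrow> s \<in> spinors n \<and> s \<noteq> (\<lambda>\<mu>. 0) \<and>
     lagrangian n {w \<in> vectors n. clifford w s = (\<lambda>\<mu>. 0)}"

text \<open>The Cartan-Pluecker relations are the quadratic equations in the Cartan coordinates that hold
  on the locus of pure spinors; a homogeneous quadratic polynomial is given by its finitely many
  coefficients.\<close>

definition quadratic_value :: "(nat set \<Rightarrow> nat set \<Rightarrow> complex) \<Rightarrow> spinor \<Rightarrow> complex" where
  "quadratic_value c s = (\<Sum>(\<mu>, \<nu>) | c \<mu> \<nu> \<noteq> 0. c \<mu> \<nu> * s \<mu> * s \<nu>)"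

definition cartan_pluecker_relation :: "enat \<Rightarrow> (nat set \<Rightarrow> nat set \<Rightarrow> complex) \<Rightarrow> bool" where
  "cartan_pluecker_relation n c \<longleftrightarrow>
     finite {(\<mu>, \<nu>). c \<mu> \<nu> \<noteq> 0} \<and>
     {(\<mu>, \<nu>). c \<mu> \<nu> \<noteq> 0} \<subseteq> strict_partitions n \<times> strict_partitions n \<and>
     (\<forall>s. pure_spinor n s \<longrightarrow> quadratic_value c s = 0)"

definition satisfies_cartan_pluecker :: "enat \<Rightarrow> spinor \<Rightarrow> bool" where
  "satisfies_cartan_pluecker n s \<longleftrightarrow>
     (\<forall>c. cartan_pluecker_relation n c \<longrightarrow> quadratic_value c s = 0)"


section \<open>The matrix and the tau-function\<close>

text \<open>Row and column labels \<open>\<dots>, -2, -1, -0, +0, 1, 2, \<dots>\<close>, with \<open>-0\<close> and \<open>+0\<close> distinct.\<close>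

datatype label = NegL nat | PosL nat

fun label_val :: "label \<Rightarrow> int" where
  "label_val (NegL j) = - int j"
| "label_val (PosL j) = int j"

definition labels :: "nat \<Rightarrow> label list" where
  "labels N = map NegL (rev [0..<Suc N]) @ map PosL [0..<Suc N]"

definition matrix_unit :: "label \<Rightarrow> label \<Rightarrow> label \<Rightarrow> label \<Rightarrow> complex" where
  "matrix_unit i j a b = (if a = i \<and> b = j then 1 else 0)"

definition skew_unit :: "label \<Rightarrow> label \<Rightarrow> label \<Rightarrow> label \<Rightarrow> complex" where
  "skew_unit i j a b = matrix_unit i j a b - matrix_unit j i a b"

definition I_set :: "nat \<Rightarrow> nat set \<Rightarrow> label set" where
  "I_set N la = (\<lambda>j. if j \<in> set (augmented la) then NegL j else PosL j) ` {..N}"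

text \<open>\<open>core_matrix\<close> collects the terms of the matrix that do not involve \<open>t\<close>.  The parameters \<open>r\<close>
  form a total function of which only the values \<open>r i j\<close> with \<open>i, j\<close> in \<open>I_set\<close> and \<open>i > |j|\<close>
  are used.\<close>

definition Q_block :: "nat \<Rightarrow> (nat \<Rightarrow> complex) \<Rightarrow> label \<Rightarrow> label \<Rightarrow> complex" where
  "Q_block N t a b = (\<Sum>j\<le>N. \<Sum>i<j. Q_two t j i * skew_unit (NegL i) (NegL j) a b)"

definition core_matrix ::
    "nat \<Rightarrow> nat set \<Rightarrow> (label \<Rightarrow> label \<Rightarrow> complex) \<Rightarrow> label \<Rightarrow> label \<Rightarrow> complex" where
  "core_matrix N la r a b =
     (\<Sum>i | 0 < i \<and> PosL i \<in> I_set N la. skew_unit (NegL i) (PosL i) a b)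
   + (\<Sum>(i, j) | i \<in> I_set N la \<and> j \<in> I_set N la \<and> label_val i > \<bar>label_val j\<bar>.
        (-1) powi (min 0 (label_val j)) * r i j * skew_unit i j a b)
   + (\<Sum>k<length (augmented la) div 2.
        skew_unit (PosL (augmented la ! (2 * k + 1))) (PosL (augmented la ! (2 * k))) a b)
   + (if 0 \<in> set (augmented la) then 0 else 1) * skew_unit (NegL 0) (PosL 0) a b"

definition W_matrix ::
    "nat \<Rightarrow> nat set \<Rightarrow> (label \<Rightarrow> label \<Rightarrow> complex) \<Rightarrow> (nat \<Rightarrow> complex) \<Rightarrow> label \<Rightarrow> label \<Rightarrow> complex"
  where "W_matrix N la r t a b = Q_block N t a b + core_matrix N la r a b"

definition tau ::
    "nat \<Rightarrow> nat set \<Rightarrow> (label \<Rightarrow> label \<Rightarrow> complex) \<Rightarrow> (nat \<Rightarrow> complex) \<Rightarrow> complex" where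
  "tau N la r t = pfaffian (labels N) (W_matrix N la r t)"

text \<open>For finite \<open>n\<close> the only truncation is \<open>n\<close> itself.  For \<open>n = \<infinity>\<close> the Pfaffian is the formal
  series \<open>\<Sum>\<mu>. R \<mu> Q\<^sub>\<mu>\<close> whose part with all \<open>\<mu>\<^sub>i \<le> N\<close> is the Pfaffian of the matrix with labels from
  \<open>-N\<close> to \<open>N\<close>, for every \<open>N\<close> that is at least the largest part of \<open>\<lambda>\<close>.\<close>

definition truncations :: "enat \<Rightarrow> nat set" where
  "truncations n = {N. n = enat N \<or> n = \<infinity>}"

definition schur_Q_expansion ::
    "enat \<Rightarrow> nat set \<Rightarrow> (label \<Rightarrow> label \<Rightarrow> complex) \<Rightarrow> spinor \<Rightarrow> bool" where
  "schur_Q_expansion n la r R \<longleftrightarrow> R \<in> spinors n \<and>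
     (\<forall>N\<in>truncations n. la \<in> strict_partitions (enat N) \<longrightarrow>
        (\<forall>t. tau N la r t = (\<Sum>\<mu>\<in>strict_partitions (enat N). R \<mu> * schur_Q t \<mu>)))"

text \<open>The core matrix conjugated by the diagonal matrix with entries \<open>(-1)\<^sup>i\<close>.  This rescaling
  absorbs the sign \<open>(-1)\<close> to the power \<open>|\<mu>|\<close> with which the complementary minors occur in the
  expansion of the Pfaffian along its block of Schur Q-functions.\<close>

definition cartan_matrix ::
    "nat \<Rightarrow> nat set \<Rightarrow> (label \<Rightarrow> label \<Rightarrow> complex) \<Rightarrow> label \<Rightarrow> label \<Rightarrow> complex" where
  "cartan_matrix N la r a b = (-1) powi (label_val a) * (-1) powi (label_val b) * core_matrix N la r a b"

definition minor_labels :: "nat \<Rightarrow> nat set \<Rightarrow> label list" where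
  "minor_labels N \<mu> = filter (\<lambda>a. a \<notin> NegL ` set (augmented \<mu>)) (labels N)"


section \<open>Consistency with the intended structures\<close>

lemma skew_unit_skew: "skew_unit i j b a = - skew_unit i j a b"
  unfolding skew_unit_def matrix_unit_def minus_diff_eq by (simp only: conj_commute)


lemma core_matrix_skew: "core_matrix N la r b a = - core_matrix N la r a b"
proof -
  have e: "skew_unit i j b a = - skew_unit i j a b" for i j by (rule skew_unit_skew)
  show ?thesis
    unfolding core_matrix_def e mult_minus_right sum_negf case_prod_unfold minus_add_distrib by (rule refl)
qed

lemma W_matrix_skew: "W_matrix N la r t b a = - W_matrix N la r t a b"
proof -
  have e: "skew_unit i j b a = - skew_unit i j a b" for i j by (rule skew_unit_skew)
  have "Q_block N t b a = - Q_block N t a b"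
    unfolding Q_block_def e mult_minus_right sum_negf by (rule refl)
  then show ?thesis
    unfolding W_matrix_def using core_matrix_skew[of N la r b a] by simp
qed


lemma cartan_matrix_skew: "cartan_matrix N la r b a = - cartan_matrix N la r a b"
  unfolding cartan_matrix_def core_matrix_skew[of N la r b a] mult_minus_right
  by (subst mult.commute[of "(-1) powi label_val b"]) (rule refl)

lemma sign_above_insert:
  assumes "finite \<mu>" "a \<notin> \<mu>"
  shows "sign_above b (insert a \<mu>) = (if b < a then -1 else 1) * sign_above b \<mu>"
proof -
  have "{m \<in> insert a \<mu>. b < m} = (if b < a then insert a {m \<in> \<mu>. b < m} else {m \<in> \<mu>. b < m})"
    by auto
  then show ?thesis using assms by (simp add: sign_above_def)
qed

lemma sign_above_remove:
  assumes "finite \<mu>" "a \<in> \<mu>"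
  shows "sign_above b (\<mu> - {a}) = (if b < a then -1 else 1) * sign_above b \<mu>"
proof -
  have "insert a (\<mu> - {a}) = \<mu>" using assms by auto
  then have "sign_above b \<mu> = (if b < a then -1 else 1) * sign_above b (\<mu> - {a})"
    using sign_above_insert[of "\<mu> - {a}" a b] assms(1) by (metis Diff_iff finite_Diff singletonI)
  then show ?thesis
    by (cases "b < a") simp_all
qed

lemma sign_above_square: "sign_above b \<mu> * (sign_above b \<mu> * x) = x"
  unfolding sign_above_def by (simp flip: mult.assoc power_mult_distrib)

lemma sign_card_remove:
  assumes "finite \<mu>" "a \<in> \<mu>"
  shows "(-1 :: complex) ^ card (\<mu> - {a}) = - ((-1) ^ card \<mu>)"
  unfolding card.remove[OF assms] power_Suc
  by (simp only: mult_minus_left mult_1 minus_minus)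

lemma clifford_gen_zero:
  "clifford_gen 0 s \<mu> = (-1) ^ card \<mu> / complex_of_real (sqrt 2) * s \<mu>"
  by (simp add: clifford_gen_def Let_def)

lemma clifford_gen_pos:
  "a > 0 \<Longrightarrow> clifford_gen (int a) s \<mu>
    = (if a \<in> \<mu> then sign_above a \<mu> * s (\<mu> - {a}) else 0)"
  by (simp add: clifford_gen_def Let_def)

lemma clifford_gen_neg:
  "a > 0 \<Longrightarrow> clifford_gen (- int a) s \<mu>
    = (if a \<in> \<mu> then 0 else (-1) ^ a * sign_above a \<mu> * s (insert a \<mu>))"
  by (simp add: clifford_gen_def Let_def)


lemma clifford_gen_vacuum_neg:
  assumes "a > 0"
  shows "clifford_gen (- int a) vacuum = (\<lambda>\<mu>. 0)"
proof
  fix \<mu>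
  have "insert a \<mu> \<noteq> {}" by (rule insert_not_empty)
  then show "clifford_gen (- int a) vacuum \<mu> = 0"
    unfolding clifford_gen_neg[OF assms] vacuum_def by (simp only: if_False mult_zero_right if_cancel)
qed

lemma clifford_gen_vacuum_zero:
  "clifford_gen 0 vacuum = (\<lambda>\<mu>. vacuum \<mu> / complex_of_real (sqrt 2))"
proof
  fix \<mu> :: "nat set"
  show "clifford_gen 0 vacuum \<mu> = vacuum \<mu> / complex_of_real (sqrt 2)"
    unfolding clifford_gen_zero vacuum_def by (cases "\<mu> = {}") simp_all
qed

lemma anticommute_pos_neg:
  assumes "finite \<mu>" "a > 0" "b > 0"
  shows "clifford_gen (int a) (clifford_gen (- int b) s) \<mu>
      + clifford_gen (- int b) (clifford_gen (int a) s) \<mu>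
    = (if a = b then (-1) ^ a else 0) * s \<mu>"
proof (cases "a = b")
  case True
  then show ?thesis using assms
    by (cases "a \<in> \<mu>") (simp_all add: clifford_gen_pos clifford_gen_neg sign_above_insert
      sign_above_remove insert_absorb sign_above_square mult.left_commute)
next
  case False
  then have "insert b (\<mu> - {a}) = insert b \<mu> - {a}" by auto
  then show ?thesis using assms False
    by (cases "a \<in> \<mu>"; cases "b \<in> \<mu>"; cases "a < b")
      (simp_all add: clifford_gen_pos clifford_gen_neg sign_above_insert sign_above_remove
        not_less mult.left_commute)
qed

lemma anticommute_zero:
  assumes "finite \<mu>" "j \<noteq> 0"
  shows "clifford_gen 0 (clifford_gen j s) \<mu> + clifford_gen j (clifford_gen 0 s) \<mu> = 0"
proof (cases "j > 0")
  case True
  then obtain a where "j = int a" "a > 0" by (metis zero_less_imp_eq_int)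
  then show ?thesis using assms
    by (simp add: clifford_gen_zero clifford_gen_pos sign_card_remove mult.left_commute
        del: card_Diff_insert card_Diff_singleton)
next
  case False
  then obtain a where "j = - int a" "a > 0"
    using assms(2) by (metis add.inverse_inverse neg_0_less_iff_less not_less_iff_gr_or_eq zero_less_imp_eq_int)
  then show ?thesis using assms
    by (simp add: clifford_gen_zero clifford_gen_neg)
qed

lemma clifford_gen_anticommute:
  assumes "finite \<mu>"
  shows "clifford_gen i (clifford_gen j s) \<mu> + clifford_gen j (clifford_gen i s) \<mu>
    = (if i = - j then (-1) powi i else 0) * s \<mu>"
proof -
  have r2: "complex_of_real (sqrt 2) * complex_of_real (sqrt 2) = 2"
    by (simp flip: of_real_mult)
  have sq: "(-1 :: complex) ^ k * (-1) ^ k = 1" for k :: nat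
    by (simp flip: power_mult_distrib)
  have z2: "clifford_gen 0 (clifford_gen 0 s) \<mu> = s \<mu> / 2"
  proof -
    have "clifford_gen 0 (clifford_gen 0 s) \<mu> = ((-1) ^ card \<mu> * (-1) ^ card \<mu>)
        / (complex_of_real (sqrt 2) * complex_of_real (sqrt 2)) * s \<mu>"
      by (simp only: clifford_gen_zero times_divide_times_eq ac_simps times_divide_eq_right times_divide_eq_left divide_divide_eq_left)
    then show ?thesis by (simp only: r2 sq) simp
  qed
  have sgn_cases: "k = 0 \<or> (\<exists>a>0. k = int a) \<or> (\<exists>a>0. k = - int a)" for k :: int
    by (cases k rule: int_cases3) auto
  consider (z) "i = 0" "j = 0" | (zl) "i = 0" "j \<noteq> 0" | (zr) "i \<noteq> 0" "j = 0"
    | (pp) a b where "i = int a" "j = int b" "a > 0" "b > 0"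
    | (pn) a b where "i = int a" "j = - int b" "a > 0" "b > 0"
    | (np) a b where "i = - int a" "j = int b" "a > 0" "b > 0"
    | (nn) a b where "i = - int a" "j = - int b" "a > 0" "b > 0"
    using sgn_cases[of i] sgn_cases[of j] by metis
  then show ?thesis
  proof cases
    case z
    then show ?thesis by (simp add: z2)
  next
    case zl
    then show ?thesis using anticommute_zero[OF assms, of j s] by simp
  next
    case zr
    then show ?thesis using anticommute_zero[OF assms, of i s] by (simp add: add.commute)
  next
    case pp
    have "\<mu> - {a} - {b} = \<mu> - {b} - {a}" by auto
    then show ?thesis using assms pp
      by (cases "a \<in> \<mu>"; cases "b \<in> \<mu>"; cases a b rule: linorder_cases)
        (simp_all add: clifford_gen_pos sign_above_remove mult.left_commute)
  next
    case nn
    have "insert a (insert b \<mu>) = insert b (insert a \<mu>)" by auto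
    then show ?thesis using assms nn
      by (cases "a \<in> \<mu>"; cases "b \<in> \<mu>"; cases a b rule: linorder_cases)
        (simp_all add: clifford_gen_neg sign_above_insert mult.left_commute)
  next
    case pn
    then show ?thesis using anticommute_pos_neg[OF assms, of a b s]
      by (simp add: power_int_def)
  next
    case np
    then show ?thesis using anticommute_pos_neg[OF assms, of b a s]
      by (auto simp: power_int_minus power_int_def add.commute)
  qed
qed

lemma clifford_gen_basis:
  assumes "sorted_wrt (>) ms" "0 \<notin> set ms"
  shows "foldr (\<lambda>m. clifford_gen (int m)) ms vacuum = (\<lambda>\<mu>. if \<mu> = set ms then 1 else 0)"
  using assms
proof (induction ms)
  case Nil
  then show ?case by (simp add: vacuum_def)
next
  case (Cons a ms)
  then have a: "a > 0" "a \<notin> set ms" "\<And>m. m \<in> set ms \<Longrightarrow> m < a" by auto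
  have "{m \<in> insert a (set ms). a < m} = {}" using a(3) by fastforce
  then have e: "sign_above a (insert a (set ms)) = 1" unfolding sign_above_def by (simp only: card.empty power_0)
  have eq: "a \<in> \<mu> \<and> \<mu> - {a} = set ms \<longleftrightarrow> \<mu> = insert a (set ms)" for \<mu>
    using a(2) by auto
  have "clifford_gen (int a) (\<lambda>\<mu>. if \<mu> = set ms then 1 else 0) \<mu>
      = (if \<mu> = insert a (set ms) then 1 else 0)" for \<mu>
    unfolding clifford_gen_pos[OF a(1)] using eq[of \<mu>] e by (auto simp del: insert_iff)
  moreover have "foldr (\<lambda>m. clifford_gen (int m)) ms vacuum = (\<lambda>\<mu>. if \<mu> = set ms then 1 else 0)"
    using Cons by simp
  ultimately show ?case by (intro ext) (simp only: foldr_Cons o_apply list.set)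
qed

end

theory Submission
  imports Defs
begin

text \<open>A nonzero spinor \<open>s\<close> is pure if and only if \<open>\<Sum>\<^sub>i (-1)\<^sup>i e\<^sub>i s \<otimes> e\<^sub>-\<^sub>i s = s \<otimes> s / 2\<close>, and every coordinate of
  this identity is a finite quadratic relation.  Its contraction with a coordinate \<open>\<nu>\<close> is the action on \<open>s\<close>
  of a vector \<open>x\<^sub>\<nu>\<close> with \<open>\<Psi>(w, x\<^sub>\<nu>) = (w s)\<^sub>\<nu>\<close>, which is therefore orthogonal to the annihilator of \<open>s\<close>.  If the
  coordinate of \<open>s\<close> at \<open>\<lambda>\<close> is nonzero, then combinations of the \<open>x\<^sub>\<nu>\<close> annihilate \<open>s\<close> and determine it up to a
  scalar; a pure spinor is thus determined by its coordinates at distance at most two from \<open>\<lambda>\<close>.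

  The Pfaffian minors of any skew-symmetric matrix satisfy the same relations: expand a product of two
  Pfaffians along a row of either factor.  They are the coefficients of the \<open>Q\<^sub>\<mu>\<close> in \<open>Pf(W\<^sub>\<lambda>)\<close>, by expansion
  along its block of Schur Q-functions and by linear independence of the \<open>Q\<^sub>\<mu>\<close>: when a variable \<open>x\<close> is added
  to the alphabet, the leading term of \<open>Q\<^sub>\<mu>\<close> in \<open>x\<close> has degree \<open>\<mu>\<^sub>1\<close>, and its coefficient is a multiple of the
  \<open>Q\<close>-function of \<open>\<mu>\<close> without the part \<open>\<mu>\<^sub>1\<close>.  For a given pure spinor take \<open>\<lambda>\<close> with nonzero coordinate and
  minimal \<open>\<Sum>\<^sub>k 2\<^sup>k\<close> over its parts \<open>k\<close>.  The coordinates at distance at most two from \<open>\<lambda>\<close> then either vanish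
  or are, up to sign and scale, the free parameters \<open>r\<close>.\<close>

section \<open>Pfaffians\<close>

text \<open>The obstacle on the way from a Lagrangian subspace to the relations is that maximality
  alone has to produce elements of the annihilator. The vectors \<open>x_\<nu>\<close> are
  orthogonal to it but not isotropic in general. Since
  \<open>\<Psi>(x_\<lambda>, x_\<lambda>) = s_\<lambda>^2 / 2\<close> is nonzero, some complex
  multiple of \<open>x_\<lambda>\<close> can be subtracted from \<open>x_\<nu>\<close> so that the
  difference is isotropic, and maximality then puts it into the annihilator. The weight in powers of
  2 is dictated by the parameters: \<open>r_(i,j)\<close> exists only for a positive label
  \<open>i\<close>, hence only if \<open>i\<close> is not a part of \<open>\<lambda>\<close>.
  Coordinates reached from \<open>\<lambda>\<close> by removing a part \<open>i\<close> and possibly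
  toggling some \<open>j < i\<close> have no parameter, so minimality has to make them zero;
  \<open>2^i\<close> outweighs \<open>2^j\<close>. In the independence argument single products in
  the Pfaffian grow faster than \<open>x\<close> to the power \<open>\<mu>_1\<close>. Subtracting
  from each row a multiple of the next one makes this cancellation visible in the entries. For
  \<open>n = \<infinity>\<close> no topology is involved: a finite index set bounds the positive
  indices that act on it, and vectors have finitely many negative ones.\<close>

fun row_contract :: "('a \<Rightarrow> 'a \<Rightarrow> complex) \<Rightarrow> 'a \<Rightarrow> 'a list \<Rightarrow> ('a list \<Rightarrow> complex) \<Rightarrow> complex" where
  "row_contract A x [] f = 0"
| "row_contract A x (y # ys) f = A x y * f ys - row_contract A x ys (\<lambda>zs. f (y # zs))"

text \<open>\<open>row_contract A x ys f\<close> is the alternating expansion along row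
  \<open>x\<close>, with \<open>f\<close> applied to \<open>ys\<close> without the partner of
  \<open>x\<close>. The condition on \<open>length zs\<close> is what makes the recursion of
  \<open>rec_pf\<close> through \<open>f\<close> terminate.\<close>

lemma row_contract_cong [fundef_cong]:
  assumes "A = A'" "x = x'" "ys = ys'" "\<And>zs. Suc (length zs) = length ys' \<Longrightarrow> f zs = g zs"
  shows "row_contract A x ys f = row_contract A' x' ys' g"
proof -
  have "row_contract A x ys f = row_contract A x ys g"
    if "\<And>zs. Suc (length zs) = length ys \<Longrightarrow> f zs = g zs" for ys
    using that
  proof (induction ys arbitrary: f g)
    case (Cons y ys)
    have "row_contract A x ys (\<lambda>zs. f (y # zs)) = row_contract A x ys (\<lambda>zs. g (y # zs))"
      by (rule Cons.IH, rule Cons.prems) simp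
    moreover have "f ys = g ys"
      by (rule Cons.prems) simp
    ultimately show ?case
      by (simp only: row_contract.simps)
  qed (simp only: row_contract.simps)
  then show ?thesis
    unfolding assms(1-3) using assms(4) by blast
qed

function rec_pf :: "('a \<Rightarrow> 'a \<Rightarrow> complex) \<Rightarrow> 'a list \<Rightarrow> complex" where
  "rec_pf A [] = 1"
| "rec_pf A (x # xs) = row_contract A x xs (rec_pf A)"
  by pat_completeness auto
termination by (relation "measure (\<lambda>(A, xs). length xs)") auto

definition skew :: "('a \<Rightarrow> 'a \<Rightarrow> complex) \<Rightarrow> bool" where
  "skew A \<longleftrightarrow> (\<forall>x y. A y x = - A x y)"

lemma skewD: "skew A \<Longrightarrow> A y x = - A x y"
  unfolding skew_def by blast

lemma skew_diag:
  assumes "skew A"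
  shows "A x x = 0"
proof -
  have "2 * A x x = A x x + A x x" by simp
  also have "\<dots> = 0" by (subst skewD[OF assms, of x x]) simp
  finally show ?thesis by simp
qed

lemma row_contract_add:
  "row_contract A x ys (\<lambda>zs. f zs + g zs) = row_contract A x ys f + row_contract A x ys g"
  by (induction ys arbitrary: f g) (simp_all add: algebra_simps)

lemma row_contract_cmult: "row_contract A x ys (\<lambda>zs. c * f zs) = c * row_contract A x ys f"
  by (induction ys arbitrary: f) (simp_all add: algebra_simps)

lemma row_contract_minus: "row_contract A x ys (\<lambda>zs. - f zs) = - row_contract A x ys f"
  using row_contract_cmult[of A x ys "-1" f] by simp

lemma row_contract_diff:
  "row_contract A x ys (\<lambda>zs. f zs - g zs) = row_contract A x ys f - row_contract A x ys g"
  using row_contract_add[of A x ys f "\<lambda>zs. - g zs"] by (simp add: row_contract_minus)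

text \<open>Row contractions are interior products by covectors on an exterior algebra, and these
  anticommute.\<close>

lemma row_contract_anticommute:
  "row_contract A x vs (\<lambda>zs. row_contract A y zs f) = - row_contract A y vs (\<lambda>zs. row_contract A x zs f)"
proof (induction vs arbitrary: f)
  case (Cons v vs)
  show ?case
    using Cons[of "\<lambda>w. f (v # w)"] by (simp add: row_contract_diff row_contract_cmult)
qed simp

lemma row_contract_swap:
  assumes "\<And>ps qs. length ps + length qs + 1 = length us + length vs \<Longrightarrow> f (ps @ x # y # qs) = - f (ps @ y # x # qs)"
  shows "row_contract A u (us @ x # y # vs) f = - row_contract A u (us @ y # x # vs) f"
  using assms
proof (induction us arbitrary: f)
  case Nil
  have "row_contract A u vs (\<lambda>zs. f (x # y # zs)) = row_contract A u vs (\<lambda>zs. - f (y # x # zs))"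
    using Nil[of "[]"] by (intro row_contract_cong) auto
  then show ?case by (simp add: row_contract_minus)
next
  case (Cons a us)
  have "f (us @ x # y # vs) = - f (us @ y # x # vs)" by (rule Cons.prems) simp
  moreover have "row_contract A u (us @ x # y # vs) (\<lambda>zs. f (a # zs)) = - row_contract A u (us @ y # x # vs) (\<lambda>zs. f (a # zs))"
    by (rule Cons.IH) (use Cons.prems[of "a # _"] in auto)
  ultimately show ?case by simp
qed

text \<open>At the front of the list, expanding both rows leaves the entry \<open>A x y\<close>,
  which changes sign by skewness, and a double contraction, which anticommutes. Further back, the
  swap persists in every term of the expansion of the first row except the two in which
  \<open>x\<close> or \<open>y\<close> is the partner, and these two trade places with opposite
  signs.\<close>

lemma rec_pf_swap_adjacent:
  assumes "skew A"
  shows "rec_pf A (us @ x # y # vs) = - rec_pf A (us @ y # x # vs)"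
proof (induction "length us + length vs" arbitrary: us vs rule: less_induct)
  case less
  show ?case
  proof (cases us)
    case Nil
    have "row_contract A x vs (\<lambda>zs. rec_pf A (y # zs)) = - row_contract A y vs (\<lambda>zs. rec_pf A (x # zs))"
      by (simp add: row_contract_anticommute[of A x])
    then show ?thesis using Nil skewD[OF assms, of x y] by simp
  next
    case (Cons u us')
    have "rec_pf A (ps @ x # y # qs) = - rec_pf A (ps @ y # x # qs)"
      if "length ps + length qs + 1 = length us' + length vs" for ps qs
      by (rule less) (use that Cons in simp)
    then show ?thesis
      unfolding Cons append_Cons rec_pf.simps(2) by (rule row_contract_swap)
  qed
qed

lemma minus_one_power_cancel: "(-1 :: complex) ^ k * ((-1) ^ k * z) = z"
  by (cases "even k") simp_all

lemma rec_pf_move: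
  assumes "skew A"
  shows "rec_pf A (us @ x # vs @ ws) = (-1) ^ length vs * rec_pf A (us @ vs @ x # ws)"
proof (induction vs arbitrary: us)
  case (Cons v vs)
  show ?case
    using rec_pf_swap_adjacent[OF assms, of us x v "vs @ ws"] Cons[of "us @ [v]"] by simp
qed simp

lemma rec_pf_move_front:
  assumes "skew A"
  shows "rec_pf A (us @ x # ws) = (-1) ^ length us * rec_pf A (x # us @ ws)"
  using rec_pf_move[OF assms, of "[]" x us ws] by (simp add: minus_one_power_cancel)

lemma rec_pf_swap:
  assumes "skew A"
  shows "rec_pf A (us @ x # vs @ y # ws) = - rec_pf A (us @ y # vs @ x # ws)"
proof -
  have "rec_pf A (us @ x # vs @ y # ws) = (-1) ^ length vs * rec_pf A (us @ vs @ x # y # ws)"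
    by (rule rec_pf_move[OF assms])
  also have "rec_pf A (us @ vs @ x # y # ws) = - rec_pf A (us @ vs @ y # x # ws)"
    using rec_pf_swap_adjacent[OF assms, of "us @ vs" x y ws] by (simp only: append_assoc)
  also have "(-1) ^ length vs * - rec_pf A (us @ vs @ y # x # ws) = - rec_pf A (us @ y # vs @ x # ws)"
    by (simp only: rec_pf_move[OF assms, of us y vs "x # ws"] mult_minus_right)
  finally show ?thesis .
qed

lemma rec_pf_odd: "odd (length xs) \<Longrightarrow> rec_pf A xs = 0"
proof (induction "length xs" arbitrary: xs rule: less_induct)
  case less
  show ?case
  proof (cases xs)
    case (Cons x ys)
    have "rec_pf A zs = 0" if "Suc (length zs) = length ys" for zs
      by (rule less) (use less.prems Cons in \<open>simp_all flip: that\<close>)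
    then have "row_contract A x ys (rec_pf A) = row_contract A x ys (\<lambda>zs. 0)"
      by (intro row_contract_cong) simp_all
    also have "\<dots> = 0"
      using row_contract_cmult[of A x ys 0 "\<lambda>zs. 0"] by simp
    finally show ?thesis using Cons by simp
  qed (use less in auto)
qed

lemma row_contract_sum:
  "row_contract A x ys f = (\<Sum>k<length ys. (-1) ^ k * A x (ys ! k) * f (take k ys @ drop (Suc k) ys))"
proof (induction ys arbitrary: f)
  case (Cons y ys)
  then show ?case by (simp add: sum.lessThan_Suc_shift sum_negf del: sum.lessThan_Suc)
qed simp

lemma upt_split:
  assumes "a \<le> b" "b < n"
  shows "[a..<n] = [a..<b] @ b # [Suc b..<n]"
proof -
  have "[a..<n] = [a..<b] @ [b..<n]"
    using assms upt_add_eq_append[of a b "n - b"] by simp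
  also have "[b..<n] = b # [Suc b..<n]"
    using assms(2) by (rule upt_conv_Cons)
  finally show ?thesis .
qed

lemma rec_pf_permute:
  assumes "skew A" "p permutes {..<n}"
  shows "rec_pf A (map (f \<circ> p) [0..<n]) = of_int (sign p) * rec_pf A (map f [0..<n])"
  using assms(2) finite_lessThan
proof (induction p arbitrary: f rule: permutes_induct)
  case id
  then show ?case by simp
next
  case (swap a b p)
  have *: "rec_pf A (map (f \<circ> transpose a b) [0..<n]) = - rec_pf A (map f [0..<n])"
    if "a < b" "b < n" for a b
  proof -
    have s: "[0..<n] = [0..<a] @ a # [Suc a..<b] @ b # [Suc b..<n]"
      using that upt_split[of 0 a n] upt_split[of "Suc a" b n] by simp
    have m: "map (f \<circ> transpose a b) [0..<n] = map f [0..<a] @ f b # map f [Suc a..<b] @ f a # map f [Suc b..<n]"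
      unfolding s using that by (auto simp: transpose_def)
    have m': "map f [0..<n] = map f [0..<a] @ f a # map f [Suc a..<b] @ f b # map f [Suc b..<n]"
      unfolding s by simp
    show ?thesis
      unfolding m m' by (rule rec_pf_swap[OF assms(1)])
  qed
  have "rec_pf A (map (f \<circ> transpose a b) [0..<n]) = - rec_pf A (map f [0..<n])"
    using *[of a b] *[of b a] swap.hyps by (cases "a < b") (auto simp: transpose_commute)
  moreover have "rec_pf A (map (f \<circ> (transpose a b \<circ> p)) [0..<n]) = of_int (sign p) * rec_pf A (map (f \<circ> transpose a b) [0..<n])"
    using swap.IH[of "f \<circ> transpose a b"] by (simp only: comp_assoc)
  moreover have "sign (transpose a b \<circ> p) = - sign p"
    using swap.hyps by (subst sign_compose) (auto simp: sign_swap_id permutation_swap_id intro: permutes_imp_permutation[OF finite_lessThan])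
  ultimately show ?case by (simp only: of_int_minus mult_minus_right mult_minus_left)
qed


text \<open>Expanding row \<open>2 * j\<close> of the remaining Pfaffian gives
  \<open>2 * (m - j) - 1\<close> terms. Composing \<open>\<sigma>\<close> with the transposition of
  \<open>2 * j + 1\<close> and \<open>2 * j + 1 + k\<close> carries the term \<open>k\<close> to the
  term \<open>0\<close>, so after summation over all permutations the terms contribute
  equally.\<close>

lemma sum_permutes_rec_pf_step:
  fixes f :: "nat \<Rightarrow> 'a"
  assumes "skew A" "j < m"
  shows "(\<Sum>\<sigma> | \<sigma> permutes {..<2 * m}. of_int (sign \<sigma>) * ((\<Prod>i<j. A (f (\<sigma> (2 * i))) (f (\<sigma> (2 * i + 1))))
            * rec_pf A (map (f \<circ> \<sigma>) [2 * j..<2 * m])))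
       = of_nat (2 * (m - j) - 1) * (\<Sum>\<sigma> | \<sigma> permutes {..<2 * m}. of_int (sign \<sigma>) *
            ((\<Prod>i<Suc j. A (f (\<sigma> (2 * i))) (f (\<sigma> (2 * i + 1)))) * rec_pf A (map (f \<circ> \<sigma>) [2 * Suc j..<2 * m])))"
    (is "?L = of_nat ?c * sum ?g ?S")
proof -
  define P where "P \<sigma> = (\<Prod>i<j. A (f (\<sigma> (2 * i))) (f (\<sigma> (2 * i + 1))))" for \<sigma>
  define T where "T \<sigma> k = of_int (sign \<sigma>) * (P \<sigma> * ((-1) ^ k * A (f (\<sigma> (2 * j))) (f (\<sigma> (2 * j + 1 + k)))
      * rec_pf A (map (f \<circ> \<sigma>) ([2 * j + 1..<2 * j + 1 + k] @ [2 * j + 2 + k..<2 * m]))))" for \<sigma> k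
  have row: "rec_pf A (map (f \<circ> \<sigma>) [2 * j..<2 * m]) = (\<Sum>k<?c. (-1) ^ k * A (f (\<sigma> (2 * j))) (f (\<sigma> (2 * j + 1 + k)))
      * rec_pf A (map (f \<circ> \<sigma>) ([2 * j + 1..<2 * j + 1 + k] @ [2 * j + 2 + k..<2 * m])))" for \<sigma>
  proof -
    have "[2 * j..<2 * m] = 2 * j # [2 * j + 1..<2 * m]"
      using assms(2) upt_conv_Cons[of "2 * j" "2 * m"] by simp
    moreover have "length [2 * j + 1..<2 * m] = ?c" using assms(2) by simp
    moreover have "take k [2 * j + 1..<2 * m] = [2 * j + 1..<2 * j + 1 + k]" if "k < ?c" for k
      using that by (simp add: take_upt)
    ultimately show ?thesis
      by (simp add: row_contract_sum take_map drop_map drop_upt del: upt_Suc cong: sum.cong)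
        (intro sum.cong refl, simp add: take_map drop_map)
  qed
  have "?L = (\<Sum>\<sigma>\<in>?S. \<Sum>k<?c. T \<sigma> k)"
    unfolding row T_def P_def by (simp only: sum_distrib_left)
  also have "\<dots> = (\<Sum>k<?c. \<Sum>\<sigma>\<in>?S. T \<sigma> k)" by (rule sum.swap)
  also have "\<dots> = (\<Sum>k<?c. sum ?g ?S)"
  proof (rule sum.cong[OF refl])
    fix k assume "k \<in> {..<?c}"
    then have k: "k < ?c" by simp
    define q where "q = transpose (2 * j + 1) (2 * j + 1 + k)"
    have q: "q permutes {..<2 * m}"
      unfolding q_def using k by (intro permutes_swap_id) auto
    have "T (\<sigma> \<circ> q) k = ?g \<sigma>" if \<sigma>: "\<sigma> permutes {..<2 * m}" for \<sigma>
    proof -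
      have P: "P (\<sigma> \<circ> q) = P \<sigma>"
        unfolding P_def by (intro prod.cong refl) (auto simp: q_def transpose_def)
      have A: "A (f ((\<sigma> \<circ> q) (2 * j))) (f ((\<sigma> \<circ> q) (2 * j + 1 + k))) = A (f (\<sigma> (2 * j))) (f (\<sigma> (2 * j + 1)))"
        by (simp add: q_def transpose_def)
      have sg: "sign (\<sigma> \<circ> q) = sign \<sigma> * sign q"
        using \<sigma> q by (intro sign_compose) (auto intro: permutes_imp_permutation[OF finite_lessThan])
      \<comment> \<open>For \<open>k > 0\<close> the sign of the transposition and
        \<open>(-1) ^ k\<close> cancel against moving the displaced entry back over
        \<open>k - 1\<close> others.\<close>
      have e: "of_int (sign q) * (-1) ^ k * rec_pf A (map (f \<circ> (\<sigma> \<circ> q)) ([2 * j + 1..<2 * j + 1 + k] @ [2 * j + 2 + k..<2 * m]))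
          = rec_pf A (map (f \<circ> \<sigma>) [2 * Suc j..<2 * m])"
      proof (cases k)
        case 0
        then show ?thesis by (simp add: q_def)
      next
        case (Suc k')
        have s: "sign q = -1" using Suc by (simp add: q_def sign_swap_id)
        let ?us = "map (f \<circ> \<sigma>) [2 * j + 2..<2 * j + 1 + k]"
        let ?x = "f (\<sigma> (2 * j + 1 + k))"
        let ?ws = "map (f \<circ> \<sigma>) [2 * j + 2 + k..<2 * m]"
        have l1: "map (f \<circ> (\<sigma> \<circ> q)) [2 * j + 1..<2 * j + 1 + k] = ?x # ?us"
          using Suc by (subst upt_conv_Cons) (auto simp: q_def transpose_def simp del: upt_Suc)
        have l2: "map (f \<circ> (\<sigma> \<circ> q)) [2 * j + 2 + k..<2 * m] = ?ws"
          by (auto simp: q_def transpose_def)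
        have l3: "[2 * Suc j..<2 * m] = [2 * j + 2..<2 * j + 1 + k] @ (2 * j + 1 + k) # [2 * j + 2 + k..<2 * m]"
          using k Suc upt_split[of "2 * j + 2" "2 * j + 1 + k" "2 * m"] by (simp del: upt_Suc)
        have l4: "rec_pf A (?us @ ?x # ?ws) = (-1) ^ k' * rec_pf A (?x # ?us @ ?ws)"
          using rec_pf_move_front[OF assms(1), of ?us ?x ?ws] Suc by (simp del: upt_Suc rec_pf.simps)
        show ?thesis
          unfolding map_append l1 l2 l3 list.map(2) comp_apply[of f \<sigma> "2 * j + 1 + k"] append_Cons l4
          using s Suc by (simp only: power_Suc) simp
      qed
      show ?thesis
        unfolding T_def P A sg e[symmetric] unfolding P_def prod.lessThan_Suc of_int_mult by (simp only: ac_simps)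
    qed
    then show "(\<Sum>\<sigma>\<in>?S. T \<sigma> k) = sum ?g ?S"
      unfolding sum_permutations_compose_right[OF q, of "\<lambda>\<sigma>. T \<sigma> k"] by (intro sum.cong) auto
  qed
  finally show ?thesis by (simp only: sum_constant card_lessThan)
qed

text \<open>In \<open>G j\<close> the first \<open>j\<close> pairs of rows are already expanded.
  \<open>G 0\<close> consists of \<open>(2 m)!\<close> equal terms, \<open>G m\<close> is the
  permutation sum, and the factors of the steps multiply to
  \<open>(2 m - 1)!! = (2 m)! / (2 ^ m * m!)\<close>, which is the normalisation in
  \<open>pfaffian\<close>.\<close>

lemma pfaffian_eq_rec_pf:
  assumes "skew A"
  shows "pfaffian xs A = rec_pf A xs"
proof (cases "even (length xs)")
  case False
  then show ?thesis by (simp add: pfaffian_def rec_pf_odd)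
next
  case True
  then obtain m where m: "length xs = 2 * m" by (elim evenE)
  define G where "G j = (\<Sum>\<sigma> | \<sigma> permutes {..<2 * m}. of_int (sign \<sigma>) *
    ((\<Prod>i<j. A (xs ! \<sigma> (2 * i)) (xs ! \<sigma> (2 * i + 1))) * rec_pf A (map ((!) xs \<circ> \<sigma>) [2 * j..<2 * m])))" for j
  have step: "G j = of_nat (2 * (m - j) - 1) * G (Suc j)" if "j < m" for j
    unfolding G_def by (rule sum_permutes_rec_pf_step[OF assms that])
  have "G (m - i) * (2 ^ i * fact i) = fact (2 * i) * G m" if "i \<le> m" for i
    using that
  proof (induction i)
    case (Suc i)
    have "G (m - Suc i) = of_nat (2 * Suc i - 1) * G (m - i)"
      using step[of "m - Suc i"] Suc.prems by (simp add: Suc_diff_Suc)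
    moreover have "fact (2 * Suc i) = (of_nat (2 * Suc i) * of_nat (2 * Suc i - 1) * fact (2 * i) :: complex)"
      by (simp add: algebra_simps)
    moreover have "2 ^ Suc i * fact (Suc i) = (of_nat (2 * Suc i) * (2 ^ i * fact i) :: complex)"
      by (simp add: algebra_simps)
    ultimately show ?case using Suc by (simp only: ac_simps) simp
  qed simp
  from this[of m] have "G 0 * (2 ^ m * fact m) = fact (2 * m) * G m" by simp
  moreover have "G 0 = fact (2 * m) * rec_pf A xs"
  proof -
    have "G 0 = (\<Sum>\<sigma> | \<sigma> permutes {..<2 * m}. rec_pf A xs)"
      unfolding G_def
    proof (intro sum.cong refl)
      fix \<sigma> assume "\<sigma> \<in> {\<sigma>. \<sigma> permutes {..<2 * m}}"
      then have "rec_pf A (map ((!) xs \<circ> \<sigma>) [0..<2 * m]) = of_int (sign \<sigma>) * rec_pf A xs"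
        using rec_pf_permute[OF assms, of \<sigma> "2 * m" "(!) xs"] map_nth[of xs] m by simp
      then show "of_int (sign \<sigma>) * ((\<Prod>i<0. A (xs ! \<sigma> (2 * i)) (xs ! \<sigma> (2 * i + 1)))
          * rec_pf A (map ((!) xs \<circ> \<sigma>) [2 * 0..<2 * m])) = rec_pf A xs"
        by (simp flip: of_int_mult mult.assoc)
    qed
    then show ?thesis by (simp add: card_permutations[of _ "2 * m"])
  qed
  moreover have "G m = (\<Sum>\<sigma> | \<sigma> permutes {..<2 * m}. of_int (sign \<sigma>) * (\<Prod>i<m. A (xs ! \<sigma> (2 * i)) (xs ! \<sigma> (2 * i + 1))))"
    unfolding G_def by simp
  ultimately show ?thesis
    unfolding pfaffian_def m by (simp add: field_simps)
qed

section \<open>Pfaffians indexed by finite subsets of a linear order\<close>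

definition set_pf :: "('a::linorder \<Rightarrow> 'a \<Rightarrow> complex) \<Rightarrow> 'a set \<Rightarrow> complex" where
  "set_pf A K = rec_pf A (sorted_list_of_set K)"

definition sign_below :: "'a::linorder \<Rightarrow> 'a set \<Rightarrow> complex" where
  "sign_below x K = (-1) ^ card {z \<in> K. z < x}"

lemma sign_below_cancel: "sign_below x K * (sign_below x K * z) = z"
  unfolding sign_below_def by (rule minus_one_power_cancel)

lemma sign_below_insert_smaller:
  "finite K \<Longrightarrow> y \<notin> K \<Longrightarrow> y < x \<Longrightarrow> sign_below x (insert y K) = - sign_below x K"
proof -
  assume a: "finite K" "y \<notin> K" "y < x"
  then have "{z \<in> insert y K. z < x} = insert y {z \<in> K. z < x}" by auto
  then show ?thesis using a by (simp add: sign_below_def)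
qed

lemma sign_below_insert_larger: "\<not> y < x \<Longrightarrow> sign_below x (insert y K) = sign_below x K"
proof -
  assume "\<not> y < x"
  then have "{z \<in> insert y K. z < x} = {z \<in> K. z < x}" by auto
  then show ?thesis by (simp add: sign_below_def)
qed

lemma sign_below_insert_self: "sign_below x (insert x K) = sign_below x K"
  by (rule sign_below_insert_larger) simp

lemma sign_below_remove_self: "sign_below x (K - {x}) = sign_below x K"
proof -
  have "{z \<in> K - {x}. z < x} = {z \<in> K. z < x}" by auto
  then show ?thesis by (simp add: sign_below_def)
qed

lemma sign_below_Un:
  assumes "finite K" "finite L" "K \<inter> L = {}"
  shows "sign_below x (K \<union> L) = sign_below x K * sign_below x L"
proof -
  have "{z \<in> K \<union> L. z < x} = {z \<in> K. z < x} \<union> {z \<in> L. z < x}" by auto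
  moreover have "card \<dots> = card {z \<in> K. z < x} + card {z \<in> L. z < x}"
    using assms by (intro card_Un_disjoint) auto
  ultimately show ?thesis by (simp add: sign_below_def power_add)
qed

lemma row_contract_sorted:
  assumes "sorted ys" "distinct ys"
  shows "row_contract A x ys f = (\<Sum>y\<in>set ys. sign_below y (set ys) * A x y * f (remove1 y ys))"
  using assms
proof (induction ys arbitrary: f)
  case (Cons y ys)
  have y: "y \<notin> set ys" "\<And>z. z \<in> set ys \<Longrightarrow> y < z" using Cons.prems by (auto simp: order_le_less)
  then have e: "{z \<in> insert y (set ys). z < y} = {}" by fastforce
  have "sign_below y (insert y (set ys)) = 1" by (simp only: sign_below_def e card.empty power_0)
  moreover have "sign_below z (insert y (set ys)) * A x z * f (remove1 z (y # ys))
      = - (sign_below z (set ys) * A x z * f (y # remove1 z ys))" if "z \<in> set ys" for z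
  proof -
    have "y < z" "y \<noteq> z" using y that by auto
    then show ?thesis using y(1) by (simp add: sign_below_insert_smaller)
  qed
  ultimately show ?case
    using y(1) Cons.prems by (simp add: sum_negf Cons.IH)
qed simp

lemma rec_pf_Cons_sorted:
  assumes "finite K"
  shows "rec_pf A (x # sorted_list_of_set K) = (\<Sum>y\<in>K. sign_below y K * A x y * set_pf A (K - {y}))"
  using assms by (simp add: row_contract_sorted set_pf_def sorted_list_of_set_remove)

lemma sorted_list_of_set_eqI:
  "sorted_wrt (<) xs \<Longrightarrow> set xs = K \<Longrightarrow> sorted_list_of_set K = xs"
  by (auto simp: strict_sorted_iff intro: sorted_list_of_set.idem_if_sorted_distinct)

lemma set_pf_insert_front:
  assumes "skew A" "finite K" "x \<notin> K"
  shows "rec_pf A (x # sorted_list_of_set K) = sign_below x K * set_pf A (insert x K)"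
proof -
  let ?u = "sorted_list_of_set {z \<in> K. z < x}" and ?w = "sorted_list_of_set {z \<in> K. x < z}"
  have "z < x \<or> x < z" if "z \<in> K" for z
    using that assms(3) by (cases z x rule: linorder_cases) auto
  then have K: "set (?u @ ?w) = K" "set (?u @ x # ?w) = insert x K"
    using assms(2) by auto
  have "sorted_list_of_set K = ?u @ ?w"
    by (rule sorted_list_of_set_eqI[OF _ K(1)]) (use assms(2) in \<open>auto simp: sorted_wrt_append\<close>)
  moreover have "sorted_list_of_set (insert x K) = ?u @ x # ?w"
    by (rule sorted_list_of_set_eqI[OF _ K(2)]) (use assms(2) in \<open>auto simp: sorted_wrt_append\<close>)
  ultimately show ?thesis
    using assms(2) by (simp add: set_pf_def rec_pf_move_front[OF assms(1), of ?u x ?w] sign_below_def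
        minus_one_power_cancel del: rec_pf.simps)
qed


lemma set_pf_insert:
  assumes "skew A" "finite K" "x \<notin> K"
  shows "set_pf A (insert x K) = sign_below x K * (\<Sum>y\<in>K. sign_below y K * A x y * set_pf A (K - {y}))"
  using set_pf_insert_front[OF assms] rec_pf_Cons_sorted[OF assms(2), of A x]
  by (metis sign_below_cancel)

text \<open>The sum expands a Pfaffian in which the row \<open>x\<close> occurs twice: in front and
  in its sorted place.\<close>

lemma set_pf_row_repeated:
  assumes "skew A" "finite K" "x \<in> K"
  shows "(\<Sum>y\<in>K. sign_below y K * A x y * set_pf A (K - {y})) = 0"
proof -
  have "x \<in> set (sorted_list_of_set K)" using assms by simp
  then obtain us ws where s: "sorted_list_of_set K = us @ x # ws" by (meson split_list)
  have "rec_pf A ([] @ x # us @ x # ws) = - rec_pf A ([] @ x # us @ x # ws)"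
    by (rule rec_pf_swap[OF assms(1)])
  then have "rec_pf A (x # sorted_list_of_set K) = 0" unfolding s append_Nil by (metis eq_neg_iff_add_eq_0 mult_2 mult_eq_0_iff zero_neq_numeral)
  then show ?thesis using rec_pf_Cons_sorted[OF assms(2), of A x] by simp
qed

lemma set_pf_empty [simp]: "set_pf A {} = 1"
  by (simp add: set_pf_def)

lemma set_pf_odd: "odd (card K) \<Longrightarrow> set_pf A K = 0"
  by (simp add: set_pf_def rec_pf_odd)

text \<open>Expanding the enlarged factor on either side gives the same double sum up to sign.\<close>

lemma set_pf_exchange:
  assumes "skew A" "finite I" "finite J"
  shows "(\<Sum>x\<in>I - J. sign_below x I * sign_below x J * set_pf A (I - {x}) * set_pf A (insert x J))
       + (\<Sum>x\<in>J - I. sign_below x I * sign_below x J * set_pf A (insert x I) * set_pf A (J - {x})) = 0"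
proof -
  have half: "(\<Sum>x\<in>I - J. sign_below x I * sign_below x J * set_pf A (I - {x}) * set_pf A (insert x J))
      = (\<Sum>x\<in>I. \<Sum>y\<in>J. sign_below x I * sign_below y J * A x y * set_pf A (I - {x}) * set_pf A (J - {y}))"
    if "finite I" "finite J" for I J
  proof -
    have "(\<Sum>x\<in>I - J. sign_below x I * sign_below x J * set_pf A (I - {x}) * set_pf A (insert x J))
        = (\<Sum>x\<in>I - J. sign_below x I * set_pf A (I - {x}) * (\<Sum>y\<in>J. sign_below y J * A x y * set_pf A (J - {y})))"
      using that by (intro sum.cong refl)
        (simp add: set_pf_insert[OF assms(1)] sign_below_cancel mult.assoc mult.left_commute[of "sign_below _ J"])
    also have "\<dots> = (\<Sum>x\<in>I. sign_below x I * set_pf A (I - {x}) * (\<Sum>y\<in>J. sign_below y J * A x y * set_pf A (J - {y})))"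
      using that by (intro sum.mono_neutral_left) (auto simp: set_pf_row_repeated[OF assms(1)])
    also have "\<dots> = (\<Sum>x\<in>I. \<Sum>y\<in>J. sign_below x I * sign_below y J * A x y * set_pf A (I - {x}) * set_pf A (J - {y}))"
      by (simp only: sum_distrib_left ac_simps)
    finally show ?thesis .
  qed
  have "(\<Sum>x\<in>J - I. sign_below x I * sign_below x J * set_pf A (insert x I) * set_pf A (J - {x}))
      = (\<Sum>x\<in>J - I. sign_below x J * sign_below x I * set_pf A (J - {x}) * set_pf A (insert x I))"
    by (simp only: ac_simps)
  also have "\<dots> = (\<Sum>x\<in>J. \<Sum>y\<in>I. sign_below x J * sign_below y I * A x y * set_pf A (J - {x}) * set_pf A (I - {y}))"
    by (rule half[OF assms(3,2)])
  also have "\<dots> = (\<Sum>y\<in>I. \<Sum>x\<in>J. sign_below x J * sign_below y I * A x y * set_pf A (J - {x}) * set_pf A (I - {y}))"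
    by (rule sum.swap)
  also have "\<dots> = (\<Sum>y\<in>I. \<Sum>x\<in>J. - (sign_below y I * sign_below x J * A y x * set_pf A (I - {y}) * set_pf A (J - {x})))"
  proof (intro sum.cong refl)
    fix x y
    show "sign_below x J * sign_below y I * A x y * set_pf A (J - {x}) * set_pf A (I - {y})
      = - (sign_below y I * sign_below x J * A y x * set_pf A (I - {y}) * set_pf A (J - {x}))"
      by (subst skewD[OF assms(1), of x y]) (simp add: ac_simps)
  qed
  finally show ?thesis
    unfolding half[OF assms(2,3)] by (simp add: sum_negf)
qed

lemma set_pf_peel:
  assumes "skew A" "finite K" "x \<in> K" "y \<in> K" "x \<noteq> y" "\<And>z. z \<in> K \<Longrightarrow> z \<noteq> x \<Longrightarrow> z \<noteq> y \<Longrightarrow> A x z = 0"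
  shows "set_pf A K = sign_below x K * sign_below y (K - {x}) * A x y * set_pf A (K - {x, y})"
proof -
  have "set_pf A K = sign_below x (K - {x}) * (\<Sum>z\<in>K - {x}. sign_below z (K - {x}) * A x z * set_pf A (K - {x} - {z}))"
    using set_pf_insert[OF assms(1), of "K - {x}" x] assms by (simp add: insert_absorb)
  also have "(\<Sum>z\<in>K - {x}. sign_below z (K - {x}) * A x z * set_pf A (K - {x} - {z}))
    = (\<Sum>z\<in>{y}. sign_below z (K - {x}) * A x z * set_pf A (K - {x} - {z}))"
    using assms by (intro sum.mono_neutral_right) auto
  also have "\<dots> = sign_below y (K - {x}) * A x y * set_pf A (K - {x, y})"
    by (simp add: Diff_insert2[symmetric] insert_commute)
  finally show ?thesis by (simp add: sign_below_remove_self mult.assoc)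
qed

section \<open>Pfaffian of a sum of two matrices\<close>

definition shuffle_sign :: "'a::linorder set \<Rightarrow> 'a set \<Rightarrow> complex" where
  "shuffle_sign S T = (\<Prod>x\<in>S. sign_below x T)"

lemma shuffle_sign_insert_left:
  "finite S \<Longrightarrow> x \<notin> S \<Longrightarrow> shuffle_sign (insert x S) T = sign_below x T * shuffle_sign S T"
  by (simp add: shuffle_sign_def)

lemma shuffle_sign_insert_right:
  assumes "finite S" "finite T" "y \<notin> S" "y \<notin> T"
  shows "shuffle_sign S (insert y T) = (-1) ^ card S * sign_below y S * shuffle_sign S T"
proof -
  have "sign_below x (insert y T) = (if x < y then 1 else -1) * sign_below x T" if "x \<in> S" for x
  proof (cases "x < y")
    case False
    then have "y < x" using that assms by (cases x y rule: linorder_cases) auto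
    then show ?thesis using assms by (simp add: sign_below_insert_smaller)
  qed (simp add: sign_below_insert_larger)
  then have "shuffle_sign S (insert y T) = (\<Prod>x\<in>S. (if x < y then 1 else -1)) * shuffle_sign S T"
    unfolding shuffle_sign_def by (simp add: prod.distrib)
  also have "(\<Prod>x\<in>S. (if x < y then 1 else -1)) = ((-1) ^ card {x \<in> S. \<not> x < y} :: complex)"
  proof -
    have "(\<Prod>x\<in>S. (if x < y then 1 else -1)) = (\<Prod>x | x \<in> S \<and> \<not> x < y. (-1 :: complex))"
      using assms(1) by (intro prod.mono_neutral_cong_right) auto
    then show ?thesis by simp
  qed
  also have "\<dots> = (-1) ^ card S * sign_below y S"
  proof -
    have "card S = card {x \<in> S. x < y} + card {x \<in> S. \<not> x < y}"
      using assms(1) by (subst card_Un_disjoint[symmetric]) (auto intro!: arg_cong[where f = card])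
    then have "(-1 :: complex) ^ card S * sign_below y S = (-1) ^ card {x \<in> S. x < y}
        * ((-1) ^ card {x \<in> S. x < y} * (-1) ^ card {x \<in> S. \<not> x < y})"
      by (simp only: sign_below_def power_add ac_simps)
    then show ?thesis by (simp only: minus_one_power_cancel)
  qed
  finally show ?thesis .
qed

lemma skew_add:
  assumes "skew A" "skew B"
  shows "skew (\<lambda>x y. A x y + B x y)"
proof -
  have "A y x + B y x = - (A x y + B x y)" for x y
    by (simp only: skewD[OF assms(1), of y x] skewD[OF assms(2), of y x] minus_add_distrib)
  then show ?thesis unfolding skew_def by blast
qed


lemma sum_Pow_insert:
  assumes "finite K" "x \<notin> K"
  shows "(\<Sum>S\<in>Pow (insert x K). f S) = (\<Sum>S\<in>Pow K. f S) + (\<Sum>S\<in>Pow K. f (insert x S))"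
proof -
  have "inj_on (insert x) (Pow K)" using assms(2) by (auto intro!: inj_onI)
  then show ?thesis
    using assms unfolding Pow_insert by (subst sum.union_disjoint) (auto simp: sum.reindex)
qed

text \<open>\<open>shuffle_sign S (K - S)\<close> is the sign of the permutation sorting
  \<open>S\<close> followed by \<open>K - S\<close>. In the expansion along the least element
  \<open>x\<close>, the terms with \<open>A x y\<close> build the Pfaffians on the subsets
  containing \<open>x\<close>, and those with \<open>B x y\<close> the Pfaffians on the complements
  containing \<open>x\<close>. Minimality of \<open>x\<close> makes every
  \<open>sign_below x\<close> equal to 1.\<close>

lemma set_pf_add:
  fixes A B :: "'a::linorder \<Rightarrow> 'a \<Rightarrow> complex"
  assumes "skew A" "skew B" "finite K"
  shows "set_pf (\<lambda>x y. A x y + B x y) K = (\<Sum>S\<in>Pow K. shuffle_sign S (K - S) * set_pf A S * set_pf B (K - S))"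
  using assms(3)
proof (induction "card K" arbitrary: K rule: less_induct)
  case less
  note AB = skew_add[OF assms(1,2)]
  show ?case
  proof (cases "K = {}")
    case True
    then show ?thesis by (simp add: shuffle_sign_def)
  next
    case False
    define x where "x = Min K"
    define L where "L = K - {x}"
    have x: "x \<in> K" "x \<notin> L" "K = insert x L" "finite L"
      using Min_in[OF less.prems False] less.prems by (auto simp: x_def L_def)
    have min: "sign_below x S = 1" if "S \<subseteq> L" for S
    proof -
      have "{z \<in> S. z < x} = {}"
        using that less.prems by (auto simp: x_def L_def not_less)
      then show ?thesis by (simp only: sign_below_def card.empty power_0)
    qed
    let ?t = "\<lambda>y S. sign_below y L * shuffle_sign S (L - {y} - S) * set_pf A S * set_pf B (L - {y} - S)"
    have "set_pf (\<lambda>x y. A x y + B x y) K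
        = (\<Sum>y\<in>L. sign_below y L * (A x y + B x y) * set_pf (\<lambda>x y. A x y + B x y) (L - {y}))"
      unfolding x(3) using x min[of L] by (simp add: set_pf_insert[OF AB])
    also have "\<dots> = (\<Sum>y\<in>L. \<Sum>S\<in>Pow (L - {y}). (A x y + B x y) * ?t y S)"
    proof (intro sum.cong refl)
      fix y assume "y \<in> L"
      then have "card (L - {y}) < card K"
        using x by (metis DiffE card_Diff1_less card_insert_disjoint less_SucI)
      then have "set_pf (\<lambda>x y. A x y + B x y) (L - {y})
          = (\<Sum>S\<in>Pow (L - {y}). shuffle_sign S (L - {y} - S) * set_pf A S * set_pf B (L - {y} - S))"
        using x by (intro less.hyps) auto
      then show "sign_below y L * (A x y + B x y) * set_pf (\<lambda>x y. A x y + B x y) (L - {y})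
          = (\<Sum>S\<in>Pow (L - {y}). (A x y + B x y) * ?t y S)"
        by (simp only: sum_distrib_left ac_simps)
    qed
    also have "\<dots> = (\<Sum>y\<in>L. \<Sum>S\<in>Pow (L - {y}). B x y * ?t y S) + (\<Sum>y\<in>L. \<Sum>S\<in>Pow (L - {y}). A x y * ?t y S)"
      by (simp only: distrib_right sum.distrib add.commute)
    also have "(\<Sum>y\<in>L. \<Sum>S\<in>Pow (L - {y}). B x y * ?t y S)
        = (\<Sum>S\<in>Pow L. shuffle_sign S (insert x (L - S)) * set_pf A S * set_pf B (insert x (L - S)))"
    proof -
      have "(\<Sum>S\<in>Pow L. shuffle_sign S (insert x (L - S)) * set_pf A S * set_pf B (insert x (L - S)))
          = (\<Sum>S\<in>Pow L. \<Sum>y | y \<in> L \<and> y \<notin> S. B x y * ?t y S)"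
      proof (intro sum.cong refl)
        fix S assume "S \<in> Pow L"
        then have S: "S \<subseteq> L" "finite S" "x \<notin> S" using x finite_subset by auto
        have "set_pf B (insert x (L - S)) = (\<Sum>y\<in>L - S. sign_below y (L - S) * B x y * set_pf B (L - S - {y}))"
          using x min[of "L - S"] by (simp add: set_pf_insert[OF assms(2)] Diff_subset)
        moreover have "shuffle_sign S (insert x (L - S)) = (-1) ^ card S * shuffle_sign S (L - S)"
          using S x min[of S] by (simp add: shuffle_sign_insert_right)
        moreover have "(-1) ^ card S * shuffle_sign S (L - S) * set_pf A S * (sign_below y (L - S) * B x y * set_pf B (L - S - {y}))
            = B x y * ?t y S" if "y \<in> L - S" for y
        proof -
          define T where "T = L - {y} - S"
          have T: "L - S = insert y T" "y \<notin> T" "finite T" "L - S - {y} = T" "L = insert y (S \<union> T)" "y \<notin> S" "S \<inter> T = {}"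
            using that x S by (auto simp: T_def)
          have e1: "shuffle_sign S (L - S) = (-1) ^ card S * sign_below y S * shuffle_sign S T"
            unfolding T(1) using S T by (intro shuffle_sign_insert_right) auto
          have e2: "sign_below y (L - S) = sign_below y T" unfolding T(1) by (rule sign_below_insert_self)
          have "sign_below y L = sign_below y (S \<union> T)" by (subst T(5)) (rule sign_below_insert_self)
          then have e3: "sign_below y L = sign_below y S * sign_below y T"
            using S T by (simp add: sign_below_Un)
          show ?thesis
            unfolding e1 e2 e3 T(4) T_def[symmetric]
            by (simp only: mult.assoc minus_one_power_cancel) (simp only: ac_simps)
        qed
        ultimately show "shuffle_sign S (insert x (L - S)) * set_pf A S * set_pf B (insert x (L - S))
            = (\<Sum>y | y \<in> L \<and> y \<notin> S. B x y * ?t y S)"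
          by (simp only: sum_distrib_left set_diff_eq) (intro sum.cong refl, simp)
      qed
      also have "\<dots> = (\<Sum>y\<in>L. \<Sum>S | S \<in> Pow L \<and> y \<notin> S. B x y * ?t y S)"
        using x by (intro sum.swap_restrict) auto
      also have "\<dots> = (\<Sum>y\<in>L. \<Sum>S\<in>Pow (L - {y}). B x y * ?t y S)"
        by (intro sum.cong refl) auto
      finally show ?thesis by (rule sym)
    qed
    also have "(\<Sum>y\<in>L. \<Sum>S\<in>Pow (L - {y}). A x y * ?t y S)
        = (\<Sum>S\<in>Pow L. shuffle_sign (insert x S) (L - S) * set_pf A (insert x S) * set_pf B (L - S))"
    proof -
      let ?u = "\<lambda>y S. shuffle_sign S (L - S) * (sign_below y S * A x y * set_pf A (S - {y})) * set_pf B (L - S)"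
      have "(\<Sum>S\<in>Pow L. shuffle_sign (insert x S) (L - S) * set_pf A (insert x S) * set_pf B (L - S))
          = (\<Sum>S\<in>Pow L. \<Sum>y | y \<in> L \<and> y \<in> S. ?u y S)"
      proof (intro sum.cong refl)
        fix S assume "S \<in> Pow L"
        then have S: "S \<subseteq> L" "finite S" "x \<notin> S" using x finite_subset by auto
        have "shuffle_sign (insert x S) (L - S) = shuffle_sign S (L - S)"
          using S x min[of "L - S"] by (simp add: shuffle_sign_insert_left Diff_subset)
        moreover have "set_pf A (insert x S) = (\<Sum>y\<in>S. sign_below y S * A x y * set_pf A (S - {y}))"
          using S x min[of S] by (simp add: set_pf_insert[OF assms(1)])
        moreover have "{y. y \<in> L \<and> y \<in> S} = S" using S by auto
        ultimately show "shuffle_sign (insert x S) (L - S) * set_pf A (insert x S) * set_pf B (L - S)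
            = (\<Sum>y | y \<in> L \<and> y \<in> S. ?u y S)"
          by (simp only: sum_distrib_left sum_distrib_right)
      qed
      also have "\<dots> = (\<Sum>y\<in>L. \<Sum>S | S \<in> Pow L \<and> y \<in> S. ?u y S)"
        using x by (intro sum.swap_restrict) auto
      also have "\<dots> = (\<Sum>y\<in>L. \<Sum>S\<in>Pow (L - {y}). A x y * ?t y S)"
      proof (rule sum.cong[OF refl])
        fix y assume y: "y \<in> L"
        have im: "{S. S \<in> Pow L \<and> y \<in> S} = insert y ` Pow (L - {y})"
        proof
          show "{S. S \<in> Pow L \<and> y \<in> S} \<subseteq> insert y ` Pow (L - {y})"
          proof
            fix S assume "S \<in> {S. S \<in> Pow L \<and> y \<in> S}"
            then show "S \<in> insert y ` Pow (L - {y})" by (intro image_eqI[of _ _ "S - {y}"]) auto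
          qed
        qed (use y in auto)
        have inj: "inj_on (insert y) (Pow (L - {y}))" by (auto intro!: inj_onI)
        have "(\<Sum>S | S \<in> Pow L \<and> y \<in> S. ?u y S) = (\<Sum>S\<in>Pow (L - {y}). ?u y (insert y S))"
          unfolding im by (simp only: sum.reindex[OF inj] o_def)
        also have "\<dots> = (\<Sum>S\<in>Pow (L - {y}). A x y * ?t y S)"
        proof (rule sum.cong[OF refl])
          fix S assume "S \<in> Pow (L - {y})"
          then have S: "S \<subseteq> L" "finite S" "y \<notin> S" using x finite_subset by auto
          define T where "T = L - {y} - S"
          have T: "L - insert y S = T" "insert y S - {y} = S" "L = insert y (S \<union> T)" "finite T" "S \<inter> T = {}"
            using S y x by (auto simp: T_def)
          have "sign_below y L = sign_below y (S \<union> T)" by (subst T(3)) (rule sign_below_insert_self)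
          then have e3: "sign_below y L = sign_below y S * sign_below y T"
            using S T by (simp add: sign_below_Un)
          show "?u y (insert y S) = A x y * ?t y S"
            unfolding T(1,2) T_def[symmetric] shuffle_sign_insert_left[OF S(2,3)] sign_below_insert_self e3
            by (simp only: ac_simps)
        qed
        finally show "(\<Sum>S | S \<in> Pow L \<and> y \<in> S. ?u y S) = (\<Sum>S\<in>Pow (L - {y}). A x y * ?t y S)" .
      qed
      finally show ?thesis by (rule sym)
    qed
    also have "(\<Sum>S\<in>Pow L. shuffle_sign S (insert x (L - S)) * set_pf A S * set_pf B (insert x (L - S)))
        + (\<Sum>S\<in>Pow L. shuffle_sign (insert x S) (L - S) * set_pf A (insert x S) * set_pf B (L - S))
      = (\<Sum>S\<in>Pow K. shuffle_sign S (K - S) * set_pf A S * set_pf B (K - S))"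
    proof -
      have "insert x L - S = insert x (L - S)" "insert x L - insert x S = L - S" if "S \<in> Pow L" for S
        using that x by auto
      then show ?thesis
        unfolding x(3) sum_Pow_insert[OF x(4,2)] by simp
    qed
    finally show ?thesis .
  qed
qed

section \<open>Conjugation by diagonal matrices, relabelling, and elimination of unit rows\<close>

lemma row_contract_scale:
  "row_contract (\<lambda>a b. d a * d b * A a b) x ys (\<lambda>zs. prod_list (map d zs) * f zs)
    = d x * prod_list (map d ys) * row_contract A x ys f"
proof (induction ys arbitrary: f)
  case (Cons y ys)
  have "row_contract (\<lambda>a b. d a * d b * A a b) x ys (\<lambda>zs. prod_list (map d zs) * (d y * f (y # zs)))
      = d x * prod_list (map d ys) * (d y * row_contract A x ys (\<lambda>zs. f (y # zs)))"
    by (simp only: Cons row_contract_cmult)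
  then show ?case by (simp add: algebra_simps)
qed simp

lemma rec_pf_scale: "rec_pf (\<lambda>a b. d a * d b * A a b) xs = prod_list (map d xs) * rec_pf A xs"
proof (induction "length xs" arbitrary: xs rule: less_induct)
  case less
  show ?case
  proof (cases xs)
    case (Cons x ys)
    have "row_contract (\<lambda>a b. d a * d b * A a b) x ys (rec_pf (\<lambda>a b. d a * d b * A a b))
        = row_contract (\<lambda>a b. d a * d b * A a b) x ys (\<lambda>zs. prod_list (map d zs) * rec_pf A zs)"
      by (intro row_contract_cong refl less) (simp add: Cons)
    then show ?thesis by (simp add: Cons row_contract_scale)
  qed simp
qed

lemma set_pf_scale:
  "finite K \<Longrightarrow> set_pf (\<lambda>a b. d a * d b * A a b) K = (\<Prod>x\<in>K. d x) * set_pf A K"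
  by (simp add: set_pf_def rec_pf_scale prod.distinct_set_conv_list[symmetric])

lemma row_contract_map:
  "row_contract (\<lambda>a b. A (h a) (h b)) x ys (\<lambda>zs. f (map h zs)) = row_contract A (h x) (map h ys) f"
proof (induction ys arbitrary: f)
  case (Cons y ys)
  show ?case using Cons[of "\<lambda>zs. f (h y # zs)"] by simp
qed simp

lemma rec_pf_map: "rec_pf (\<lambda>a b. A (h a) (h b)) xs = rec_pf A (map h xs)"
proof (induction "length xs" arbitrary: xs rule: less_induct)
  case less
  show ?case
  proof (cases xs)
    case (Cons x ys)
    have "row_contract (\<lambda>a b. A (h a) (h b)) x ys (rec_pf (\<lambda>a b. A (h a) (h b)))
        = row_contract (\<lambda>a b. A (h a) (h b)) x ys (\<lambda>zs. rec_pf A (map h zs))"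
      by (intro row_contract_cong refl less) (simp add: Cons)
    then show ?thesis by (simp add: Cons row_contract_map)
  qed simp
qed

lemma rec_pf_cong:
  assumes "\<And>a b. a \<in> set xs \<Longrightarrow> b \<in> set xs \<Longrightarrow> A a b = B a b"
  shows "rec_pf A xs = rec_pf B xs"
  using assms
proof (induction "length xs" arbitrary: xs rule: less_induct)
  case less
  have row: "row_contract A x ys f = row_contract B x ys g"
    if "\<And>y. y \<in> set ys \<Longrightarrow> A x y = B x y"
      "\<And>zs. set zs \<subseteq> set ys \<Longrightarrow> Suc (length zs) = length ys \<Longrightarrow> f zs = g zs" for x ys f g
    using that
  proof (induction ys arbitrary: f g)
    case (Cons y ys)
    have "row_contract A x ys (\<lambda>zs. f (y # zs)) = row_contract B x ys (\<lambda>zs. g (y # zs))"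
      by (rule Cons.IH, rule Cons.prems(1), simp, rule Cons.prems(2)) auto
    moreover have "f ys = g ys" by (rule Cons.prems(2)) auto
    moreover have "A x y = B x y" by (rule Cons.prems(1)) simp
    ultimately show ?case by (simp only: row_contract.simps)
  qed simp
  show ?case
  proof (cases xs)
    case (Cons x ys)
    have "row_contract A x ys (rec_pf A) = row_contract B x ys (rec_pf B)"
      by (rule row) (use Cons in \<open>auto intro!: less\<close>)
    then show ?thesis by (simp add: Cons)
  qed simp
qed

lemma set_pf_cong:
  "finite K \<Longrightarrow> (\<And>a b. a \<in> K \<Longrightarrow> b \<in> K \<Longrightarrow> A a b = B a b) \<Longrightarrow> set_pf A K = set_pf B K"
  unfolding set_pf_def by (rule rec_pf_cong) auto

text \<open>The sign precedes the quantifier over \<open>A\<close>: it depends on \<open>K\<close>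
  and \<open>ps\<close> only. The matrix will vary with the parameters \<open>r\<close>, which can
  be solved for only if the sign is fixed beforehand.\<close>

lemma set_pf_peel_pairs:
  fixes K :: "'a::linorder set"
  assumes "finite K" "distinct (map fst ps @ map snd ps)" "fst ` set ps \<union> snd ` set ps \<subseteq> K"
  shows "\<exists>\<epsilon>. (\<epsilon> = 1 \<or> \<epsilon> = -1) \<and> (\<forall>A. skew A \<longrightarrow> (\<forall>(x, y)\<in>set ps. A x y = 1 \<and> (\<forall>z\<in>K. z \<noteq> y \<longrightarrow> A x z = 0)) \<longrightarrow>
            set_pf A K = \<epsilon> * set_pf A (K - (fst ` set ps \<union> snd ` set ps)))"
  using assms
proof (induction ps arbitrary: K)
  case Nil
  then show ?case by (intro exI[of _ 1]) simp
next
  case (Cons p ps)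
  obtain a b where p: "p = (a, b)" by (cases p)
  define L where "L = K - {a, b}"
  have "fst ` set ps \<union> snd ` set ps \<subseteq> L"
    using Cons.prems by (auto simp: p L_def)
  moreover have "finite L" "distinct (map fst ps @ map snd ps)"
    using Cons.prems by (auto simp: L_def)
  ultimately obtain \<epsilon> where \<epsilon>: "\<epsilon> = 1 \<or> \<epsilon> = -1"
    "\<forall>A. skew A \<longrightarrow> (\<forall>(x, y)\<in>set ps. A x y = 1 \<and> (\<forall>z\<in>L. z \<noteq> y \<longrightarrow> A x z = 0)) \<longrightarrow>
        set_pf A L = \<epsilon> * set_pf A (L - (fst ` set ps \<union> snd ` set ps))"
    using Cons.IH[of L] by blast
  have L: "L - (fst ` set ps \<union> snd ` set ps) = K - (fst ` set (p # ps) \<union> snd ` set (p # ps))"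
    by (auto simp: p L_def)
  define \<delta> where "\<delta> = sign_below a K * sign_below b (K - {a})"
  have "\<delta> = 1 \<or> \<delta> = -1"
    unfolding \<delta>_def sign_below_def by (simp add: minus_one_power_iff)
  moreover have "set_pf A K = \<delta> * \<epsilon> * set_pf A (K - (fst ` set (p # ps) \<union> snd ` set (p # ps)))"
    if A: "skew A" and ps: "\<forall>(x, y)\<in>set (p # ps). A x y = 1 \<and> (\<forall>z\<in>K. z \<noteq> y \<longrightarrow> A x z = 0)" for A
  proof -
    have "set_pf A K = \<delta> * A a b * set_pf A L"
      unfolding \<delta>_def L_def using Cons.prems ps by (intro set_pf_peel[OF A]) (auto simp: p)
    moreover have "set_pf A L = \<epsilon> * set_pf A (L - (fst ` set ps \<union> snd ` set ps))"
      using A ps by (intro \<epsilon>(2)[rule_format]) (auto simp: L_def)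
    ultimately show ?thesis using ps by (simp add: L p)
  qed
  ultimately show ?case
    using \<epsilon>(1) by (intro exI[of _ "\<delta> * \<epsilon>"]) auto
qed

lemma set_pf_pair:
  assumes "skew A" "a \<noteq> b"
  shows "set_pf A {a, b} = sign_below a {b} * A a b"
proof -
  have "sign_below b {b} = 1" using sign_below_insert_self[of b "{}"] by (simp add: sign_below_def)
  then show ?thesis using set_pf_insert[OF assms(1), of "{b}" a] assms(2) by simp
qed

section \<open>Linear independence of the Schur Q-functions\<close>

unbundle fps_syntax

definition odd_series :: "(nat \<Rightarrow> complex) \<Rightarrow> complex fps" where
  "odd_series t = Abs_fps (\<lambda>k. if odd k then t k else 0)"

definition q_series :: "(nat \<Rightarrow> complex) \<Rightarrow> complex fps" where
  "q_series t = fps_exp 1 oo odd_series t"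

lemma q_fun_nth: "q_fun t i = q_series t $ i"
  by (simp add: q_fun_def q_series_def odd_series_def)

lemma q_series_deriv: "fps_deriv (q_series t) = q_series t * fps_deriv (odd_series t)"
  unfolding q_series_def by (subst fps_compose_deriv) (simp_all add: odd_series_def)

lemma q_fun_0: "q_fun t 0 = 1"
  by (simp add: q_fun_nth q_series_def)

definition reflect_fps :: "complex fps \<Rightarrow> complex fps" where
  "reflect_fps f = Abs_fps (\<lambda>n. (-1) ^ n * f $ n)"

lemma reflect_fps_mult: "reflect_fps (f * g) = reflect_fps f * reflect_fps g"
proof (rule fps_ext)
  fix n
  have "(-1) ^ n * (f $ i * g $ (n - i)) = (-1) ^ i * f $ i * ((-1) ^ (n - i) * g $ (n - i))" if "i \<le> n" for i
    using that power_add[of "-1 :: complex" i "n - i"] by simp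
  then have "(\<Sum>i=0..n. (-1) ^ n * (f $ i * g $ (n - i))) = (\<Sum>i=0..n. (-1) ^ i * f $ i * ((-1) ^ (n - i) * g $ (n - i)))"
    by (intro sum.cong refl) simp
  then show "reflect_fps (f * g) $ n = (reflect_fps f * reflect_fps g) $ n"
    by (simp add: reflect_fps_def fps_mult_nth sum_distrib_left)
qed

lemma reflect_fps_deriv: "fps_deriv (reflect_fps f) = - reflect_fps (fps_deriv f)"
  by (rule fps_ext) (simp add: reflect_fps_def)

lemma reflect_fps_deriv_odd_series: "reflect_fps (fps_deriv (odd_series t)) = fps_deriv (odd_series t)"
  by (rule fps_ext) (simp add: reflect_fps_def odd_series_def)

text \<open>The exponent is odd in \<open>z\<close>, so \<open>E(-z)\<close> inverts
  \<open>E(z)\<close>: the product has derivative 0 and constant term 1.\<close>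

lemma q_series_reflect: "q_series t * reflect_fps (q_series t) = 1"
proof -
  let ?E = "q_series t"
  have "fps_deriv (?E * reflect_fps ?E) = 0"
    by (simp add: q_series_deriv reflect_fps_deriv reflect_fps_mult reflect_fps_deriv_odd_series algebra_simps)
  then have "?E * reflect_fps ?E = fps_const ((?E * reflect_fps ?E) $ 0)"
    by (simp only: fps_deriv_eq_0_iff)
  also have "(?E * reflect_fps ?E) $ 0 = 1"
    using q_fun_0[of t] by (simp add: reflect_fps_def q_fun_nth)
  finally show ?thesis by simp
qed

lemma q_fun_quadratic:
  assumes "n > 0"
  shows "(\<Sum>i\<le>n. (-1) ^ i * q_fun t i * q_fun t (n - i)) = 0"
proof -
  have "(reflect_fps (q_series t) * q_series t) $ n = 0"
    using q_series_reflect[of t] assms by (simp add: mult.commute)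
  then show ?thesis
    by (simp add: fps_mult_nth reflect_fps_def q_fun_nth atLeast0AtMost)
qed

text \<open>Adding one variable \<open>x\<close> to the alphabet multiplies the generating series of the \<open>q\<^sub>i\<close> by
  \<open>(1 + x z) / (1 - x z)\<close>.\<close>

definition shift_times :: "(nat \<Rightarrow> complex) \<Rightarrow> complex \<Rightarrow> nat \<Rightarrow> complex" where
  "shift_times t x k = t k + 2 * x ^ k / of_nat k"

text \<open>Both sides solve the linear equation \<open>(1 + x z) f' = ((1 + x z) D + x) f\<close>
  with constant term 1. Hence the Wronskian \<open>Y' Z - Y Z'\<close> vanishes and the quotient of
  the two sides is constant.\<close>

lemma q_series_shift:
  "(1 - fps_const x * fps_X) * q_series (shift_times t x) = (1 + fps_const x * fps_X) * q_series t"
proof -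
  define a where "a = fps_const x"
  let ?c = "a * fps_X"
  \<comment> \<open>\<open>H\<close> is the derivative of
    \<open>log ((1 + x z) / (1 - x z))\<close>, that is, \<open>2 x / (1 - x^2 z^2)\<close>.\<close>
  define E E' D H where "E = q_series t" and "E' = q_series (shift_times t x)"
    and "D = fps_deriv (odd_series t)" and "H = Abs_fps (\<lambda>n. if even n then 2 * x ^ Suc n else 0)"
  define Y Z where "Y = (1 - ?c) * E'" and "Z = (1 + ?c) * E"
  have da: "fps_deriv a = 0" by (simp add: a_def)
  have dE: "fps_deriv E = E * D" by (simp add: E_def D_def q_series_deriv)
  have dE': "fps_deriv E' = E' * (D + H)"
    unfolding E'_def q_series_deriv
  proof (rule arg_cong[where f = "\<lambda>f. q_series (shift_times t x) * f"], rule fps_ext)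
    fix n
    have "of_nat (Suc n) * (2 * x ^ Suc n / of_nat (Suc n)) = 2 * x ^ Suc n"
      by (simp del: of_nat_Suc)
    then show "fps_deriv (odd_series (shift_times t x)) $ n = (D + H) $ n"
      by (simp add: D_def H_def odd_series_def shift_times_def distrib_left del: of_nat_Suc power_Suc)
  qed
  have H: "H * (1 - ?c * ?c) = 2 * a"
  proof (rule fps_ext)
    fix n
    have e: "H * (1 - ?c * ?c) = H - fps_const (x * x) * (H * fps_X ^ 2)"
      by (simp add: a_def algebra_simps power2_eq_square flip: fps_const_mult)
    show "(H * (1 - ?c * ?c)) $ n = (2 * a) $ n"
    proof (cases n)
      case 0
      then show ?thesis
        unfolding e by (simp add: a_def H_def fps_X_power_mult_right_nth numeral_fps_const)
    next
      case (Suc m)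
      then show ?thesis
        unfolding e by (cases m) (simp_all add: a_def H_def fps_X_power_mult_right_nth numeral_fps_const)
    qed
  qed
  have dY: "(1 + ?c) * fps_deriv Y = ((1 + ?c) * D + a) * Y"
  proof -
    have "(1 + ?c) * fps_deriv Y = (- a * (1 + ?c) + (1 - ?c * ?c) * D + H * (1 - ?c * ?c)) * E'"
      by (simp add: Y_def dE' da algebra_simps)
    then show ?thesis unfolding H by (simp add: Y_def algebra_simps)
  qed
  have dZ: "(1 + ?c) * fps_deriv Z = ((1 + ?c) * D + a) * Z"
    by (simp add: Z_def dE da algebra_simps)
  have "(1 + ?c) * (fps_deriv Y * Z - Y * fps_deriv Z) = ((1 + ?c) * fps_deriv Y) * Z - Y * ((1 + ?c) * fps_deriv Z)"
    by (simp only: right_diff_distrib mult.assoc mult.left_commute[of Y])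
  also have "\<dots> = 0"
    unfolding dY dZ by (simp only: mult.assoc mult.left_commute[of Y] diff_self)
  finally have "(1 + ?c) * (fps_deriv Y * Z - Y * fps_deriv Z) = 0" .
  moreover have "1 + ?c \<noteq> 0"
  proof
    assume "1 + ?c = 0"
    then have "(1 + ?c) $ 0 = (0 :: complex)" by (simp only: fps_zero_nth)
    then show False by simp
  qed
  ultimately have W: "fps_deriv Y * Z = Y * fps_deriv Z" by simp
  have Z0: "Z $ 0 = 1" "Y $ 0 = 1"
    using q_fun_0[of t] q_fun_0[of "shift_times t x"] by (simp_all add: Z_def Y_def E_def E'_def q_fun_nth a_def)
  have inv: "Z * inverse Z = 1" using Z0 inverse_mult_eq_1'[of Z] by simp
  have "fps_deriv (Y * inverse Z) = fps_deriv Y * inverse Z - Y * fps_deriv Z * (inverse Z)\<^sup>2"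
    using Z0 by (simp add: fps_inverse_deriv algebra_simps)
  also have "fps_deriv Y * inverse Z = fps_deriv Y * (Z * inverse Z) * inverse Z" unfolding inv by simp
  also have "\<dots> = Y * fps_deriv Z * (inverse Z)\<^sup>2"
    unfolding mult.assoc[symmetric] W by (simp add: power2_eq_square mult.assoc)
  finally have "Y * inverse Z = fps_const ((Y * inverse Z) $ 0)"
    by (simp only: diff_self fps_deriv_eq_0_iff)
  also have "(Y * inverse Z) $ 0 = 1" using Z0 by simp
  finally have "Y * inverse Z * Z = Z" by simp
  then have "Y = Z" using inv by (metis mult.assoc mult.commute mult_1_right)
  then show ?thesis by (simp add: Y_def Z_def E_def E'_def a_def)
qed

lemma q_fun_shift:
  "q_fun (shift_times t x) (Suc i) - x * q_fun (shift_times t x) i = q_fun t (Suc i) + x * q_fun t i"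
proof -
  have "((1 - fps_const x * fps_X) * q_series (shift_times t x)) $ Suc i = ((1 + fps_const x * fps_X) * q_series t) $ Suc i"
    by (simp only: q_series_shift)
  then show ?thesis by (simp add: q_fun_nth algebra_simps)
qed

section \<open>The matrix of two-part Q-functions under adjunction of a variable\<close>

definition theta :: "(nat \<Rightarrow> complex) \<Rightarrow> (nat \<Rightarrow> complex) \<Rightarrow> nat \<Rightarrow> nat \<Rightarrow> complex" where
  "theta u v i j = u i * v j / 2 + (\<Sum>k=1..j. (-1) ^ k * u (i + k) * v (j - k))"

definition backward_comb :: "complex \<Rightarrow> (nat \<Rightarrow> complex) \<Rightarrow> nat \<Rightarrow> complex" where
  "backward_comb a u k = (if k = 0 then u 0 else u k + a * u (k - 1))"

text \<open>\<open>theta u v i j\<close> is the coefficient of \<open>z^i w^j\<close> in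
  \<open>u(z) v(w) (z - w) / (2 (z + w))\<close>, expanded in powers of \<open>w / z\<close>, and
  \<open>backward_comb a\<close> multiplies a series by \<open>1 + a z\<close>. Independent
  arguments \<open>u\<close> and \<open>v\<close> allow the two factors to be changed one at a
  time.\<close>

lemma theta_backward_left:
  "theta (backward_comb a u) v (Suc i) j = theta u v (Suc i) j + a * theta u v i j"
  by (simp add: theta_def backward_comb_def algebra_simps sum.distrib sum_distrib_left)

lemma theta_backward_right:
  "theta u (backward_comb a v) i (Suc j) = theta u v i (Suc j) + a * theta u v i j"
proof -
  have "(\<Sum>k=1..Suc j. (-1) ^ k * u (i + k) * backward_comb a v (Suc j - k))
      = (\<Sum>k=1..j. (-1) ^ k * u (i + k) * backward_comb a v (Suc j - k)) + (-1) ^ Suc j * u (i + Suc j) * v 0"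
    by (simp add: backward_comb_def)
  also have "(\<Sum>k=1..j. (-1) ^ k * u (i + k) * backward_comb a v (Suc j - k))
      = (\<Sum>k=1..j. (-1) ^ k * u (i + k) * v (Suc j - k)) + a * (\<Sum>k=1..j. (-1) ^ k * u (i + k) * v (j - k))"
    unfolding sum_distrib_left sum.distrib[symmetric]
    by (intro sum.cong refl) (auto simp: backward_comb_def algebra_simps Suc_diff_le)
  finally show ?thesis
    by (simp add: theta_def backward_comb_def algebra_simps)
qed

text \<open>The value 1/2 of \<open>theta\<close> at \<open>(0, 0)\<close> is the only failure of
  skew-symmetry and is subtracted. Entries with one index 0 are \<open>q_a / 2\<close> instead of
  \<open>q_a / sqrt 2\<close>, so that the shift identities hold uniformly down to index 0;
  \<open>root_two_weight\<close> restores the factor.\<close>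

definition Q_matrix :: "(nat \<Rightarrow> complex) \<Rightarrow> nat \<Rightarrow> nat \<Rightarrow> complex" where
  "Q_matrix t i j = theta (q_fun t) (q_fun t) i j - (if i = 0 \<and> j = 0 then 1 / 2 else 0)"

text \<open>Multiplied by \<open>(-1) ^ j\<close>, the two values are the parts \<open>l < j\<close>
  and \<open>l > j\<close> of the vanishing sum of \<open>(-1)^l q_l q_(i+j-l)\<close> over
  \<open>l \<le> i + j\<close>, each with half of the middle term \<open>l = j\<close>.\<close>

lemma theta_q_fun_skew:
  assumes "i + j > 0"
  shows "theta (q_fun t) (q_fun t) i j + theta (q_fun t) (q_fun t) j i = 0"
proof -
  let ?q = "q_fun t" and ?g = "\<lambda>l. (-1) ^ l * q_fun t l * q_fun t (i + j - l)"
  have eq: "(-1) ^ j * theta ?q ?q i j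
      = (-1) ^ j * ?q j * ?q i / 2 + (\<Sum>l<j. (-1) ^ l * ?q l * ?q (i + j - l))" for i j
  proof -
    have "(\<Sum>k=1..j. (-1) ^ j * ((-1) ^ k * ?q (i + k) * ?q (j - k))) = (\<Sum>l<j. (-1) ^ l * ?q l * ?q (i + j - l))"
      by (rule sum.reindex_bij_witness[of _ "\<lambda>l. j - l" "\<lambda>k. j - k"])
        (auto simp: minus_one_power_iff)
    then show ?thesis by (simp only: theta_def distrib_left sum_distrib_left) simp
  qed
  have "(-1) ^ j * theta ?q ?q j i = (-1) ^ (i + j) * ((-1) ^ i * theta ?q ?q j i)"
    by (simp add: power_add minus_one_power_iff)
  also have "\<dots> = (-1) ^ (i + j) * ?g i / 2 + (\<Sum>l<i. (-1) ^ (i + j) * ?g l)"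
    unfolding eq[of i j] by (simp only: distrib_left sum_distrib_left add.commute[of j i] diff_add_inverse times_divide_eq_right)
  also have "(-1) ^ (i + j) * ?g i = ?g j"
    by (simp add: power_add minus_one_power_iff)
  also have "(\<Sum>l<i. (-1) ^ (i + j) * ?g l) = (\<Sum>l\<in>{j<..i + j}. ?g l)"
    by (rule sum.reindex_bij_witness[of _ "\<lambda>l. i + j - l" "\<lambda>l. i + j - l"])
      (auto simp: minus_one_power_iff)
  finally have "(-1) ^ j * (theta ?q ?q i j + theta ?q ?q j i) = (\<Sum>l<j. ?g l) + ?g j + (\<Sum>l\<in>{j<..i + j}. ?g l)"
    unfolding distrib_left eq[of j i] by simp
  also have "\<dots> = (\<Sum>l\<in>{..j}. ?g l) + (\<Sum>l\<in>{j<..i + j}. ?g l)"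
    by (simp flip: lessThan_Suc_atMost)
  also have "\<dots> = (\<Sum>l\<in>{..j} \<union> {j<..i + j}. ?g l)"
    by (rule sum.union_disjoint[symmetric]) auto
  also have "{..j} \<union> {j<..i + j} = {..i + j}" by auto
  also have "(\<Sum>l\<le>i + j. ?g l) = 0" by (rule q_fun_quadratic[OF assms])
  finally show ?thesis by simp
qed

lemma Q_matrix_skew: "skew (Q_matrix t)"
proof -
  have "Q_matrix t y x = - Q_matrix t x y" for x y
  proof (cases "x + y > 0")
    case True
    then show ?thesis using theta_q_fun_skew[OF True, of t] by (auto simp: Q_matrix_def eq_neg_iff_add_eq_0 add.commute)
  qed (simp add: Q_matrix_def theta_def q_fun_0)
  then show ?thesis unfolding skew_def by blast
qed

lemma Q_matrix_0 [simp]: "Q_matrix t 0 0 = 0"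
  by (rule skew_diag[OF Q_matrix_skew])

lemma Q_matrix_right_0: "Q_matrix t a 0 = q_fun t a / 2 - (if a = 0 then 1 / 2 else 0)"
  by (simp add: Q_matrix_def theta_def q_fun_0)

definition root_two_weight :: "nat \<Rightarrow> complex" where
  "root_two_weight a = (if a = 0 then complex_of_real (sqrt 2) else 1)"

lemma sqrt_two_square: "complex_of_real (sqrt 2) * complex_of_real (sqrt 2) = 2"
  by (simp flip: of_real_mult)

lemma Q_two_eq: "Q_two t a b = root_two_weight a * root_two_weight b * Q_matrix t a b"
proof -
  have desc: "Q_desc t a b = root_two_weight a * root_two_weight b * Q_matrix t a b" if "a > b" for a b
  proof (cases "b = 0")
    case True
    have "q_fun t a / complex_of_real (sqrt 2)
        = complex_of_real (sqrt 2) * complex_of_real (sqrt 2) * q_fun t a / (2 * complex_of_real (sqrt 2))"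
      unfolding sqrt_two_square by simp
    then show ?thesis using that True by (simp add: Q_desc_def root_two_weight_def Q_matrix_right_0)
  qed (use that in \<open>simp add: Q_desc_def root_two_weight_def Q_matrix_def theta_def\<close>)
  show ?thesis
  proof (cases a b rule: linorder_cases)
    case less
    then show ?thesis using desc[OF less] by (simp add: Q_two_def skewD[OF Q_matrix_skew, of t a b] mult.commute)
  next
    case equal
    then show ?thesis using skew_diag[OF Q_matrix_skew] by (simp add: Q_two_def)
  next
    case greater
    then show ?thesis using desc by (simp add: Q_two_def)
  qed
qed

lemma Q_two_skew: "skew (Q_two t)"
proof -
  have "Q_two t y x = - Q_two t x y" for x y
    unfolding Q_two_eq by (subst skewD[OF Q_matrix_skew, of t y x]) simp
  then show ?thesis unfolding skew_def by blast
qed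

text \<open>\<open>1 - x z\<close> times the shifted series is \<open>1 + x z\<close> times the old
  one; this is applied in \<open>z\<close> and in \<open>w\<close>. For \<open>i = j = 0\<close> the
  correction of \<open>Q_matrix\<close> contributes \<open>- x^2 / 2\<close> to both sides.\<close>

lemma Q_matrix_shift:
  assumes "t' = shift_times t x"
  shows "Q_matrix t' (Suc i) (Suc j) - x * Q_matrix t' i (Suc j) - x * Q_matrix t' (Suc i) j + x * x * Q_matrix t' i j
       = Q_matrix t (Suc i) (Suc j) + x * Q_matrix t i (Suc j) + x * Q_matrix t (Suc i) j + x * x * Q_matrix t i j"
proof -
  have eq: "backward_comb (- x) (q_fun t') = backward_comb x (q_fun t)"
  proof
    fix k show "backward_comb (- x) (q_fun t') k = backward_comb x (q_fun t) k"
    proof (cases k)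
      case (Suc l)
      then show ?thesis using q_fun_shift[of t x l] by (simp add: backward_comb_def assms)
    qed (simp add: backward_comb_def q_fun_0)
  qed
  have *: "theta (backward_comb a u) (backward_comb a u) (Suc i) (Suc j)
      = theta u u (Suc i) (Suc j) + a * theta u u i (Suc j) + a * theta u u (Suc i) j + a * a * theta u u i j" for a u
    unfolding theta_backward_left theta_backward_right by (simp add: algebra_simps)
  have "theta (q_fun t') (q_fun t') (Suc i) (Suc j) - x * theta (q_fun t') (q_fun t') i (Suc j)
        - x * theta (q_fun t') (q_fun t') (Suc i) j + x * x * theta (q_fun t') (q_fun t') i j
      = theta (q_fun t) (q_fun t) (Suc i) (Suc j) + x * theta (q_fun t) (q_fun t) i (Suc j)
        + x * theta (q_fun t) (q_fun t) (Suc i) j + x * x * theta (q_fun t) (q_fun t) i j"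
    using *[of "- x" "q_fun t'"] *[of x "q_fun t"] unfolding eq by simp
  then show ?thesis by (cases "i = 0 \<and> j = 0") (simp_all add: Q_matrix_def algebra_simps)
qed

text \<open>With \<open>y = 1 / x\<close>: the entries, scaled by powers of \<open>y\<close>, of the shifted matrix in the basis of row
  combinations \<open>e\<^sub>a - x\<^sup>a\<^sup>-\<^sup>b e\<^sub>b\<close> are polynomials in \<open>y\<close>.\<close>

definition row_entry :: "(nat \<Rightarrow> complex) \<Rightarrow> complex \<Rightarrow> nat \<Rightarrow> nat \<Rightarrow> nat \<Rightarrow> nat \<Rightarrow> complex" where
  "row_entry t y a b c d = (\<Sum>i=b..<a. \<Sum>j=d..<c. y ^ (i - b) * y ^ (j - d) *
     (y * y * Q_matrix t (Suc i) (Suc j) + y * Q_matrix t i (Suc j) + y * Q_matrix t (Suc i) j + Q_matrix t i j))"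

definition col_entry :: "(nat \<Rightarrow> complex) \<Rightarrow> complex \<Rightarrow> nat \<Rightarrow> nat \<Rightarrow> complex" where
  "col_entry t y a b = (if b = 0 then 1 / 2 else 0) + (\<Sum>i=b..<a. y ^ (i - b) * (y * q_fun t (Suc i) + q_fun t i)) / 2"

lemma power_telescope:
  fixes y :: complex
  assumes "b \<le> a"
  shows "(\<Sum>i=b..<a. y ^ (i - b) * (y * f (Suc i) - f i)) = y ^ (a - b) * f a - f b"
  using assms by (induction rule: dec_induct) (simp_all add: Suc_diff_le algebra_simps)

text \<open>\<open>y^(a-b) e_a - e_b\<close> telescopes into the unit steps
  \<open>y e_(i+1) - e_i\<close>. For unit steps in both indices \<open>Q_matrix_shift\<close>
  trades the shifted matrix for the original one, and the factor \<open>y * y\<close> clears the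
  powers of \<open>x = 1 / y\<close>, so that only nonnegative powers of \<open>y\<close>
  remain.\<close>

lemma row_entry_shift:
  assumes "y \<noteq> 0" "b \<le> a" "d \<le> c" "t' = shift_times t (1 / y)"
  shows "y ^ (a - b) * (y ^ (c - d) * Q_matrix t' a c - Q_matrix t' a d) - (y ^ (c - d) * Q_matrix t' b c - Q_matrix t' b d)
       = row_entry t y a b c d"
proof -
  have "y ^ (a - b) * (y ^ (c - d) * Q_matrix t' a c - Q_matrix t' a d) - (y ^ (c - d) * Q_matrix t' b c - Q_matrix t' b d)
      = (\<Sum>i=b..<a. y ^ (i - b) * (y * (y ^ (c - d) * Q_matrix t' (Suc i) c - Q_matrix t' (Suc i) d)
          - (y ^ (c - d) * Q_matrix t' i c - Q_matrix t' i d)))"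
    by (rule power_telescope[OF assms(2), symmetric])
  also have "\<dots> = row_entry t y a b c d"
    unfolding row_entry_def
  proof (rule sum.cong[OF refl])
    fix i
    have "y * (y ^ (c - d) * Q_matrix t' (Suc i) c - Q_matrix t' (Suc i) d) - (y ^ (c - d) * Q_matrix t' i c - Q_matrix t' i d)
        = (\<Sum>j=d..<c. y ^ (j - d) * (y * (y * Q_matrix t' (Suc i) (Suc j) - Q_matrix t' i (Suc j))
            - (y * Q_matrix t' (Suc i) j - Q_matrix t' i j)))"
      unfolding power_telescope[OF assms(3), of y "\<lambda>j. y * Q_matrix t' (Suc i) j - Q_matrix t' i j"]
      by (simp add: algebra_simps)
    also have "\<dots> = (\<Sum>j=d..<c. y ^ (j - d) * (y * y * Q_matrix t (Suc i) (Suc j) + y * Q_matrix t i (Suc j)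
        + y * Q_matrix t (Suc i) j + Q_matrix t i j))"
    proof (rule sum.cong[OF refl])
      fix j
      have "y * (y * Q_matrix t' (Suc i) (Suc j) - Q_matrix t' i (Suc j)) - (y * Q_matrix t' (Suc i) j - Q_matrix t' i j)
        = y * y * (Q_matrix t' (Suc i) (Suc j) - 1 / y * Q_matrix t' i (Suc j) - 1 / y * Q_matrix t' (Suc i) j
            + 1 / y * (1 / y) * Q_matrix t' i j)"
        using assms(1) by (simp add: field_simps)
      also have "\<dots> = y * y * Q_matrix t (Suc i) (Suc j) + y * Q_matrix t i (Suc j) + y * Q_matrix t (Suc i) j + Q_matrix t i j"
        unfolding Q_matrix_shift[OF assms(4)] using assms(1) by (simp add: field_simps)
      finally show "y ^ (j - d) * (y * (y * Q_matrix t' (Suc i) (Suc j) - Q_matrix t' i (Suc j))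
            - (y * Q_matrix t' (Suc i) j - Q_matrix t' i j))
          = y ^ (j - d) * (y * y * Q_matrix t (Suc i) (Suc j) + y * Q_matrix t i (Suc j)
            + y * Q_matrix t (Suc i) j + Q_matrix t i j)" by simp
    qed
    finally show "y ^ (i - b) * (y * (y ^ (c - d) * Q_matrix t' (Suc i) c - Q_matrix t' (Suc i) d)
          - (y ^ (c - d) * Q_matrix t' i c - Q_matrix t' i d))
      = (\<Sum>j=d..<c. y ^ (i - b) * y ^ (j - d) * (y * y * Q_matrix t (Suc i) (Suc j) + y * Q_matrix t i (Suc j)
        + y * Q_matrix t (Suc i) j + Q_matrix t i j))"
      by (simp add: sum_distrib_left mult.assoc)
  qed
  finally show ?thesis .
qed

text \<open>Column 0 is not combined with another one. The summand 1/2 of \<open>col_entry\<close>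
  at \<open>b = 0\<close> accounts for the correction of \<open>Q_matrix\<close> at
  \<open>(0, 0)\<close>.\<close>

lemma col_entry_shift:
  assumes "y \<noteq> 0" "b < a" "t' = shift_times t (1 / y)"
  shows "y ^ (a - b) * Q_matrix t' a 0 - Q_matrix t' b 0 = col_entry t y a b"
proof -
  have "y * q_fun t' (Suc i) - q_fun t' i = y * q_fun t (Suc i) + q_fun t i" for i
  proof -
    have "y * q_fun t' (Suc i) - q_fun t' i = y * (q_fun t' (Suc i) - 1 / y * q_fun t' i)"
      using assms(1) by (simp add: field_simps)
    also have "\<dots> = y * q_fun t (Suc i) + q_fun t i"
      unfolding assms(3) q_fun_shift using assms(1) by (simp add: field_simps)
    finally show ?thesis .
  qed
  then have "(\<Sum>i=b..<a. y ^ (i - b) * (y * q_fun t (Suc i) + q_fun t i)) = y ^ (a - b) * q_fun t' a - q_fun t' b"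
    using power_telescope[of b a y "q_fun t'"] assms(2) by simp
  then show ?thesis using assms(2) by (simp add: col_entry_def Q_matrix_right_0 diff_divide_distrib algebra_simps)
qed

lemma power_zero_sum:
  assumes "b < a"
  shows "(\<Sum>i=b..<a. (0 :: complex) ^ (i - b) * f i) = f b"
proof -
  have "(\<Sum>i=b..<a. (0 :: complex) ^ (i - b) * f i) = (\<Sum>i\<in>{b}. 0 ^ (i - b) * f i)"
    using assms by (intro sum.mono_neutral_right) auto
  then show ?thesis by simp
qed

text \<open>At \<open>y = 0\<close> only the lowest term of each telescoping sum survives: every
  index is replaced by the lower end of its pair.\<close>

lemma row_entry_0: "b < a \<Longrightarrow> d < c \<Longrightarrow> row_entry t 0 a b c d = Q_matrix t b d"
  by (simp add: row_entry_def power_zero_sum mult.assoc flip: sum_distrib_left)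

lemma col_entry_0: "b < a \<Longrightarrow> col_entry t 0 a b = Q_matrix t b 0 + (if b = 0 then 1 else 0)"
  by (simp add: col_entry_def power_zero_sum Q_matrix_right_0 q_fun_0)

lemma row_entry_skew: "row_entry t y c d a b = - row_entry t y a b c d"
proof -
  let ?S = "\<lambda>i j. y ^ (i - b) * y ^ (j - d) *
     (y * y * Q_matrix t (Suc i) (Suc j) + y * Q_matrix t i (Suc j) + y * Q_matrix t (Suc i) j + Q_matrix t i j)"
  have "row_entry t y c d a b = (\<Sum>j=d..<c. \<Sum>i=b..<a. - ?S i j)"
    unfolding row_entry_def
  proof (intro sum.cong refl)
    fix i j
    note s = skewD[OF Q_matrix_skew, of t]
    show "y ^ (j - d) * y ^ (i - b) *
       (y * y * Q_matrix t (Suc j) (Suc i) + y * Q_matrix t j (Suc i) + y * Q_matrix t (Suc j) i + Q_matrix t j i) = - ?S i j"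
      unfolding s[of "Suc i" "Suc j"] s[of "Suc i" j] s[of i "Suc j"] s[of i j] by (simp add: algebra_simps)
  qed
  also have "\<dots> = (\<Sum>i=b..<a. \<Sum>j=d..<c. - ?S i j)" by (rule sum.swap)
  finally show ?thesis by (simp add: row_entry_def sum_negf)
qed

text \<open>The pair \<open>(a, b)\<close> with \<open>a \<noteq> b\<close> stands for the row combination \<open>e\<^sub>a - x\<^sup>a\<^sup>-\<^sup>b e\<^sub>b\<close>, and \<open>(a, a)\<close> for \<open>e\<^sub>a\<close>.\<close>

definition pair_coeff :: "complex \<Rightarrow> nat \<times> nat \<Rightarrow> complex" where
  "pair_coeff x p = (if fst p = snd p then 0 else x ^ (fst p - snd p))"

definition pair_form :: "(nat \<Rightarrow> nat \<Rightarrow> complex) \<Rightarrow> complex \<Rightarrow> nat \<times> nat \<Rightarrow> nat \<times> nat \<Rightarrow> complex" where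
  "pair_form M x p r = M (fst p) (fst r) - pair_coeff x p * M (snd p) (fst r)
     - pair_coeff x r * M (fst p) (snd r) + pair_coeff x p * pair_coeff x r * M (snd p) (snd r)"

definition pair_scale :: "complex \<Rightarrow> nat \<times> nat \<Rightarrow> complex" where
  "pair_scale y p = (if fst p = snd p then y ^ fst p else y ^ (fst p - snd p))"

text \<open>An unpaired row is split as \<open>y^c e_c = (y^c e_c - e_0) + e_0\<close>, which yields
  a \<open>row_entry\<close> with lower end 0 and a \<open>col_entry\<close>. Two unpaired rows
  occur only as one and the same row, whence the last value 0.\<close>

definition pair_entry :: "(nat \<Rightarrow> complex) \<Rightarrow> complex \<Rightarrow> nat \<times> nat \<Rightarrow> nat \<times> nat \<Rightarrow> complex" where
  "pair_entry t y p r =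
     (if fst p \<noteq> snd p \<and> fst r \<noteq> snd r then row_entry t y (fst p) (snd p) (fst r) (snd r)
      else if fst p \<noteq> snd p then row_entry t y (fst p) (snd p) (fst r) 0 + col_entry t y (fst p) (snd p)
      else if fst r \<noteq> snd r then - (row_entry t y (fst r) (snd r) (fst p) 0 + col_entry t y (fst r) (snd r))
      else 0)"

lemma pair_form_skew:
  assumes "skew M"
  shows "skew (pair_form M x)"
proof -
  have "pair_form M x r p = - pair_form M x p r" for p r
    unfolding pair_form_def skewD[OF assms, of "fst p"] skewD[OF assms, of "snd p"]
    by (simp add: algebra_simps)
  then show ?thesis unfolding skew_def by blast
qed

lemma pair_entry_skew: "skew (pair_entry t y)"
proof -
  have "pair_entry t y r p = - pair_entry t y p r" for p r
    unfolding pair_entry_def using row_entry_skew[of t y "fst r" "snd r" "fst p" "snd p"] by simp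
  then show ?thesis unfolding skew_def by blast
qed

lemma pair_entry_shift:
  assumes y: "y \<noteq> 0" "t' = shift_times t (1 / y)"
    and p: "snd p \<le> fst p" "snd r \<le> fst r" "fst p = snd p \<Longrightarrow> fst r = snd r \<Longrightarrow> p = r"
  shows "pair_scale y p * pair_scale y r * pair_form (Q_matrix t') (1 / y) p r = pair_entry t y p r"
proof -
  have inv: "y ^ k * (1 / y) ^ k = 1" for k
    using y(1) by (simp flip: power_mult_distrib)
  have mixed: "pair_scale y p * pair_scale y r * pair_form (Q_matrix t') (1 / y) p r
      = row_entry t y (fst p) (snd p) (fst r) 0 + col_entry t y (fst p) (snd p)"
    if "snd p < fst p" "fst r = snd r" for p r
  proof -
    have "pair_scale y p * pair_scale y r * pair_form (Q_matrix t') (1 / y) p r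
        = y ^ (fst p - snd p) * (y ^ fst r * Q_matrix t' (fst p) (fst r))
          - y ^ (fst p - snd p) * (1 / y) ^ (fst p - snd p) * (y ^ fst r * Q_matrix t' (snd p) (fst r))"
      using that by (simp add: pair_scale_def pair_form_def pair_coeff_def algebra_simps)
    then show ?thesis
      unfolding inv row_entry_shift[OF y(1) less_imp_le[OF that(1)] le0[of "fst r"] y(2), symmetric]
        col_entry_shift[OF y(1) that(1) y(2), symmetric]
      by (simp add: algebra_simps)
  qed
  consider "snd p < fst p" "snd r < fst r" | "snd p < fst p" "fst r = snd r" | "fst p = snd p" "snd r < fst r"
    | "fst p = snd p" "fst r = snd r" "p = r"
    using p by linarith
  then show ?thesis
  proof cases
    case 1
    let ?m = "fst p - snd p" and ?k = "fst r - snd r"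
    have "pair_scale y p * pair_scale y r * pair_form (Q_matrix t') (1 / y) p r
        = y ^ ?m * (y ^ ?k * Q_matrix t' (fst p) (fst r) - y ^ ?k * (1 / y) ^ ?k * Q_matrix t' (fst p) (snd r))
          - y ^ ?m * (1 / y) ^ ?m * (y ^ ?k * Q_matrix t' (snd p) (fst r) - y ^ ?k * (1 / y) ^ ?k * Q_matrix t' (snd p) (snd r))"
      using 1 by (simp add: pair_scale_def pair_form_def pair_coeff_def algebra_simps)
    then show ?thesis
      unfolding inv mult_1 row_entry_shift[OF y(1) less_imp_le[OF 1(1)] less_imp_le[OF 1(2)] y(2)]
      using 1 by (simp add: pair_entry_def)
  next
    case 2
    then show ?thesis using mixed[OF 2] by (simp add: pair_entry_def)
  next
    case 3
    have "pair_form (Q_matrix t') (1 / y) p r = - pair_form (Q_matrix t') (1 / y) r p"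
      by (rule skewD[OF pair_form_skew[OF Q_matrix_skew]])
    then show ?thesis using mixed[OF 3(2,1)] 3 by (simp add: pair_entry_def mult.commute)
  next
    case 4
    then show ?thesis using skew_diag[OF pair_form_skew[OF Q_matrix_skew]] by (simp add: pair_entry_def)
  qed
qed

section \<open>Row operations and the limit of a large variable\<close>

lemma row_contract_comb:
  assumes "\<And>w. w \<in> set ys \<Longrightarrow> A u w = B z w + c * C v w"
  shows "row_contract A u ys f = row_contract B z ys f + c * row_contract C v ys f"
  using assms
proof (induction ys arbitrary: f)
  case (Cons y ys)
  have "row_contract A u ys (\<lambda>zs. f (y # zs)) = row_contract B z ys (\<lambda>zs. f (y # zs)) + c * row_contract C v ys (\<lambda>zs. f (y # zs))"
    by (rule Cons.IH) (use Cons.prems in simp)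
  moreover have "A u y = B z y + c * C v y" by (rule Cons.prems) simp
  ultimately show ?case by (simp add: algebra_simps)
qed simp

lemma rec_pf_repeated:
  assumes "skew A"
  shows "rec_pf A (v # us @ v # ws) = 0"
proof -
  have "rec_pf A ([] @ v # us @ v # ws) = - rec_pf A ([] @ v # us @ v # ws)"
    by (rule rec_pf_swap[OF assms])
  then show ?thesis unfolding append_Nil by (metis eq_neg_iff_add_eq_0 mult_2 mult_eq_0_iff zero_neq_numeral)
qed

lemma rec_pf_row_operation:
  assumes "skew A" "\<And>w. A u w = A z w + c * A v w"
  shows "rec_pf A (ps @ u # v # qs) = rec_pf A (ps @ z # v # qs)"
proof -
  have "rec_pf A (u # ps @ v # qs) = rec_pf A (z # ps @ v # qs) + c * rec_pf A (v # ps @ v # qs)"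
    unfolding rec_pf.simps by (rule row_contract_comb) (rule assms(2))
  then show ?thesis
    by (simp only: rec_pf_move_front[OF assms(1), of ps] rec_pf_repeated[OF assms(1)] mult_zero_right add_0_right)
qed

fun pair_rows :: "nat list \<Rightarrow> (nat \<times> nat) list" where
  "pair_rows [] = []"
| "pair_rows [a] = [(a, a)]"
| "pair_rows (a # b # L) = (a, b) # pair_rows (b # L)"

lemma pair_form_diag: "pair_form M x (a, a) (b, b) = M a b"
  by (simp add: pair_form_def pair_coeff_def)

text \<open>The later rows are restored first, so that the row \<open>(b, b)\<close> needed to turn
  \<open>(a, b)\<close> into \<open>(a, a)\<close> is present.\<close>

lemma rec_pf_pair_rows:
  assumes "skew M" "sorted_wrt (>) L"
  shows "rec_pf (pair_form M x) (ps @ pair_rows L) = rec_pf (pair_form M x) (ps @ map (\<lambda>a. (a, a)) L)"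
  using assms(2)
proof (induction L arbitrary: ps rule: pair_rows.induct)
  case (3 a b L)
  have "rec_pf (pair_form M x) (ps @ pair_rows (a # b # L)) = rec_pf (pair_form M x) ((ps @ [(a, b)]) @ map (\<lambda>a. (a, a)) (b # L))"
    using 3 by (subst 3(1)[symmetric]) auto
  also have "\<dots> = rec_pf (pair_form M x) (ps @ (a, b) # (b, b) # map (\<lambda>a. (a, a)) L)" by simp
  also have "\<dots> = rec_pf (pair_form M x) (ps @ (a, a) # (b, b) # map (\<lambda>a. (a, a)) L)"
  proof (rule rec_pf_row_operation[OF pair_form_skew[OF assms(1)], symmetric])
    fix w
    show "pair_form M x (a, a) w = pair_form M x (a, b) w + x ^ (a - b) * pair_form M x (b, b) w"
      using 3(2) by (simp add: pair_form_def pair_coeff_def algebra_simps)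
  qed
  finally show ?case by simp
qed simp_all

lemma pair_rows_members:
  assumes "sorted_wrt (>) L" "p \<in> set (pair_rows L)"
  shows "snd p \<le> fst p" "fst p = snd p \<Longrightarrow> p = (last L, last L)" "fst p \<in> set L" "snd p \<in> set L"
  using assms by (induction L rule: pair_rows.induct) auto

text \<open>The exponents are the successive differences of the parts and the last part; they add up
  to the largest part.\<close>

lemma prod_list_pair_scale:
  "sorted_wrt (>) (a # L) \<Longrightarrow> prod_list (map (pair_scale y) (pair_rows (a # L))) = y ^ a"
proof (induction L arbitrary: a)
  case (Cons b L)
  then have "a > b" by simp
  then show ?case using Cons by (simp add: pair_scale_def flip: power_add)
qed (simp add: pair_scale_def)

lemma rec_pf_pair_entry:
  assumes "y \<noteq> 0" "sorted_wrt (>) (a # L)"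
  shows "y ^ a * rec_pf (Q_matrix (shift_times t (1 / y))) (a # L) = rec_pf (pair_entry t y) (pair_rows (a # L))"
proof -
  let ?M = "Q_matrix (shift_times t (1 / y))" and ?L = "a # L"
  have "rec_pf ?M ?L = rec_pf (\<lambda>a b. pair_form ?M (1 / y) (a, a) (b, b)) ?L"
    unfolding pair_form_diag by simp
  also have "\<dots> = rec_pf (pair_form ?M (1 / y)) ([] @ map (\<lambda>a. (a, a)) ?L)"
    unfolding append_Nil by (rule rec_pf_map)
  also have "\<dots> = rec_pf (pair_form ?M (1 / y)) (pair_rows ?L)"
    by (subst rec_pf_pair_rows[OF Q_matrix_skew assms(2), symmetric]) simp
  finally have "y ^ a * rec_pf ?M ?L
      = rec_pf (\<lambda>p r. pair_scale y p * pair_scale y r * pair_form ?M (1 / y) p r) (pair_rows ?L)"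
    by (simp only: rec_pf_scale prod_list_pair_scale[OF assms(2)])
  also have "\<dots> = rec_pf (pair_entry t y) (pair_rows ?L)"
  proof (rule rec_pf_cong)
    fix p r assume pr: "p \<in> set (pair_rows ?L)" "r \<in> set (pair_rows ?L)"
    show "pair_scale y p * pair_scale y r * pair_form ?M (1 / y) p r = pair_entry t y p r"
    proof (rule pair_entry_shift[OF assms(1) refl])
      show "snd p \<le> fst p" "snd r \<le> fst r" using pair_rows_members(1)[OF assms(2)] pr by blast+
      show "p = r" if "fst p = snd p" "fst r = snd r"
        using pair_rows_members(2)[OF assms(2) pr(1) that(1)] pair_rows_members(2)[OF assms(2) pr(2) that(2)] by simp
    qed
  qed
  finally show ?thesis .
qed

text \<open>The permutation formula is an explicit polynomial in the entries, so continuity is read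
  off there.\<close>

lemma tendsto_rec_pf:
  assumes "\<And>y. skew (A y)" "skew B" "\<And>a b. ((\<lambda>y. A y a b) \<longlongrightarrow> B a b) F"
  shows "((\<lambda>y. rec_pf (A y) xs) \<longlongrightarrow> rec_pf B xs) F"
proof -
  have "((\<lambda>y. pfaffian xs (A y)) \<longlongrightarrow> pfaffian xs B) F"
    unfolding pfaffian_def
    by (cases "even (length xs)") (auto intro!: tendsto_intros assms(3))
  then show ?thesis by (simp only: pfaffian_eq_rec_pf[OF assms(1)] pfaffian_eq_rec_pf[OF assms(2)])
qed

lemma tendsto_row_entry: "((\<lambda>y. row_entry t y a b c d) \<longlongrightarrow> row_entry t 0 a b c d) (at 0)"
  unfolding row_entry_def by (intro tendsto_intros)

lemma tendsto_col_entry: "((\<lambda>y. col_entry t y a b) \<longlongrightarrow> col_entry t 0 a b) (at 0)"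
  unfolding col_entry_def by (intro tendsto_intros) simp_all

lemma tendsto_pair_entry: "((\<lambda>y. pair_entry t y p r) \<longlongrightarrow> pair_entry t 0 p r) (at 0)"
  unfolding pair_entry_def by (auto intro!: tendsto_intros tendsto_row_entry tendsto_col_entry)

lemma tendsto_Q_matrix_shift:
  assumes "sorted_wrt (>) (a # L)"
  shows "((\<lambda>y. y ^ a * rec_pf (Q_matrix (shift_times t (1 / y))) (a # L))
    \<longlongrightarrow> rec_pf (pair_entry t 0) (pair_rows (a # L))) (at 0)"
proof (rule Lim_transform_eventually)
  show "((\<lambda>y. rec_pf (pair_entry t y) (pair_rows (a # L))) \<longlongrightarrow> rec_pf (pair_entry t 0) (pair_rows (a # L))) (at 0)"
    by (rule tendsto_rec_pf[OF pair_entry_skew pair_entry_skew tendsto_pair_entry])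
  show "\<forall>\<^sub>F y in at 0. rec_pf (pair_entry t y) (pair_rows (a # L)) = y ^ a * rec_pf (Q_matrix (shift_times t (1 / y))) (a # L)"
    by (rule eventually_mono[OF eventually_neq_at_within[of 0]]) (rule rec_pf_pair_entry[OF _ assms, symmetric])
qed

definition limit_index :: "nat \<times> nat \<Rightarrow> nat" where
  "limit_index p = (if fst p = snd p then 0 else snd p)"

lemma map_limit_index:
  "sorted_wrt (>) (a # L) \<Longrightarrow> map limit_index (pair_rows (a # L)) = L @ [0]"
proof (induction L arbitrary: a)
  case (Cons b L)
  then have "a > b" by simp
  then show ?case using Cons by (simp add: limit_index_def)
qed (simp add: limit_index_def)

text \<open>In the limit the indices \<open>a # L\<close> become \<open>L @ [0]\<close>. The
  unpaired last row meets any other row \<open>(a, b)\<close> in a \<open>row_entry\<close> plus a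
  \<open>col_entry\<close>, both equal to \<open>Q_matrix t b 0\<close> because
  \<open>b > 0\<close>; this is the factor 2.\<close>

lemma rec_pf_pair_entry_0_positive:
  assumes L: "sorted_wrt (>) (a # L)" "0 \<notin> set (a # L)"
  shows "rec_pf (pair_entry t 0) (pair_rows (a # L)) = 2 * rec_pf (Q_matrix t) (L @ [0])"
proof -
  define g :: "nat \<times> nat \<Rightarrow> complex" where "g p = (if fst p = snd p then 2 else 1)" for p
  have g: "prod_list (map g (pair_rows (a # L))) = 2" if "sorted_wrt (>) (a # L)" for a L
    using that
  proof (induction L arbitrary: a)
    case (Cons b L)
    then have "a > b" by simp
    then show ?case using Cons by (simp add: g_def)
  qed (simp add: g_def)
  have "rec_pf (pair_entry t 0) (pair_rows (a # L))
      = rec_pf (\<lambda>p r. g p * g r * Q_matrix t (limit_index p) (limit_index r)) (pair_rows (a # L))"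
  proof (rule rec_pf_cong)
    fix p r assume pr: "p \<in> set (pair_rows (a # L))" "r \<in> set (pair_rows (a # L))"
    have le: "snd p \<le> fst p" "snd r \<le> fst r" and pos: "snd p > 0" "snd r > 0" "fst p > 0" "fst r > 0"
      using pair_rows_members[OF L(1) pr(1)] pair_rows_members[OF L(1) pr(2)] L(2) by (metis gr0I)+
    consider "snd p < fst p" "snd r < fst r" | "snd p < fst p" "fst r = snd r" | "fst p = snd p" "snd r < fst r"
      | "fst p = snd p" "fst r = snd r"
      using le by linarith
    then show "pair_entry t 0 p r = g p * g r * Q_matrix t (limit_index p) (limit_index r)"
    proof cases
      case 3
      have "Q_matrix t 0 (snd r) = - Q_matrix t (snd r) 0" by (rule skewD[OF Q_matrix_skew])
      then show ?thesis using 3 pos by (simp add: pair_entry_def g_def limit_index_def row_entry_0 col_entry_0)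
    qed (use pos in \<open>simp_all add: pair_entry_def g_def limit_index_def row_entry_0 col_entry_0\<close>)
  qed
  also have "\<dots> = prod_list (map g (pair_rows (a # L))) * rec_pf (\<lambda>p r. Q_matrix t (limit_index p) (limit_index r)) (pair_rows (a # L))"
    by (rule rec_pf_scale)
  also have "\<dots> = 2 * rec_pf (Q_matrix t) (L @ [0])"
    unfolding g[OF L(1)] rec_pf_map[of "Q_matrix t" limit_index] map_limit_index[OF L(1)] by (rule refl)
  finally show ?thesis .
qed

lemma row_contract_last:
  assumes "\<And>w. w \<in> set us \<Longrightarrow> A x w = 0"
  shows "row_contract A x (us @ [v]) f = (-1) ^ length us * A x v * f us"
  using assms by (induction us arbitrary: f) auto

lemma pair_rows_snoc_0:
  assumes "sorted_wrt (>) (a # L)" "0 \<notin> set (a # L)"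
  shows "\<exists>us. pair_rows (a # L @ [0]) = us @ [(last (a # L), 0), (0, 0)] \<and> map limit_index us = L
     \<and> (\<forall>p\<in>set us. snd p < fst p \<and> 0 < snd p)"
  using assms
proof (induction L arbitrary: a)
  case (Cons b L)
  have "sorted_wrt (>) (b # L)" "0 \<notin> set (b # L)" using Cons.prems by auto
  from Cons.IH[OF this] obtain us where us: "pair_rows (b # L @ [0]) = us @ [(last (b # L), 0), (0, 0)]"
    "map limit_index us = L" "\<forall>p\<in>set us. snd p < fst p \<and> 0 < snd p" by blast
  have ab: "b < a" "0 < b" using Cons.prems by auto
  have "pair_rows (a # (b # L) @ [0]) = ((a, b) # us) @ [(last (a # b # L), 0), (0, 0)]"
    using us(1) by simp
  moreover have "map limit_index ((a, b) # us) = b # L" using us(2) ab by (simp add: limit_index_def)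
  moreover have "\<forall>p\<in>set ((a, b) # us). snd p < fst p \<and> 0 < snd p" using us(3) ab by simp
  ultimately show ?case by (intro exI[of _ "(a, b) # us"] conjI) simp_all
qed simp

text \<open>Here both \<open>(c, 0)\<close> and \<open>(0, 0)\<close> tend to the index 0. Their
  rows agree against all other rows, but they pair with each other to 1, the extra summand in
  \<open>col_entry_0\<close>. Subtracting one from the other leaves a row with a single entry 1, and
  the Pfaffian shrinks to \<open>L\<close>.\<close>

lemma rec_pf_pair_entry_0_zero:
  assumes L: "sorted_wrt (>) (a # L)" "0 \<notin> set (a # L)" "odd (length (a # L))"
  shows "rec_pf (pair_entry t 0) (pair_rows (a # L @ [0])) = rec_pf (Q_matrix t) L"
proof -
  let ?A = "pair_entry t 0"
  obtain us where us: "pair_rows (a # L @ [0]) = us @ [(last (a # L), 0), (0, 0)]" "map limit_index us = L"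
    "\<forall>p\<in>set us. snd p < fst p \<and> 0 < snd p"
    using pair_rows_snoc_0[OF L(1,2)] by blast
  define c where "c = last (a # L)"
  have "c \<in> set (a # L)" unfolding c_def by (rule last_in_set) simp
  then have c: "c > 0" using L(2) by (metis gr0I)
  define D where "D = (\<lambda>p r. ?A p r - ?A (0, 0) r)"
  have same: "?A (c, 0) w = ?A (0, 0) w" if "w \<in> set us" for w
  proof -
    have w: "snd w < fst w" "0 < snd w" using that us(3) by blast+
    have "Q_matrix t 0 (snd w) = - Q_matrix t (snd w) 0" by (rule skewD[OF Q_matrix_skew])
    moreover have "row_entry t 0 (fst w) (snd w) 0 0 = 0" by (simp add: row_entry_def)
    ultimately show ?thesis using c w by (simp add: pair_entry_def row_entry_0 col_entry_0)
  qed
  have one: "?A (c, 0) (0, 0) = 1"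
  proof -
    have "row_entry t 0 c 0 0 0 = 0" by (simp add: row_entry_def)
    then show ?thesis using c by (simp add: pair_entry_def col_entry_0)
  qed
  have zero: "?A (0, 0) (0, 0) = 0" by (rule skew_diag[OF pair_entry_skew])
  have "rec_pf ?A (us @ (c, 0) # [(0, 0)]) = (-1) ^ length us * rec_pf ?A ((c, 0) # us @ [(0, 0)])"
    by (rule rec_pf_move_front[OF pair_entry_skew])
  also have "rec_pf ?A ((c, 0) # us @ [(0, 0)])
      = row_contract D (c, 0) (us @ [(0, 0)]) (rec_pf ?A) + 1 * row_contract ?A (0, 0) (us @ [(0, 0)]) (rec_pf ?A)"
    unfolding rec_pf.simps by (rule row_contract_comb) (simp add: D_def)
  also have "row_contract ?A (0, 0) (us @ [(0, 0)]) (rec_pf ?A) = 0"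
    using rec_pf_repeated[OF pair_entry_skew, of t 0 "(0, 0)" us "[]"] by simp
  also have "row_contract D (c, 0) (us @ [(0, 0)]) (rec_pf ?A) = (-1) ^ length us * D (c, 0) (0, 0) * rec_pf ?A us"
    by (rule row_contract_last) (simp add: D_def same)
  also have "D (c, 0) (0, 0) = 1" by (simp add: D_def one zero)
  finally have "rec_pf ?A (us @ [(c, 0), (0, 0)]) = rec_pf ?A us"
    by (simp only: mult_1_right mult_zero_right add_0_right mult.assoc minus_one_power_cancel)
  also have "\<dots> = rec_pf (\<lambda>p r. Q_matrix t (limit_index p) (limit_index r)) us"
    using us(3) by (intro rec_pf_cong) (auto simp: pair_entry_def limit_index_def row_entry_0)
  also have "\<dots> = rec_pf (Q_matrix t) L"
    unfolding rec_pf_map[of "Q_matrix t" limit_index] us(2) by (rule refl)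
  finally show ?thesis unfolding us(1) c_def .
qed

section \<open>Leading terms of Schur Q-functions and their independence\<close>

definition descending :: "nat set \<Rightarrow> nat list" where
  "descending \<mu> = rev (sorted_list_of_set \<mu>)"

lemma set_descending: "finite \<mu> \<Longrightarrow> set (descending \<mu>) = \<mu>"
  by (simp add: descending_def)

lemma sorted_descending: "sorted_wrt (>) (descending \<mu>)"
  unfolding descending_def sorted_wrt_rev
  by (rule sorted_wrt_mono_rel[OF _ strict_sorted_list_of_set]) simp

lemma length_descending: "length (descending \<mu>) = card \<mu>"
  by (simp add: descending_def)

lemma descending_insert_Max:
  assumes "finite \<nu>" "\<And>k. k \<in> \<nu> \<Longrightarrow> k < m"
  shows "descending (insert m \<nu>) = m # descending \<nu>"
proof -
  have "sorted_list_of_set (insert m \<nu>) = sorted_list_of_set \<nu> @ [m]"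
    using assms by (intro sorted_list_of_set_eqI) (auto simp: sorted_wrt_append)
  then show ?thesis by (simp add: descending_def)
qed

lemma augmented_descending:
  assumes "finite \<mu>" "0 \<notin> \<mu>"
  shows "augmented \<mu> = (if odd (card \<mu>) then descending \<mu> @ [0] else descending \<mu>)"
proof -
  have "0 < k" if "k \<in> \<mu>" for k using that assms(2) by (metis gr0I)
  then have "sorted_list_of_set (insert 0 \<mu>) = 0 # sorted_list_of_set \<mu>"
    using assms(1) by (intro sorted_list_of_set_eqI) auto
  then show ?thesis by (simp add: augmented_def descending_def)
qed

lemma schur_Q_eq:
  assumes "finite \<mu>" "0 \<notin> \<mu>"
  shows "schur_Q t \<mu> = (if odd (card \<mu>) then complex_of_real (sqrt 2) else 1) * rec_pf (Q_matrix t) (augmented \<mu>)"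
proof -
  have "schur_Q t \<mu> = rec_pf (\<lambda>a b. root_two_weight a * root_two_weight b * Q_matrix t a b) (augmented \<mu>)"
    unfolding schur_Q_def pfaffian_eq_rec_pf[OF Q_two_skew] Q_two_eq by (rule refl)
  also have "\<dots> = prod_list (map root_two_weight (augmented \<mu>)) * rec_pf (Q_matrix t) (augmented \<mu>)"
    by (rule rec_pf_scale)
  also have "map root_two_weight (descending \<mu>) = map (\<lambda>_. 1) (descending \<mu>)"
  proof (intro map_cong refl)
    fix k assume "k \<in> set (descending \<mu>)"
    then have "k \<noteq> 0" using assms set_descending by metis
    then show "root_two_weight k = 1" by (simp add: root_two_weight_def)
  qed
  then have "prod_list (map root_two_weight (augmented \<mu>)) = (if odd (card \<mu>) then complex_of_real (sqrt 2) else 1)"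
    using assms by (simp add: augmented_descending root_two_weight_def map_replicate_const prod_list_replicate)
  finally show ?thesis .
qed

text \<open>Both parities give the same constant. If \<open>card \<nu>\<close> is odd, the limit has
  the factor 2, of which \<open>schur_Q t \<nu>\<close> contains one \<open>sqrt 2\<close>; if it is
  even, the \<open>sqrt 2\<close> comes from the augmentation of
  \<open>insert m \<nu>\<close>.\<close>

lemma tendsto_schur_Q_shift:
  assumes "finite \<nu>" "0 \<notin> \<nu>" "m > 0" "\<And>k. k \<in> \<nu> \<Longrightarrow> k < m"
  shows "((\<lambda>y. y ^ m * schur_Q (shift_times t (1 / y)) (insert m \<nu>)) \<longlongrightarrow> complex_of_real (sqrt 2) * schur_Q t \<nu>) (at 0)"
proof -
  let ?L = "descending \<nu>" and ?r = "complex_of_real (sqrt 2)"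
  have m: "m \<notin> \<nu>" using assms(4) by blast
  have D: "descending (insert m \<nu>) = m # ?L" using assms by (intro descending_insert_Max)
  have s: "sorted_wrt (>) (m # ?L)" "0 \<notin> set (m # ?L)"
    using sorted_descending[of "insert m \<nu>"] assms unfolding D by (simp_all add: set_descending)
  have S: "finite (insert m \<nu>)" "0 \<notin> insert m \<nu>" using assms by auto
  show ?thesis
  proof (cases "odd (card \<nu>)")
    case True
    have "((\<lambda>y. y ^ m * rec_pf (Q_matrix (shift_times t (1 / y))) (m # ?L)) \<longlongrightarrow> 2 * rec_pf (Q_matrix t) (?L @ [0])) (at 0)"
      using tendsto_Q_matrix_shift[OF s(1)] unfolding rec_pf_pair_entry_0_positive[OF s] .
    moreover have "schur_Q t (insert m \<nu>) = rec_pf (Q_matrix t) (m # ?L)" for t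
      unfolding schur_Q_eq[OF S] augmented_descending[OF S] D using True m assms(1) by simp
    moreover have "?r * schur_Q t \<nu> = 2 * rec_pf (Q_matrix t) (?L @ [0])"
      unfolding schur_Q_eq[OF assms(1,2)] augmented_descending[OF assms(1,2)] using True
      by (simp add: sqrt_two_square flip: mult.assoc)
    ultimately show ?thesis by (simp only:)
  next
    case False
    have s0: "sorted_wrt (>) (m # ?L @ [0])"
      using s by (auto simp: sorted_wrt_append intro: gr0I)
    have odd: "odd (length (m # ?L))" using False by (simp add: length_descending)
    have "((\<lambda>y. ?r * (y ^ m * rec_pf (Q_matrix (shift_times t (1 / y))) (m # ?L @ [0]))) \<longlongrightarrow> ?r * rec_pf (Q_matrix t) ?L) (at 0)"
      using tendsto_Q_matrix_shift[OF s0] unfolding rec_pf_pair_entry_0_zero[OF s odd] by (rule tendsto_mult_left)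
    moreover have "y ^ m * schur_Q t (insert m \<nu>) = ?r * (y ^ m * rec_pf (Q_matrix t) (m # ?L @ [0]))" for t y
      unfolding schur_Q_eq[OF S] augmented_descending[OF S] D using False m assms(1) by simp
    moreover have "schur_Q t \<nu> = rec_pf (Q_matrix t) ?L"
      unfolding schur_Q_eq[OF assms(1,2)] augmented_descending[OF assms(1,2)] using False by simp
    ultimately show ?thesis by (simp only:)
  qed
qed

lemma strict_partitions_enat: "strict_partitions (enat N) = Pow {1..N}"
  by (auto simp: strict_partitions_def Suc_le_eq intro: finite_subset gr0I)

lemma schur_Q_empty: "schur_Q t {} = 1"
  by (simp add: schur_Q_eq augmented_def)

text \<open>With the variable \<open>1 / y\<close> added, multiply by \<open>y ^ Suc N\<close> and
  let \<open>y\<close> tend to 0. Partitions without the part \<open>Suc N\<close> grow too slowly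
  and disappear; the others leave a relation among the \<open>schur_Q t \<nu>\<close> with parts up
  to \<open>N\<close>. The induction hypothesis applies to this relation, and then to what remains
  of the original one.\<close>

lemma schur_Q_independent:
  assumes "\<And>t. (\<Sum>\<mu>\<in>strict_partitions (enat N). D \<mu> * schur_Q t \<mu>) = 0" "\<mu> \<in> strict_partitions (enat N)"
  shows "D \<mu> = 0"
  using assms
proof (induction N arbitrary: D \<mu>)
  case 0
  then show ?case by (simp add: strict_partitions_enat schur_Q_empty)
next
  case (Suc N)
  let ?m = "Suc N" and ?r = "complex_of_real (sqrt 2)"
  have ins: "{1..Suc N} = insert ?m {1..N}" by auto
  have split: "(\<Sum>\<mu>\<in>strict_partitions (enat ?m). f \<mu>)
      = (\<Sum>\<nu>\<in>strict_partitions (enat N). f \<nu>) + (\<Sum>\<nu>\<in>strict_partitions (enat N). f (insert ?m \<nu>))"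
    for f :: "nat set \<Rightarrow> complex"
    unfolding strict_partitions_enat ins by (rule sum_Pow_insert) auto
  have low: "((\<lambda>y. y ^ ?m * schur_Q (shift_times t (1 / y)) \<nu>) \<longlongrightarrow> 0) (at 0)"
    if \<nu>: "\<nu> \<in> strict_partitions (enat N)" for \<nu> t
  proof (cases "\<nu> = {}")
    case True
    have "((\<lambda>y :: complex. y ^ ?m) \<longlongrightarrow> 0 ^ ?m) (at 0)" by (intro tendsto_intros)
    then show ?thesis by (simp add: True schur_Q_empty)
  next
    case False
    have fin: "finite \<nu>" "\<nu> \<subseteq> {1..N}"
      using \<nu> finite_subset[of \<nu> "{1..N}"] by (simp_all add: strict_partitions_enat)
    define k where "k = Max \<nu>"
    have k: "k \<in> \<nu>" "\<And>l. l \<in> \<nu> - {k} \<Longrightarrow> l < k" "k > 0" "k \<le> N"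
    proof -
      show "k \<in> \<nu>" unfolding k_def by (rule Max_in[OF fin(1) False])
      then show "k > 0" "k \<le> N" using fin(2) by auto
      show "l < k" if "l \<in> \<nu> - {k}" for l
        using that Max_ge[OF fin(1), of l] unfolding k_def by auto
    qed
    then have e: "insert k (\<nu> - {k}) = \<nu>" by auto
    have "((\<lambda>y. y ^ k * schur_Q (shift_times t (1 / y)) (insert k (\<nu> - {k}))) \<longlongrightarrow> ?r * schur_Q t (\<nu> - {k})) (at 0)"
      using fin k by (intro tendsto_schur_Q_shift) auto
    then have "((\<lambda>y. y ^ (?m - k) * (y ^ k * schur_Q (shift_times t (1 / y)) \<nu>)) \<longlongrightarrow> 0 ^ (?m - k) * (?r * schur_Q t (\<nu> - {k}))) (at 0)"
      unfolding e by (intro tendsto_mult[OF tendsto_power[OF tendsto_ident_at]])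
    moreover have "y ^ (?m - k) * (y ^ k * z) = y ^ ?m * z" for y z :: complex
      using k by (simp flip: mult.assoc power_add)
    moreover have "0 ^ (?m - k) * (?r * schur_Q t (\<nu> - {k})) = 0" using k(4) by (simp add: Suc_diff_le)
    ultimately show ?thesis by (simp only:)
  qed
  have high: "D (insert ?m \<nu>) = 0" if "\<nu> \<in> strict_partitions (enat N)" for \<nu>
  proof -
    have "(\<Sum>\<nu>\<in>strict_partitions (enat N). (D (insert ?m \<nu>) * ?r) * schur_Q t \<nu>) = 0" for t
    proof -
      let ?f = "\<lambda>y. (\<Sum>\<nu>\<in>strict_partitions (enat N). D \<nu> * (y ^ ?m * schur_Q (shift_times t (1 / y)) \<nu>))
        + (\<Sum>\<nu>\<in>strict_partitions (enat N). D (insert ?m \<nu>) * (y ^ ?m * schur_Q (shift_times t (1 / y)) (insert ?m \<nu>)))"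
      have "?f y = y ^ ?m * (\<Sum>\<mu>\<in>strict_partitions (enat ?m). D \<mu> * schur_Q (shift_times t (1 / y)) \<mu>)" for y
        unfolding split distrib_left sum_distrib_left by (simp only: mult.left_commute[of "y ^ ?m"])
      then have "?f y = 0" for y unfolding Suc.prems(1) by simp
      then have f0: "?f = (\<lambda>y. 0)" by (rule ext)
      have "(?f \<longlongrightarrow> (\<Sum>\<nu>\<in>strict_partitions (enat N). D \<nu> * 0)
        + (\<Sum>\<nu>\<in>strict_partitions (enat N). D (insert ?m \<nu>) * (?r * schur_Q t \<nu>))) (at 0)"
      proof (intro tendsto_add tendsto_sum tendsto_mult_left low)
        fix \<nu> assume "\<nu> \<in> strict_partitions (enat N)"
        then have "\<nu> \<subseteq> {1..N}" "finite \<nu>"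
          using finite_subset[of \<nu> "{1..N}"] by (simp_all add: strict_partitions_enat)
        then show "((\<lambda>y. y ^ ?m * schur_Q (shift_times t (1 / y)) (insert ?m \<nu>)) \<longlongrightarrow> ?r * schur_Q t \<nu>) (at 0)"
          by (intro tendsto_schur_Q_shift) force+
      qed
      then have "(\<Sum>\<nu>\<in>strict_partitions (enat N). D \<nu> * 0)
        + (\<Sum>\<nu>\<in>strict_partitions (enat N). D (insert ?m \<nu>) * (?r * schur_Q t \<nu>)) = 0"
        unfolding f0 using tendsto_unique[OF _ _ tendsto_const] by (metis at_neq_bot)
      then show ?thesis by (simp add: mult.assoc)
    qed
    then have "D (insert ?m \<nu>) * ?r = 0" using that by (rule Suc.IH)
    then show ?thesis by simp
  qed
  then have "(\<Sum>\<mu>\<in>strict_partitions (enat N). D \<mu> * schur_Q t \<mu>) = 0" for t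
    using Suc.prems(1)[of t] unfolding split by simp
  then have "D \<nu> = 0" if "\<nu> \<in> strict_partitions (enat N)" for \<nu> using that by (rule Suc.IH)
  moreover have "\<mu> \<in> strict_partitions (enat N) \<or> (\<exists>\<nu>\<in>strict_partitions (enat N). \<mu> = insert ?m \<nu>)"
    using Suc.prems(2) unfolding strict_partitions_enat ins Pow_insert by auto
  ultimately show ?case using high by blast
qed

section \<open>Pure spinors and bilinear relations\<close>

definition toggle :: "nat \<Rightarrow> nat set \<Rightarrow> nat set" where
  "toggle j \<mu> = (if j \<in> \<mu> then \<mu> - {j} else insert j \<mu>)"

text \<open>Each \<open>e_i\<close> is monomial in the weight basis: a coordinate of
  \<open>e_i s\<close> is a scalar times one coordinate of \<open>s\<close>. Separating the scalar
  from the index makes quadratic expressions in \<open>s\<close> explicit.\<close>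

definition gen_coeff :: "int \<Rightarrow> nat set \<Rightarrow> complex" where
  "gen_coeff i \<mu> = (let j = nat \<bar>i\<bar> in
     if i = 0 then (-1) ^ card \<mu> / complex_of_real (sqrt 2)
     else if i > 0 then (if j \<in> \<mu> then sign_above j \<mu> else 0)
     else (if j \<in> \<mu> then 0 else (-1) ^ j * sign_above j \<mu>))"

definition gen_index :: "int \<Rightarrow> nat set \<Rightarrow> nat set" where
  "gen_index i \<mu> = (if i = 0 then \<mu> else toggle (nat \<bar>i\<bar>) \<mu>)"

lemma clifford_gen_eq: "clifford_gen i s \<mu> = gen_coeff i \<mu> * s (gen_index i \<mu>)"
  by (simp add: clifford_gen_def gen_coeff_def gen_index_def toggle_def Let_def)

lemma toggle_toggle [simp]: "toggle j (toggle j \<mu>) = \<mu>"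
  by (auto simp: toggle_def)

lemma mem_toggle: "k \<in> toggle j \<mu> \<longleftrightarrow> (if k = j then k \<notin> \<mu> else k \<in> \<mu>)"
  by (auto simp: toggle_def)

lemma finite_toggle [simp]: "finite (toggle j \<mu>) \<longleftrightarrow> finite \<mu>"
  by (auto simp: toggle_def)

lemma finite_gen_index [simp]: "finite (gen_index i \<mu>) \<longleftrightarrow> finite \<mu>"
  by (simp add: gen_index_def)

lemma toggle_strict_partitions:
  "\<mu> \<in> strict_partitions n \<Longrightarrow> j > 0 \<Longrightarrow> enat j \<le> n \<Longrightarrow> toggle j \<mu> \<in> strict_partitions n"
  by (auto simp: strict_partitions_def toggle_def)

lemma sign_above_nonzero [simp]: "sign_above j \<mu> \<noteq> 0"
  by (simp add: sign_above_def)

lemma gen_coeff_zero_nonzero [simp]: "gen_coeff 0 \<mu> \<noteq> 0"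
  by (simp add: gen_coeff_def)

section \<open>Finiteness of the sums over all indices\<close>

definition bounded_below :: "nat \<Rightarrow> (int \<Rightarrow> complex) \<Rightarrow> bool" where
  "bounded_below m w \<longleftrightarrow> (\<forall>i. i < - int m \<longrightarrow> w i = 0)"

text \<open>Phrased with a filter so that a common bound for finitely many vectors and sets is a
  conjunction of eventual statements.\<close>

lemma eventually_bounded_below:
  assumes "w \<in> vectors n"
  shows "\<forall>\<^sub>F m in sequentially. bounded_below m w"
proof -
  have fin: "finite {i. i < 0 \<and> w i \<noteq> 0}" using assms by (simp add: vectors_def)
  define M where "M = Max (insert 0 ((\<lambda>i. nat \<bar>i\<bar>) ` {i. i < 0 \<and> w i \<noteq> 0}))"
  have "w i = 0" if "M \<le> m" "i < - int m" for m i
  proof (rule ccontr)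
    assume "w i \<noteq> 0"
    then have "nat \<bar>i\<bar> \<in> insert 0 ((\<lambda>i. nat \<bar>i\<bar>) ` {i. i < 0 \<and> w i \<noteq> 0})" using that by auto
    then have "nat \<bar>i\<bar> \<le> M" unfolding M_def using fin by (intro Max_ge) auto
    then show False using that by linarith
  qed
  then show ?thesis unfolding eventually_sequentially bounded_below_def by blast
qed

lemma eventually_subset_atMost:
  fixes \<mu> :: "nat set"
  assumes "finite \<mu>"
  shows "\<forall>\<^sub>F m in sequentially. \<mu> \<subseteq> {..m}"
proof -
  obtain M where "\<forall>k\<in>\<mu>. k \<le> M" using assms unfolding finite_nat_set_iff_bounded_le by blast
  then have "\<forall>m\<ge>M. \<mu> \<subseteq> {..m}" by fastforce
  then show ?thesis unfolding eventually_sequentially by blast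
qed

lemma common_bound:
  assumes "finite X" "X \<subseteq> vectors n" "finite \<mu>"
  shows "\<exists>m. (\<forall>x\<in>X. bounded_below m x) \<and> \<mu> \<subseteq> {..m}"
proof -
  have "\<forall>\<^sub>F m in sequentially. (\<forall>x\<in>X. bounded_below m x) \<and> \<mu> \<subseteq> {..m}"
    using assms by (intro eventually_conj eventually_ball_finite eventually_subset_atMost) (auto intro: eventually_bounded_below)
  then show ?thesis by (rule eventually_happens'[OF sequentially_bot])
qed

lemma gen_index_subset: "\<mu> \<subseteq> {..m} \<Longrightarrow> i \<in> {- int m..int m} \<Longrightarrow> gen_index i \<mu> \<subseteq> {..m}"
  by (auto simp: gen_index_def toggle_def split: if_splits)

lemma gen_coeff_eq_0: "\<mu> \<subseteq> {..m} \<Longrightarrow> i > int m \<Longrightarrow> gen_coeff i \<mu> = 0"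
  by (auto simp: gen_coeff_def Let_def)

text \<open>Below \<open>- int m\<close> the vector vanishes; above \<open>int m\<close> the
  generator would need its index in \<open>\<mu>\<close>.\<close>

lemma clifford_eq_sum:
  assumes "bounded_below m w" "\<mu> \<subseteq> {..m}"
  shows "clifford w s \<mu> = (\<Sum>i\<in>{- int m..int m}. w i * clifford_gen i s \<mu>)"
  unfolding clifford_def
proof (rule Sum_any.expand_superset)
  show "{i. w i * clifford_gen i s \<mu> \<noteq> 0} \<subseteq> {- int m..int m}"
  proof
    fix i assume "i \<in> {i. w i * clifford_gen i s \<mu> \<noteq> 0}"
    then have "w i \<noteq> 0" "gen_coeff i \<mu> \<noteq> 0" by (auto simp: clifford_gen_eq)
    then show "i \<in> {- int m..int m}"
      using assms gen_coeff_eq_0[OF assms(2), of i] by (auto simp: bounded_below_def not_less[symmetric])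
  qed
qed simp

lemma Psi_eq_sum:
  assumes "bounded_below m x" "bounded_below m y"
  shows "Psi x y = (\<Sum>i\<in>{- int m..int m}. (-1) powi i * x i * y (- i))"
  unfolding Psi_def
proof (rule Sum_any.expand_superset)
  show "{i. (-1) powi i * x i * y (- i) \<noteq> 0} \<subseteq> {- int m..int m}"
  proof
    fix i assume "i \<in> {i. (-1) powi i * x i * y (- i) \<noteq> 0}"
    then have "x i \<noteq> 0" "y (- i) \<noteq> 0" by auto
    then have "\<not> i < - int m" "\<not> - i < - int m" using assms by (auto simp: bounded_below_def)
    then show "i \<in> {- int m..int m}" by auto
  qed
qed simp

lemma clifford_lincomb:
  assumes "x \<in> vectors n" "y \<in> vectors n" "finite \<mu>"
  shows "clifford (\<lambda>i. a * x i + b * y i) s \<mu> = a * clifford x s \<mu> + b * clifford y s \<mu>"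
proof -
  obtain m where m: "bounded_below m x" "bounded_below m y" "\<mu> \<subseteq> {..m}"
    using common_bound[of "{x, y}" n "\<mu>"] assms by auto
  then have "bounded_below m (\<lambda>i. a * x i + b * y i)" by (simp add: bounded_below_def)
  then show ?thesis
    using m by (simp add: clifford_eq_sum sum.distrib sum_distrib_left distrib_right mult.assoc)
qed

lemma clifford_spinor_lincomb:
  assumes "x \<in> vectors n" "finite \<mu>"
  shows "clifford x (\<lambda>\<nu>. a * s \<nu> + b * s' \<nu>) \<mu> = a * clifford x s \<mu> + b * clifford x s' \<mu>"
proof -
  obtain m where m: "bounded_below m x" "\<mu> \<subseteq> {..m}"
    using common_bound[of "{x}" n "\<mu>"] assms by auto
  then show ?thesis
    by (simp add: clifford_eq_sum clifford_gen_eq sum.distrib sum_distrib_left algebra_simps)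
qed

lemma vectors_lincomb:
  assumes "x \<in> vectors n" "y \<in> vectors n"
  shows "(\<lambda>i. a * x i + b * y i) \<in> vectors n"
proof -
  have "{i. i < 0 \<and> a * x i + b * y i \<noteq> 0} \<subseteq> {i. i < 0 \<and> x i \<noteq> 0} \<union> {i. i < 0 \<and> y i \<noteq> 0}" by auto
  then have "finite {i. i < 0 \<and> a * x i + b * y i \<noteq> 0}"
    by (rule finite_subset) (use assms in \<open>auto simp: vectors_def\<close>)
  moreover have "enat (nat \<bar>i\<bar>) \<le> n" if "a * x i + b * y i \<noteq> 0" for i
    using that assms unfolding vectors_def by (cases "x i = 0") auto
  ultimately show ?thesis by (simp add: vectors_def)
qed

lemma Psi_lincomb_left:
  assumes "x \<in> vectors n" "y \<in> vectors n" "z \<in> vectors n"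
  shows "Psi (\<lambda>i. a * x i + b * y i) z = a * Psi x z + b * Psi y z"
proof -
  obtain m where m: "bounded_below m x" "bounded_below m y" "bounded_below m z"
    using common_bound[of "{x, y, z}" n "{}"] assms by auto
  then have "bounded_below m (\<lambda>i. a * x i + b * y i)" by (simp add: bounded_below_def)
  then show ?thesis
    using m by (simp add: Psi_eq_sum sum.distrib sum_distrib_left algebra_simps)
qed

lemma minus_one_powi_uminus: "(-1 :: complex) powi (- i) = (-1) powi i"
  by (cases "even i") (simp_all add: power_int_minus_left)

lemma minus_one_powi_square: "(-1 :: complex) powi i * ((-1) powi i * z) = z"
  by (simp flip: power_int_mult_distrib mult.assoc)

lemma Psi_commute:
  assumes "x \<in> vectors n" "y \<in> vectors n"
  shows "Psi x y = Psi y x"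
proof -
  obtain m where m: "bounded_below m x" "bounded_below m y"
    using common_bound[of "{x, y}" n "{}"] assms by auto
  have "(\<Sum>i\<in>{- int m..int m}. (-1) powi i * x i * y (- i)) = (\<Sum>i\<in>{- int m..int m}. (-1) powi i * y i * x (- i))"
    by (rule sum.reindex_bij_witness[of _ uminus uminus]) (auto simp: minus_one_powi_uminus)
  then show ?thesis using m by (simp add: Psi_eq_sum)
qed

lemma Psi_lincomb_right:
  assumes "x \<in> vectors n" "y \<in> vectors n" "z \<in> vectors n"
  shows "Psi z (\<lambda>i. a * x i + b * y i) = a * Psi z x + b * Psi z y"
  using Psi_lincomb_left[OF assms] Psi_commute[OF assms(3) vectors_lincomb[OF assms(1,2)]]
    Psi_commute[OF assms(3,1)] Psi_commute[OF assms(3,2)] by simp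

lemma clifford_anticommute:
  assumes "x \<in> vectors n" "y \<in> vectors n" "finite \<mu>"
  shows "clifford x (clifford y s) \<mu> + clifford y (clifford x s) \<mu> = Psi x y * s \<mu>"
proof -
  obtain m where m: "bounded_below m x" "bounded_below m y" "\<mu> \<subseteq> {..m}"
    using common_bound[of "{x, y}" n "\<mu>"] assms by auto
  let ?J = "{- int m..int m}"
  have comp: "clifford x (clifford y s) \<mu> = (\<Sum>i\<in>?J. \<Sum>j\<in>?J. x i * y j * clifford_gen i (clifford_gen j s) \<mu>)"
    if "bounded_below m x" "bounded_below m y" for x y
  proof -
    have "clifford x (clifford y s) \<mu> = (\<Sum>i\<in>?J. x i * (gen_coeff i \<mu> * clifford y s (gen_index i \<mu>)))"
      using that m by (simp add: clifford_eq_sum clifford_gen_eq[of _ "clifford y s"])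
    also have "\<dots> = (\<Sum>i\<in>?J. x i * (gen_coeff i \<mu> * (\<Sum>j\<in>?J. y j * clifford_gen j s (gen_index i \<mu>))))"
      using that m by (intro sum.cong refl) (simp add: clifford_eq_sum gen_index_subset)
    also have "\<dots> = (\<Sum>i\<in>?J. \<Sum>j\<in>?J. x i * y j * clifford_gen i (clifford_gen j s) \<mu>)"
      by (simp only: clifford_gen_eq[of _ "clifford_gen _ s"] sum_distrib_left ac_simps)
    finally show ?thesis .
  qed
  have "clifford y (clifford x s) \<mu> = (\<Sum>i\<in>?J. \<Sum>j\<in>?J. x i * y j * clifford_gen j (clifford_gen i s) \<mu>)"
    unfolding comp[OF m(2,1)] by (subst sum.swap) (simp only: ac_simps)
  then have "clifford x (clifford y s) \<mu> + clifford y (clifford x s) \<mu>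
      = (\<Sum>i\<in>?J. \<Sum>j\<in>?J. x i * y j * (clifford_gen i (clifford_gen j s) \<mu> + clifford_gen j (clifford_gen i s) \<mu>))"
    unfolding comp[OF m(1,2)] by (simp only: sum.distrib distrib_left)
  also have "\<dots> = (\<Sum>i\<in>?J. \<Sum>j\<in>?J. if j = - i then (-1) powi i * x i * y j * s \<mu> else 0)"
    unfolding clifford_gen_anticommute[OF assms(3)] by (intro sum.cong refl) auto
  also have "\<dots> = (\<Sum>i\<in>?J. (-1) powi i * x i * y (- i) * s \<mu>)"
    by (intro sum.cong refl) (simp add: sum.delta')
  also have "\<dots> = Psi x y * s \<mu>"
    using m by (simp add: Psi_eq_sum sum_distrib_right)
  finally show ?thesis .
qed

lemma clifford_infinite:
  assumes "s \<in> spinors n" "infinite \<mu>"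
  shows "clifford w s \<mu> = 0"
proof -
  have "s (gen_index i \<mu>) = 0" for i
    using assms by (auto simp: spinors_def strict_partitions_def)
  then show ?thesis by (simp add: clifford_def clifford_gen_eq)
qed

lemma clifford_spinors:
  assumes "w \<in> vectors n" "s \<in> spinors n"
  shows "clifford w s \<in> spinors n"
  unfolding spinors_def
proof (intro CollectI allI impI)
  fix \<mu> assume \<mu>: "\<mu> \<notin> strict_partitions n"
  show "clifford w s \<mu> = 0"
  proof (cases "finite \<mu>")
    case True
    have "w i * clifford_gen i s \<mu> = 0" for i
    proof (rule ccontr)
      assume "w i * clifford_gen i s \<mu> \<noteq> 0"
      then have a: "w i \<noteq> 0" "gen_coeff i \<mu> \<noteq> 0" "s (gen_index i \<mu>) \<noteq> 0" by (auto simp: clifford_gen_eq)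
      then have "gen_index i \<mu> \<in> strict_partitions n" "enat (nat \<bar>i\<bar>) \<le> n"
        using assms by (auto simp: spinors_def vectors_def)
      then have "gen_index i (gen_index i \<mu>) \<in> strict_partitions n"
        unfolding gen_index_def[of i "gen_index i \<mu>"] by (auto intro: toggle_strict_partitions)
      then show False using \<mu> by (simp add: gen_index_def split: if_splits)
    qed
    then show ?thesis by (simp only: clifford_def Sum_any.neutral)
  qed (use assms clifford_infinite in auto)
qed

section \<open>Dual vectors and the pivot\<close>

definition dual_vector :: "spinor \<Rightarrow> nat set \<Rightarrow> int \<Rightarrow> complex" where
  "dual_vector s \<nu> i = (-1) powi i * clifford_gen (- i) s \<nu>"

lemma Psi_dual_vector: "Psi w (dual_vector s \<nu>) = clifford w s \<nu>"
  unfolding Psi_def clifford_def dual_vector_def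
  by (rule arg_cong[where f = Sum_any]) (simp add: fun_eq_iff minus_one_powi_uminus minus_one_powi_square mult.assoc mult.left_commute[of "w _"])

text \<open>A negative index \<open>- k\<close> in the support needs \<open>k \<in> \<nu>\<close>,
  so there are finitely many of them. Any nonzero index in the support has its absolute value in
  \<open>\<nu>\<close> or in a strict partition obtained from \<open>\<nu>\<close> by toggling it,
  which bounds it by \<open>n\<close>.\<close>

lemma dual_vector_vectors:
  assumes "s \<in> spinors n" "\<nu> \<in> strict_partitions n"
  shows "dual_vector s \<nu> \<in> vectors n"
proof -
  have nz: "gen_coeff (- i) \<nu> \<noteq> 0 \<and> s (gen_index (- i) \<nu>) \<noteq> 0" if "dual_vector s \<nu> i \<noteq> 0" for i
    using that by (auto simp: dual_vector_def clifford_gen_eq)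
  have "{i. i < 0 \<and> dual_vector s \<nu> i \<noteq> 0} \<subseteq> (\<lambda>k. - int k) ` \<nu>"
  proof
    fix i assume i: "i \<in> {i. i < 0 \<and> dual_vector s \<nu> i \<noteq> 0}"
    then have "gen_coeff (- i) \<nu> \<noteq> 0" "i < 0" using nz by blast+
    then have "nat \<bar>i\<bar> \<in> \<nu>" by (simp add: gen_coeff_def Let_def split: if_split_asm)
    then show "i \<in> (\<lambda>k. - int k) ` \<nu>" using i by (intro image_eqI[of _ _ "nat \<bar>i\<bar>"]) auto
  qed
  then have "finite {i. i < 0 \<and> dual_vector s \<nu> i \<noteq> 0}"
    by (rule finite_subset) (use assms in \<open>auto simp: strict_partitions_def\<close>)
  moreover have "enat (nat \<bar>i\<bar>) \<le> n" if "dual_vector s \<nu> i \<noteq> 0" for i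
  proof -
    have "gen_index (- i) \<nu> \<in> strict_partitions n" using nz[OF that] assms unfolding spinors_def by blast
    moreover have "i = 0 \<or> nat \<bar>i\<bar> \<in> gen_index (- i) \<nu> \<or> nat \<bar>i\<bar> \<in> \<nu>"
      by (simp add: gen_index_def toggle_def)
    ultimately consider "i = 0" | "enat (nat \<bar>i\<bar>) \<le> n"
      using assms(2) unfolding strict_partitions_def by blast
    then show ?thesis by cases (simp_all add: zero_enat_def[symmetric])
  qed
  ultimately show ?thesis by (simp add: vectors_def)
qed

definition sym_diff :: "'a set \<Rightarrow> 'a set \<Rightarrow> 'a set" where
  "sym_diff A B = (A - B) \<union> (B - A)"

text \<open>For a pivot \<open>\<lambda>\<close>, the vectors \<open>e\<^sub>i\<close> with \<open>i = lower \<lambda> j\<close> are those annihilating the basis spinor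
  attached to \<open>\<lambda>\<close>.\<close>

definition lower :: "nat set \<Rightarrow> nat \<Rightarrow> int" where
  "lower la j = (if j \<in> la then int j else - int j)"

lemma gen_coeff_lower: "j > 0 \<Longrightarrow> gen_coeff (lower la j) \<nu> \<noteq> 0 \<longleftrightarrow> (j \<in> \<nu> \<longleftrightarrow> j \<in> la)"
  by (simp add: gen_coeff_def lower_def Let_def)

lemma gen_coeff_upper: "j > 0 \<Longrightarrow> gen_coeff (- lower la j) \<nu> \<noteq> 0 \<longleftrightarrow> (j \<in> \<nu> \<longleftrightarrow> j \<notin> la)"
  by (simp add: gen_coeff_def lower_def Let_def)

lemma gen_index_lower: "j > 0 \<Longrightarrow> gen_index (lower la j) \<nu> = toggle j \<nu>"
  "j > 0 \<Longrightarrow> gen_index (- lower la j) \<nu> = toggle j \<nu>"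
  by (simp_all add: gen_index_def lower_def)

lemma lower_nonzero [simp]: "j > 0 \<Longrightarrow> lower la j \<noteq> 0"
  by (simp add: lower_def)

lemma lower_cases:
  obtains "i = 0" | j where "j > 0" "i = lower la j" | j where "j > 0" "i = - lower la j"
proof (cases "i = 0")
  case False
  have "i = lower la (nat \<bar>i\<bar>) \<or> i = - lower la (nat \<bar>i\<bar>)" by (auto simp: lower_def)
  then show ?thesis using False that(2,3)[of "nat \<bar>i\<bar>"] by auto
qed

lemma sym_diff_toggle:
  assumes "k \<in> \<nu> \<longleftrightarrow> k \<notin> la"
  shows "sym_diff la (toggle k \<nu>) = sym_diff la \<nu> - {k}" "k \<in> sym_diff la \<nu>"
  using assms by (auto simp: sym_diff_def toggle_def)

lemma finite_sym_diff: "finite A \<Longrightarrow> finite B \<Longrightarrow> finite (sym_diff A B)"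
  by (simp add: sym_diff_def)

text \<open>Each \<open>y j\<close> expresses a coordinate through coordinates closer to the pivot.\<close>

lemma pivot_determines:
  assumes s: "s \<in> spinors n" and la: "la \<in> strict_partitions n" and s0: "s la = 0"
    and yV: "\<And>j. j > 0 \<Longrightarrow> enat j \<le> n \<Longrightarrow> y j \<in> vectors n"
    and yk: "\<And>j k. j > 0 \<Longrightarrow> enat j \<le> n \<Longrightarrow> k > 0 \<Longrightarrow> k \<noteq> j \<Longrightarrow> y j (lower la k) = 0"
    and yj: "\<And>j. j > 0 \<Longrightarrow> enat j \<le> n \<Longrightarrow> y j (lower la j) \<noteq> 0"
    and kill: "\<And>j \<mu>. j > 0 \<Longrightarrow> enat j \<le> n \<Longrightarrow> \<mu> \<in> strict_partitions n \<Longrightarrow> clifford (y j) s \<mu> = 0"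
  shows "s \<mu> = 0"
proof (induction "card (sym_diff la \<mu>)" arbitrary: \<mu> rule: less_induct)
  case less
  show ?case
  proof (cases "\<mu> \<in> strict_partitions n \<and> \<mu> \<noteq> la")
    case False
    then show ?thesis using s s0 by (auto simp: spinors_def)
  next
    case True
    then have \<mu>: "\<mu> \<in> strict_partitions n" "finite \<mu>" "finite la" "0 \<notin> \<mu>" "0 \<notin> la"
      using la by (auto simp: strict_partitions_def)
    have "sym_diff la \<mu> \<noteq> {}" using True by (auto simp: sym_diff_def)
    then obtain j where jd: "j \<in> sym_diff la \<mu>" by blast
    then have j: "j > 0" "enat j \<le> n" "j \<in> \<mu> \<longleftrightarrow> j \<notin> la"
      using \<mu> la by (auto simp: sym_diff_def strict_partitions_def intro!: gr0I)
    define \<nu> where "\<nu> = toggle j \<mu>"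
    have \<nu>: "\<nu> \<in> strict_partitions n" "finite \<nu>" "j \<in> \<nu> \<longleftrightarrow> j \<in> la" "toggle j \<nu> = \<mu>"
      using \<mu> j toggle_strict_partitions[of \<mu> n j] by (auto simp: \<nu>_def mem_toggle)
    have dist: "card (sym_diff la \<nu>) < card (sym_diff la \<mu>)"
      unfolding \<nu>_def sym_diff_toggle(1)[OF j(3)] using jd \<mu> by (intro card_Diff1_less finite_sym_diff)
    \<comment> \<open>Index 0 stays at \<open>\<nu>\<close>; other lower indices are excluded by
      \<open>yk\<close>; an upper index either removes one more difference from \<open>la\<close> or
      has coefficient 0.\<close>
    have other: "y j i * clifford_gen i s \<nu> = 0" if "i \<noteq> lower la j" for i
    proof (cases rule: lower_cases[where i = i and la = la])
      case 1
      then show ?thesis using less(1)[OF dist] by (simp add: clifford_gen_eq gen_index_def)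
    next
      case (2 k)
      then show ?thesis using that yk[OF j(1,2)] by auto
    next
      case (3 k)
      show ?thesis
      proof (cases "k \<in> \<nu> \<longleftrightarrow> k \<notin> la")
        case True
        have "card (sym_diff la (toggle k \<nu>)) \<le> card (sym_diff la \<nu>)"
          unfolding sym_diff_toggle(1)[OF True] using \<mu> \<nu> by (intro card_mono finite_sym_diff) auto
        then have "s (toggle k \<nu>) = 0" using dist by (intro less(1)) simp
        then show ?thesis using 3 by (simp add: clifford_gen_eq gen_index_lower)
      next
        case False
        then have "gen_coeff i \<nu> = 0" using 3 gen_coeff_upper by blast
        then show ?thesis by (simp add: clifford_gen_eq)
      qed
    qed
    have "clifford (y j) s \<nu> = (\<Sum>i\<in>{lower la j}. y j i * clifford_gen i s \<nu>)"
      unfolding clifford_def by (rule Sum_any.expand_superset) (use other in auto)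
    then have "y j (lower la j) * (gen_coeff (lower la j) \<nu> * s \<mu>) = 0"
      using kill[OF j(1,2) \<nu>(1)] j \<nu>(4) by (simp add: clifford_gen_eq gen_index_lower)
    then show ?thesis using yj[OF j(1,2)] gen_coeff_lower[OF j(1)] \<nu>(3) by auto
  qed
qed

lemma dual_vector_lower_other:
  assumes "k > 0" "k \<in> \<nu> \<longleftrightarrow> k \<in> la"
  shows "dual_vector s \<nu> (lower la k) = 0"
proof -
  have "gen_coeff (- lower la k) \<nu> = 0" using gen_coeff_upper[OF assms(1)] assms(2) by blast
  then show ?thesis by (simp add: dual_vector_def clifford_gen_eq)
qed

lemma dual_vector_lower_self:
  assumes "j > 0" "s la \<noteq> 0"
  shows "dual_vector s (toggle j la) (lower la j) \<noteq> 0"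
proof -
  have "gen_coeff (- lower la j) (toggle j la) \<noteq> 0" using gen_coeff_upper[OF assms(1)] by (simp add: mem_toggle)
  then show ?thesis using assms by (simp add: dual_vector_def clifford_gen_eq gen_index_lower)
qed

text \<open>Among the indices \<open>lower la k\<close> the dual vector at
  \<open>toggle j la\<close> has a component only for \<open>k = j\<close>, and the one at
  \<open>la\<close> has none. The family is thus in echelon form for any \<open>c\<close>, and
  \<open>c\<close> stays free to make the vectors isotropic or annihilating.\<close>

definition pivot_vector :: "spinor \<Rightarrow> nat set \<Rightarrow> (nat \<Rightarrow> complex) \<Rightarrow> nat \<Rightarrow> int \<Rightarrow> complex" where
  "pivot_vector s la c j = (\<lambda>i. 1 * dual_vector s (toggle j la) i + (- c j) * dual_vector s la i)"

lemma pivot_vector_vectors: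
  assumes "s \<in> spinors n" "la \<in> strict_partitions n" "j > 0" "enat j \<le> n"
  shows "pivot_vector s la c j \<in> vectors n"
  unfolding pivot_vector_def
  by (intro vectors_lincomb dual_vector_vectors toggle_strict_partitions assms)

lemma pivot_vector_determines:
  assumes "s \<in> spinors n" "la \<in> strict_partitions n" "s la \<noteq> 0" "s' \<in> spinors n" "s' la = 0"
    and "\<And>j \<mu>. j > 0 \<Longrightarrow> enat j \<le> n \<Longrightarrow> \<mu> \<in> strict_partitions n \<Longrightarrow> clifford (pivot_vector s la c j) s' \<mu> = 0"
  shows "s' \<mu> = 0"
proof (rule pivot_determines[OF assms(4,2,5)])
  fix j assume j: "j > 0" "enat j \<le> n"
  show "pivot_vector s la c j \<in> vectors n" using pivot_vector_vectors assms j by blast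
  show "pivot_vector s la c j (lower la j) \<noteq> 0"
    using dual_vector_lower_self[of j s la] dual_vector_lower_other[of j la la s] assms j by (simp add: pivot_vector_def)
  show "pivot_vector s la c j (lower la k) = 0" if "k > 0" "k \<noteq> j" for k
    using that dual_vector_lower_other[of k "toggle j la" la s] dual_vector_lower_other[of k la la s]
    by (simp add: pivot_vector_def mem_toggle)
  show "clifford (pivot_vector s la c j) s' \<mu> = 0" if "\<mu> \<in> strict_partitions n" for \<mu>
    using assms(6) j that by blast
qed

section \<open>Bilinear relations and purity\<close>

definition bilinear_relations :: "enat \<Rightarrow> spinor \<Rightarrow> bool" where
  "bilinear_relations n s \<longleftrightarrow>
     (\<forall>\<mu>\<in>strict_partitions n. \<forall>\<nu>\<in>strict_partitions n. clifford (dual_vector s \<nu>) s \<mu> = s \<nu> * s \<mu> / 2)"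

lemma finite_strict_partition: "\<mu> \<in> strict_partitions n \<Longrightarrow> finite \<mu>"
  by (simp add: strict_partitions_def)

text \<open>\<open>dual_vector s la\<close> has no component at any \<open>lower la j\<close>, and
  for \<open>i \<noteq> 0\<close> one of \<open>i\<close> and \<open>- i\<close> has this form, so
  only the component at 0 contributes.\<close>

lemma Psi_dual_vector_pivot:
  assumes "la \<in> strict_partitions n"
  shows "Psi (dual_vector s la) (dual_vector s la) = (s la)\<^sup>2 / 2"
proof -
  let ?x = "dual_vector s la"
  have z: "(-1) powi i * ?x i * ?x (- i) = 0" if "i \<noteq> 0" for i
  proof (cases rule: lower_cases[where i = i and la = la])
    case (2 j)
    then show ?thesis using dual_vector_lower_other[of j la la s] by simp
  next
    case (3 j)
    then show ?thesis using dual_vector_lower_other[of j la la s] by simp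
  qed (use that in simp)
  have "Psi ?x ?x = (\<Sum>i\<in>{0}. (-1) powi i * ?x i * ?x (- i))"
    unfolding Psi_def by (rule Sum_any.expand_superset) (use z in auto)
  also have "\<dots> = (clifford_gen 0 s la)\<^sup>2"
    by (simp add: dual_vector_def power2_eq_square)
  also have "\<dots> = (s la)\<^sup>2 / 2"
    unfolding clifford_gen_zero
    by (simp add: power_mult_distrib power_divide flip: of_real_power power_mult)
  finally show ?thesis .
qed

lemma annihilator_isotropic:
  assumes "x \<in> vectors n" "y \<in> vectors n" "s \<mu> \<noteq> 0" "finite \<mu>"
    and "clifford x s = (\<lambda>\<mu>. 0)" "clifford y s = (\<lambda>\<mu>. 0)"
  shows "Psi x y = 0"
proof -
  have "clifford w (\<lambda>\<mu>. 0) \<mu> = 0" for w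
    by (simp add: clifford_def clifford_gen_eq)
  then have "Psi x y * s \<mu> = 0"
    using clifford_anticommute[OF assms(1,2,4), of s] assms(5,6) by simp
  then show ?thesis using assms(3) by simp
qed

lemma zero_vectors: "(\<lambda>i. 0) \<in> vectors n"
  by (simp add: vectors_def)

lemma clifford_zero_spinor: "clifford w (\<lambda>\<mu>. 0) = (\<lambda>\<mu>. 0)"
  by (simp add: clifford_def clifford_gen_eq fun_eq_iff)

lemma annihilator_totally_isotropic:
  assumes "s \<in> spinors n" "s \<noteq> (\<lambda>\<mu>. 0)"
  shows "totally_isotropic n {w \<in> vectors n. clifford w s = (\<lambda>\<mu>. 0)}"
proof -
  let ?L = "{w \<in> vectors n. clifford w s = (\<lambda>\<mu>. 0)}"
  obtain \<mu> where \<mu>: "s \<mu> \<noteq> 0" using assms(2) by blast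
  then have fin: "finite \<mu>" using assms(1) by (auto simp: spinors_def strict_partitions_def)
  have lin: "(\<lambda>i. a * x i + b * y i) \<in> ?L" if "x \<in> ?L" "y \<in> ?L" for a b x y
  proof -
    have V: "x \<in> vectors n" "y \<in> vectors n" using that by auto
    have "clifford (\<lambda>i. a * x i + b * y i) s \<mu> = 0" for \<mu>
    proof (cases "finite \<mu>")
      case True
      then show ?thesis using that V by (simp add: clifford_lincomb)
    qed (use assms clifford_infinite in blast)
    then show ?thesis using vectors_lincomb[OF V] by auto
  qed
  have 0: "(\<lambda>i. 0) \<in> ?L" by (simp add: zero_vectors clifford_def)
  show ?thesis
    unfolding totally_isotropic_def linear_subspace_def
  proof (intro conjI ballI allI 0)
    fix x y assume xy: "x \<in> ?L" "y \<in> ?L"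
    show "(\<lambda>i. x i + y i) \<in> ?L" using lin[OF xy, of 1 1] by simp
    show "Psi x y = 0" using xy annihilator_isotropic[of x n y s \<mu>] \<mu> fin by auto
  next
    fix c x assume "x \<in> ?L"
    then show "(\<lambda>i. c * x i) \<in> ?L" using lin[of x x c 0] by simp
  qed auto
qed

text \<open>By the relations, \<open>dual_vector s \<nu>\<close> acts on \<open>s\<close> as the
  scalar \<open>s \<nu> / 2\<close>; the ratio of two such scalars is the coefficient for which the
  difference acts as 0.\<close>

lemma bilinear_relations_kill:
  assumes s: "s \<in> spinors n" and F: "bilinear_relations n s" and la: "la \<in> strict_partitions n" "s la \<noteq> 0"
    and j: "j > 0" "enat j \<le> n"
  shows "clifford (pivot_vector s la (\<lambda>j. s (toggle j la) / s la) j) s = (\<lambda>\<mu>. 0)"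
proof
  fix \<mu>
  show "clifford (pivot_vector s la (\<lambda>j. s (toggle j la) / s la) j) s \<mu> = 0"
  proof (cases "\<mu> \<in> strict_partitions n")
    case True
    have t: "toggle j la \<in> strict_partitions n" using la j by (intro toggle_strict_partitions)
    have F': "clifford (dual_vector s \<nu>) s \<mu> = s \<nu> * s \<mu> / 2" if "\<nu> \<in> strict_partitions n" for \<nu>
      using F True that unfolding bilinear_relations_def by blast
    show ?thesis
      unfolding pivot_vector_def clifford_lincomb[OF dual_vector_vectors[OF s t] dual_vector_vectors[OF s la(1)]
          finite_strict_partition[OF True]] F'[OF t] F'[OF la(1)]
      using la(2) by simp
  next
    case False
    have "clifford (pivot_vector s la (\<lambda>j. s (toggle j la) / s la) j) s \<in> spinors n"
      by (intro clifford_spinors pivot_vector_vectors s la j)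
    then show ?thesis using False unfolding spinors_def by blast
  qed
qed

text \<open>A vector \<open>w\<close> in a totally isotropic space containing the annihilator is
  orthogonal to the pivot vectors, so these annihilate \<open>w s\<close> as well as
  \<open>s\<close>. Since they determine a spinor from its coordinate at \<open>la\<close>,
  \<open>w s = \<kappa> s\<close>, and \<open>w (w s) = 0\<close> forces
  \<open>\<kappa> = 0\<close>.\<close>

lemma bilinear_relations_imp_pure:
  assumes s: "s \<in> spinors n" "s \<noteq> (\<lambda>\<mu>. 0)" and F: "bilinear_relations n s"
  shows "pure_spinor n s"
proof -
  let ?L = "{w \<in> vectors n. clifford w s = (\<lambda>\<mu>. 0)}"
  obtain la where la: "s la \<noteq> 0" using s(2) by blast
  then have laS: "la \<in> strict_partitions n" "finite la"
    using s(1) by (auto simp: spinors_def strict_partitions_def)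
  let ?c = "\<lambda>j. s (toggle j la) / s la"
  let ?y = "pivot_vector s la ?c"
  have "L' = ?L" if L': "totally_isotropic n L'" "?L \<subseteq> L'" for L'
  proof -
    have "w \<in> ?L" if w: "w \<in> L'" for w
    proof -
      have wV: "w \<in> vectors n" using w L' unfolding totally_isotropic_def linear_subspace_def by blast
      have fin: "finite \<mu>" if "\<mu> \<in> strict_partitions n" for \<mu> using that by (simp add: strict_partitions_def)
      define s' where "s' = clifford w s"
      define \<kappa> where "\<kappa> = s' la / s la"
      have s': "s' \<in> spinors n" unfolding s'_def by (rule clifford_spinors[OF wV s(1)])
      define d where "d = (\<lambda>\<mu>. 1 * s' \<mu> + (- \<kappa>) * s \<mu>)"
      have "d \<mu> = 0" for \<mu>
      proof (rule pivot_vector_determines[OF s(1) laS(1) la])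
        show "d \<in> spinors n" using s s' by (simp add: d_def spinors_def)
        show "d la = 0" using la by (simp add: d_def \<kappa>_def)
        fix j \<mu> assume j: "j > 0" "enat j \<le> n" and \<mu>: "\<mu> \<in> strict_partitions n"
        have yV: "?y j \<in> vectors n" by (rule pivot_vector_vectors[OF s(1) laS(1) j])
        have ys: "clifford (?y j) s = (\<lambda>\<mu>. 0)" by (rule bilinear_relations_kill[OF s(1) F laS(1) la j])
        then have "Psi w (?y j) = 0"
          using L' w yV unfolding totally_isotropic_def by blast
        then have "clifford (?y j) s' \<mu> = 0"
          using clifford_anticommute[OF wV yV fin[OF \<mu>], of s] ys
          by (simp add: s'_def clifford_zero_spinor)
        then show "clifford (?y j) d \<mu> = 0"
          unfolding d_def clifford_spinor_lincomb[OF yV fin[OF \<mu>]] by (simp add: ys)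
      qed
      then have eq: "s' = (\<lambda>\<mu>. \<kappa> * s \<mu> + 0 * s \<mu>)" by (simp add: d_def fun_eq_iff)
      have "Psi w w = 0" using L'(1) w unfolding totally_isotropic_def by blast
      then have "clifford w s' la = 0"
        using clifford_anticommute[OF wV wV laS(2), of s] by (simp add: s'_def)
      moreover have "clifford w s' la = \<kappa> * s' la"
        by (subst eq, subst clifford_spinor_lincomb[OF wV laS(2)]) (simp add: s'_def)
      moreover have "s' la = \<kappa> * s la" using la by (simp add: \<kappa>_def)
      ultimately have "\<kappa> = 0" using la by simp
      then show ?thesis using wV eq by (simp add: s'_def)
    qed
    then show ?thesis using L'(2) by blast
  qed
  then show ?thesis
    unfolding pure_spinor_def lagrangian_def using s annihilator_totally_isotropic[OF s] by blast
qed

text \<open>Otherwise \<open>L\<close> and \<open>x\<close> would span a larger totally isotropic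
  subspace.\<close>

lemma lagrangian_contains:
  assumes L: "lagrangian n L" and x: "x \<in> vectors n" "\<And>w. w \<in> L \<Longrightarrow> Psi w x = 0" "Psi x x = 0"
  shows "x \<in> L"
proof -
  define L' where "L' = {\<lambda>i. 1 * w i + c * x i | w c. w \<in> L}"
  have LV: "w \<in> vectors n" if "w \<in> L" for w
    using that L unfolding lagrangian_def totally_isotropic_def linear_subspace_def by blast
  have L0: "(\<lambda>i. 0) \<in> L" and Ladd: "\<And>v w. v \<in> L \<Longrightarrow> w \<in> L \<Longrightarrow> (\<lambda>i. v i + w i) \<in> L"
    and Lmul: "\<And>c v. v \<in> L \<Longrightarrow> (\<lambda>i. c * v i) \<in> L" and Liso: "\<And>v w. v \<in> L \<Longrightarrow> w \<in> L \<Longrightarrow> Psi v w = 0"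
    using L unfolding lagrangian_def totally_isotropic_def linear_subspace_def by blast+
  have sub: "L \<subseteq> L'"
  proof
    fix w assume "w \<in> L"
    then show "w \<in> L'" unfolding L'_def by (intro CollectI exI[of _ w] exI[of _ 0]) simp
  qed
  have xL': "x \<in> L'" unfolding L'_def using L0 by (intro CollectI exI[of _ "\<lambda>i. 0"] exI[of _ 1]) simp
  have xw: "Psi x w = 0" if "w \<in> L" for w
    using x(2)[OF that] Psi_commute[OF x(1) LV[OF that]] by simp
  have "totally_isotropic n L'"
    unfolding totally_isotropic_def linear_subspace_def
  proof (intro conjI ballI allI)
    show "L' \<subseteq> vectors n" unfolding L'_def using vectors_lincomb[OF LV x(1)] by blast
    show "(\<lambda>i. 0) \<in> L'" using L0 sub by blast
  next
    fix v w assume "v \<in> L'" "w \<in> L'"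
    then obtain v' c w' d where v: "v = (\<lambda>i. 1 * v' i + c * x i)" "v' \<in> L" and w: "w = (\<lambda>i. 1 * w' i + d * x i)" "w' \<in> L"
      unfolding L'_def by blast
    show "(\<lambda>i. v i + w i) \<in> L'"
      unfolding L'_def using Ladd[OF v(2) w(2)]
      by (intro CollectI exI[of _ "\<lambda>i. v' i + w' i"] exI[of _ "c + d"]) (simp add: v w algebra_simps)
    have "w \<in> vectors n" unfolding w by (rule vectors_lincomb[OF LV[OF w(2)] x(1)])
    then show "Psi v w = 0"
      unfolding v(1) by (subst Psi_lincomb_left[OF LV[OF v(2)] x(1)])
        (simp_all only: w(1) Psi_lincomb_right[OF LV[OF w(2)] x(1)] LV[OF v(2)] x(1) Liso[OF v(2) w(2)]
          x(2)[OF v(2)] xw[OF w(2)] x(3) mult_zero_right add_0_left)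
  next
    fix c v assume "v \<in> L'"
    then obtain v' d where v: "v = (\<lambda>i. 1 * v' i + d * x i)" "v' \<in> L" unfolding L'_def by blast
    show "(\<lambda>i. c * v i) \<in> L'"
      unfolding L'_def using Lmul[OF v(2), of c]
      by (intro CollectI exI[of _ "\<lambda>i. c * v' i"] exI[of _ "c * d"]) (simp add: v algebra_simps)
  qed
  then have "L' = L" using L sub unfolding lagrangian_def by blast
  then show ?thesis using xL' by simp
qed

lemma complex_quadratic_root:
  fixes a b d :: complex
  assumes "a \<noteq> 0"
  obtains c where "a * c\<^sup>2 + b * c + d = 0"
proof
  let ?r = "csqrt (b\<^sup>2 - 4 * a * d)"
  have "a * ((?r - b) / (2 * a))\<^sup>2 + b * ((?r - b) / (2 * a)) + d = (?r\<^sup>2 - (b\<^sup>2 - 4 * a * d)) / (4 * a)"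
    using assms by (simp add: field_simps power2_eq_square del: power2_csqrt)
  then show "a * ((?r - b) / (2 * a))\<^sup>2 + b * ((?r - b) / (2 * a)) + d = 0"
    by simp
qed

text \<open>Once the pivot vectors lie in the annihilator, every vector orthogonal to it acts on
  \<open>s\<close> by a scalar; the relations state the values of these scalars for the dual
  vectors.\<close>

lemma pure_imp_bilinear_relations:
  assumes "pure_spinor n s"
  shows "bilinear_relations n s"
proof -
  let ?L = "{w \<in> vectors n. clifford w s = (\<lambda>\<mu>. 0)}"
  have s: "s \<in> spinors n" "s \<noteq> (\<lambda>\<mu>. 0)" and L: "lagrangian n ?L"
    using assms by (auto simp: pure_spinor_def)
  obtain la where la: "s la \<noteq> 0" using s(2) by blast
  then have laS: "la \<in> strict_partitions n" "finite la"
    using s(1) by (auto simp: spinors_def strict_partitions_def)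
  have xV: "dual_vector s \<nu> \<in> vectors n" if "\<nu> \<in> strict_partitions n" for \<nu>
    using dual_vector_vectors[OF s(1) that] .
  have perp: "Psi w (dual_vector s \<nu>) = 0" if "w \<in> ?L" for w \<nu>
    using that by (simp add: Psi_dual_vector)
  let ?x = "dual_vector s la"
  have aa: "Psi ?x ?x \<noteq> 0" unfolding Psi_dual_vector_pivot[OF laS(1)] using la by simp
  \<comment> \<open>The norm of the combination is a quadratic polynomial in \<open>c\<close> with
    leading coefficient \<open>Psi ?x ?x \<noteq> 0\<close>, so it has a complex root.\<close>
  define c where "c j = (SOME c. Psi (\<lambda>i. 1 * dual_vector s (toggle j la) i + (- c) * ?x i)
      (\<lambda>i. 1 * dual_vector s (toggle j la) i + (- c) * ?x i) = 0)" for j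
  have iso: "Psi (pivot_vector s la c j) (pivot_vector s la c j) = 0" if j: "j > 0" "enat j \<le> n" for j
  proof -
    let ?z = "dual_vector s (toggle j la)"
    have zV: "?z \<in> vectors n" using laS j by (intro xV toggle_strict_partitions)
    obtain c0 where c0: "Psi ?x ?x * c0\<^sup>2 + (- 2 * Psi ?x ?z) * c0 + Psi ?z ?z = 0"
      using complex_quadratic_root[OF aa] by blast
    have "Psi (\<lambda>i. 1 * ?z i + (- c0) * ?x i) (\<lambda>i. 1 * ?z i + (- c0) * ?x i)
        = 1 * (1 * Psi ?z ?z + (- c0) * Psi ?z ?x) + (- c0) * (1 * Psi ?x ?z + (- c0) * Psi ?x ?x)"
      by (subst Psi_lincomb_left[OF zV xV[OF laS(1)] vectors_lincomb[OF zV xV[OF laS(1)]]])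
        (simp only: Psi_lincomb_right[OF zV xV[OF laS(1)] zV] Psi_lincomb_right[OF zV xV[OF laS(1)] xV[OF laS(1)]])
    also have "Psi ?z ?x = Psi ?x ?z" by (rule Psi_commute[OF zV xV[OF laS(1)]])
    also have "1 * (1 * Psi ?z ?z + (- c0) * Psi ?x ?z) + (- c0) * (1 * Psi ?x ?z + (- c0) * Psi ?x ?x) = 0"
      using c0 by (simp add: algebra_simps power2_eq_square)
    finally show ?thesis unfolding pivot_vector_def c_def by (rule someI)
  qed
  have yL: "pivot_vector s la c j \<in> ?L" if j: "j > 0" "enat j \<le> n" for j
  proof (rule lagrangian_contains[OF L _ _ iso[OF j]])
    show "pivot_vector s la c j \<in> vectors n" by (rule pivot_vector_vectors[OF s(1) laS(1) j])
    fix w assume w: "w \<in> ?L"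
    have "toggle j la \<in> strict_partitions n" using laS j by (intro toggle_strict_partitions)
    then show "Psi w (pivot_vector s la c j) = 0"
      unfolding pivot_vector_def
      by (subst Psi_lincomb_right[OF xV xV[OF laS(1)]]) (use w in \<open>auto simp: perp\<close>)
  qed
  \<comment> \<open>The pivot vectors annihilate \<open>s\<close> and are orthogonal to
    \<open>x\<close>, so they annihilate \<open>x s\<close>, which is then a multiple of
    \<open>s\<close>.\<close>
  have eig: "clifford x s \<mu> = clifford x s la / s la * s \<mu>"
    if x: "x \<in> vectors n" "\<And>w. w \<in> ?L \<Longrightarrow> Psi w x = 0" for x \<mu>
  proof -
    define s' where "s' = clifford x s"
    define d where "d = (\<lambda>\<mu>. 1 * s' \<mu> + (- (s' la / s la)) * s \<mu>)"
    have s': "s' \<in> spinors n" unfolding s'_def by (rule clifford_spinors[OF x(1) s(1)])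
    have "d \<mu> = 0"
    proof (rule pivot_vector_determines[OF s(1) laS(1) la])
      show "d \<in> spinors n" using s s' by (simp add: d_def spinors_def)
      show "d la = 0" using la by (simp add: d_def)
      fix j \<mu> assume j: "j > 0" "enat j \<le> n" and \<mu>: "\<mu> \<in> strict_partitions n"
      note fin = finite_strict_partition[OF \<mu>]
      have yV: "pivot_vector s la c j \<in> vectors n" and ys: "clifford (pivot_vector s la c j) s = (\<lambda>\<mu>. 0)"
        using yL[OF j] by auto
      have "clifford (pivot_vector s la c j) s' \<mu> = 0"
        using clifford_anticommute[OF x(1) yV fin, of s] ys x(2)[OF yL[OF j]] Psi_commute[OF x(1) yV]
        by (simp add: s'_def clifford_zero_spinor)
      then show "clifford (pivot_vector s la c j) d \<mu> = 0"
        unfolding d_def clifford_spinor_lincomb[OF yV fin] by (simp add: ys)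
    qed
    then show ?thesis by (simp add: d_def s'_def)
  qed
  have \<kappa>: "clifford ?x s \<nu> = s la * s \<nu> / 2" for \<nu>
  proof -
    have half: "clifford ?x s la / s la = s la / 2"
      unfolding Psi_dual_vector[symmetric] Psi_dual_vector_pivot[OF laS(1)] using la by (simp add: power2_eq_square)
    have "clifford ?x s \<nu> = clifford ?x s la / s la * s \<nu>"
      by (rule eig[OF xV[OF laS(1)] perp])
    then show ?thesis unfolding half by simp
  qed
  have "clifford (dual_vector s \<nu>) s \<mu> = s \<nu> * s \<mu> / 2" if \<nu>: "\<nu> \<in> strict_partitions n" for \<mu> \<nu>
  proof -
    \<comment> \<open>Symmetry of \<open>Psi\<close> exchanges the roles: the coordinate at
      \<open>la\<close> of the action of \<open>dual_vector s \<nu>\<close> is the coordinate at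
      \<open>\<nu>\<close> of the action of \<open>?x\<close>, which \<open>\<kappa>\<close>
      gives.\<close>
    have half: "clifford (dual_vector s \<nu>) s la = s la * s \<nu> / 2"
      using Psi_commute[OF xV[OF \<nu>] xV[OF laS(1)]] \<kappa>[of \<nu>] by (simp add: Psi_dual_vector)
    have "clifford (dual_vector s \<nu>) s \<mu> = clifford (dual_vector s \<nu>) s la / s la * s \<mu>"
      by (rule eig[OF xV[OF \<nu>] perp])
    then show ?thesis unfolding half using la by simp
  qed
  then show ?thesis by (simp add: bilinear_relations_def)
qed

section \<open>Cartan-Pluecker relations\<close>

lemma quadratic_value_family:
  fixes \<alpha> \<beta> :: "'b \<Rightarrow> nat set"
  assumes "finite I" and c: "\<And>\<mu> \<nu>. c \<mu> \<nu> = (\<Sum>i\<in>I. if \<alpha> i = \<mu> \<and> \<beta> i = \<nu> then K i else 0)"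
  shows "quadratic_value c s = (\<Sum>i\<in>I. K i * s (\<alpha> i) * s (\<beta> i))"
    and "{(\<mu>, \<nu>). c \<mu> \<nu> \<noteq> 0} \<subseteq> (\<lambda>i. (\<alpha> i, \<beta> i)) ` {i \<in> I. K i \<noteq> 0}"
proof -
  \<comment> \<open>Different \<open>i\<close> may give the same pair, so a coefficient is a sum
    over a fibre and the two sums are compared through a double sum.\<close>
  let ?T = "(\<lambda>i. (\<alpha> i, \<beta> i)) ` I"
  have nz: "\<exists>i\<in>I. K i \<noteq> 0 \<and> \<alpha> i = \<mu> \<and> \<beta> i = \<nu>" if "c \<mu> \<nu> \<noteq> 0" for \<mu> \<nu>
  proof (rule ccontr)
    assume "\<not> ?thesis"
    then have "c \<mu> \<nu> = 0" unfolding c by (intro sum.neutral) auto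
    then show False using that by simp
  qed
  then show "{(\<mu>, \<nu>). c \<mu> \<nu> \<noteq> 0} \<subseteq> (\<lambda>i. (\<alpha> i, \<beta> i)) ` {i \<in> I. K i \<noteq> 0}" by force
  have "quadratic_value c s = (\<Sum>p\<in>?T. c (fst p) (snd p) * s (fst p) * s (snd p))"
    unfolding quadratic_value_def case_prod_unfold
    by (rule sum.mono_neutral_left) (use assms(1) nz in force)+
  also have "\<dots> = (\<Sum>p\<in>?T. \<Sum>i\<in>I. if p = (\<alpha> i, \<beta> i) then K i * s (\<alpha> i) * s (\<beta> i) else 0)"
    unfolding c sum_distrib_right by (intro sum.cong refl) auto
  also have "\<dots> = (\<Sum>i\<in>I. \<Sum>p\<in>?T. if p = (\<alpha> i, \<beta> i) then K i * s (\<alpha> i) * s (\<beta> i) else 0)"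
    by (rule sum.swap)
  also have "\<dots> = (\<Sum>i\<in>I. K i * s (\<alpha> i) * s (\<beta> i))"
    using assms(1) by (intro sum.cong refl) (simp add: sum.delta)
  finally show "quadratic_value c s = (\<Sum>i\<in>I. K i * s (\<alpha> i) * s (\<beta> i))" .
qed

text \<open>If \<open>i > 0\<close> the first coefficient forces the index into
  \<open>\<mu>\<close>, and if \<open>i < 0\<close> the second one forces its absolute value into
  \<open>\<nu>\<close>; either way the rank is respected.\<close>

lemma gen_index_strict_partitions:
  assumes "\<mu> \<in> strict_partitions n" "\<nu> \<in> strict_partitions n" "gen_coeff i \<mu> \<noteq> 0" "gen_coeff (- i) \<nu> \<noteq> 0"
  shows "gen_index i \<mu> \<in> strict_partitions n"
proof (cases "i = 0")
  case False
  then have "nat \<bar>i\<bar> \<in> \<mu> \<union> \<nu>"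
    using assms(3,4) by (cases "i > 0") (auto simp: gen_coeff_def Let_def split: if_split_asm)
  then have "enat (nat \<bar>i\<bar>) \<le> n" using assms(1,2) by (auto simp: strict_partitions_def)
  then show ?thesis using False assms(1) by (simp add: gen_index_def toggle_strict_partitions)
qed (use assms in \<open>simp add: gen_index_def\<close>)

lemma bilinear_sum:
  assumes "\<mu> \<subseteq> {..m}" "\<nu> \<subseteq> {..m}"
  shows "clifford (dual_vector s \<nu>) s \<mu> = (\<Sum>i\<in>{- int m..int m}. (-1) powi i * gen_coeff (- i) \<nu> * gen_coeff i \<mu>
      * s (gen_index (- i) \<nu>) * s (gen_index i \<mu>))"
proof -
  have "bounded_below m (dual_vector s \<nu>)"
    using gen_coeff_eq_0[OF assms(2)] by (simp add: bounded_below_def dual_vector_def clifford_gen_eq)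
  then have "clifford (dual_vector s \<nu>) s \<mu> = (\<Sum>i\<in>{- int m..int m}. dual_vector s \<nu> i * clifford_gen i s \<mu>)"
    by (rule clifford_eq_sum[OF _ assms(1)])
  then show ?thesis by (simp only: dual_vector_def clifford_gen_eq ac_simps)
qed

lemma cartan_pluecker_imp_bilinear_relations:
  assumes s: "satisfies_cartan_pluecker n s"
  shows "bilinear_relations n s"
  unfolding bilinear_relations_def
proof (intro ballI)
  fix \<mu> \<nu> assume \<mu>: "\<mu> \<in> strict_partitions n" and \<nu>: "\<nu> \<in> strict_partitions n"
  obtain m where m: "\<mu> \<subseteq> {..m}" "\<nu> \<subseteq> {..m}"
    using common_bound[of "{}" n "\<mu> \<union> \<nu>"] finite_strict_partition[OF \<mu>] finite_strict_partition[OF \<nu>] by auto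
  \<comment> \<open>\<open>None\<close> stands for the term \<open>- s \<nu> * s \<mu> / 2\<close>,
    and \<open>Some i\<close> for the term of index \<open>i\<close>.\<close>
  define I where "I = insert None (Some ` {- int m..int m})"
  define K where "K p = (case p of None \<Rightarrow> - 1 / 2 | Some i \<Rightarrow> (-1) powi i * gen_coeff (- i) \<nu> * gen_coeff i \<mu>)" for p
  define \<alpha> where "\<alpha> p = (case p of None \<Rightarrow> \<nu> | Some i \<Rightarrow> gen_index (- i) \<nu>)" for p
  define \<beta> where "\<beta> p = (case p of None \<Rightarrow> \<mu> | Some i \<Rightarrow> gen_index i \<mu>)" for p
  define c where "c \<kappa> \<rho> = (\<Sum>p\<in>I. if \<alpha> p = \<kappa> \<and> \<beta> p = \<rho> then K p else 0)" for \<kappa> \<rho>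
  have fin: "finite I" by (simp add: I_def)
  have val: "quadratic_value c s = clifford (dual_vector s \<nu>) s \<mu> - s \<nu> * s \<mu> / 2" for s
    unfolding quadratic_value_family(1)[OF fin c_def] bilinear_sum[OF m] I_def
    by (subst sum.insert) (auto simp: sum.reindex \<alpha>_def \<beta>_def K_def)
  have supp: "{(\<mu>, \<nu>). c \<mu> \<nu> \<noteq> 0} \<subseteq> (\<lambda>p. (\<alpha> p, \<beta> p)) ` {p \<in> I. K p \<noteq> 0}"
    by (rule quadratic_value_family(2)[OF fin c_def])
  moreover have "(\<alpha> p, \<beta> p) \<in> strict_partitions n \<times> strict_partitions n" if "K p \<noteq> 0" for p
  proof (cases p)
    case (Some i)
    then have "gen_coeff (- i) \<nu> \<noteq> 0" "gen_coeff i \<mu> \<noteq> 0" using that by (auto simp: K_def)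
    then show ?thesis
      using gen_index_strict_partitions[OF \<mu> \<nu>, of i] gen_index_strict_partitions[OF \<nu> \<mu>, of "- i"] Some
      by (simp add: \<alpha>_def \<beta>_def)
  qed (use \<mu> \<nu> in \<open>simp add: \<alpha>_def \<beta>_def\<close>)
  moreover have "quadratic_value c s = 0" if "pure_spinor n s" for s
    unfolding val using pure_imp_bilinear_relations[OF that] \<mu> \<nu> by (simp add: bilinear_relations_def)
  moreover have "finite {(\<mu>, \<nu>). c \<mu> \<nu> \<noteq> 0}"
    by (rule finite_subset[OF supp]) (use fin in simp)
  ultimately have "cartan_pluecker_relation n c"
    unfolding cartan_pluecker_relation_def by (intro conjI) (blast+)
  then have "quadratic_value c s = 0" using s by (simp add: satisfies_cartan_pluecker_def)
  then show "clifford (dual_vector s \<nu>) s \<mu> = s \<nu> * s \<mu> / 2" unfolding val by simp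
qed

lemma satisfies_cartan_pluecker_iff_pure:
  assumes "s \<in> spinors n" "s \<noteq> (\<lambda>\<mu>. 0)"
  shows "satisfies_cartan_pluecker n s \<longleftrightarrow> pure_spinor n s"
  using cartan_pluecker_imp_bilinear_relations bilinear_relations_imp_pure[OF assms]
  unfolding satisfies_cartan_pluecker_def cartan_pluecker_relation_def by blast

text \<open>The pivot vectors of both spinors involve only coordinates at distance at most two from
  \<open>la\<close>, so they coincide. They annihilate both spinors and hence the difference, which
  vanishes at \<open>la\<close> and therefore everywhere.\<close>

lemma bilinear_relations_agree:
  assumes s: "s \<in> spinors n" "bilinear_relations n s" and s': "s' \<in> spinors n" "bilinear_relations n s'"
    and la: "la \<in> strict_partitions n" "s la \<noteq> 0" "s' la = s la"
    and one: "\<And>j. j > 0 \<Longrightarrow> enat j \<le> n \<Longrightarrow> s' (toggle j la) = s (toggle j la)"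
    and two: "\<And>j k. j > 0 \<Longrightarrow> enat j \<le> n \<Longrightarrow> k > 0 \<Longrightarrow> enat k \<le> n \<Longrightarrow> k < j \<Longrightarrow>
        s' (toggle k (toggle j la)) = s (toggle k (toggle j la))"
  shows "s' = s"
proof -
  let ?c = "\<lambda>j. s (toggle j la) / s la"
  have swap: "toggle k (toggle j la) = toggle j (toggle k la)" for j k
    by (auto simp: toggle_def)
  have near: "s' (gen_index i (toggle j la)) = s (gen_index i (toggle j la))"
    "s' (gen_index i la) = s (gen_index i la)" if "j > 0" "enat j \<le> n" for i j
  proof -
    have out: "s' \<mu> = s \<mu>" if "\<mu> \<notin> strict_partitions n" for \<mu>
      using that s(1) s'(1) by (simp add: spinors_def)
    consider "i = 0" | "i \<noteq> 0" "enat (nat \<bar>i\<bar>) \<le> n" | "i \<noteq> 0" "\<not> enat (nat \<bar>i\<bar>) \<le> n" by blast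
    then have "s' (gen_index i (toggle j la)) = s (gen_index i (toggle j la)) \<and> s' (gen_index i la) = s (gen_index i la)"
    proof cases
      case 1
      then show ?thesis using one[OF that] la(3) by (simp add: gen_index_def)
    next
      case 2
      then have k: "nat \<bar>i\<bar> > 0" "enat (nat \<bar>i\<bar>) \<le> n" by auto
      have "s' (toggle (nat \<bar>i\<bar>) (toggle j la)) = s (toggle (nat \<bar>i\<bar>) (toggle j la))"
      proof (cases "nat \<bar>i\<bar>" j rule: linorder_cases)
        case less
        then show ?thesis by (rule two[OF that k])
      next
        case greater
        then show ?thesis unfolding swap[of "nat \<bar>i\<bar>" j] by (intro two k that)
      qed (use la(3) in simp)
      then show ?thesis using one[OF k] 2 by (simp add: gen_index_def)
    next
      \<comment> \<open>An index beyond the rank leads outside \<open>strict_partitions n\<close>,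
        where both spinors are 0.\<close>
      case 3
      have a: "enat (nat \<bar>i\<bar>) \<noteq> enat j" using 3(2) that(2) by metis
      then have "nat \<bar>i\<bar> \<notin> la" "nat \<bar>i\<bar> \<notin> toggle j la"
        using 3 la(1) by (auto simp: strict_partitions_def mem_toggle)
      then have "gen_index i la \<notin> strict_partitions n" "gen_index i (toggle j la) \<notin> strict_partitions n"
        using 3 by (auto simp: gen_index_def toggle_def strict_partitions_def)
      then show ?thesis using out by simp
    qed
    then show "s' (gen_index i (toggle j la)) = s (gen_index i (toggle j la))"
      "s' (gen_index i la) = s (gen_index i la)" by auto
  qed
  have eq: "pivot_vector s' la (\<lambda>j. s' (toggle j la) / s' la) j = pivot_vector s la ?c j" if "j > 0" "enat j \<le> n" for j
    unfolding pivot_vector_def dual_vector_def clifford_gen_eq near[OF that] one[OF that] la(3) by (rule refl)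
  define d where "d = (\<lambda>\<mu>. 1 * s' \<mu> + (- 1) * s \<mu>)"
  have "d \<mu> = 0" for \<mu>
  proof (rule pivot_vector_determines[OF s(1) la(1,2)])
    show "d \<in> spinors n" using s(1) s'(1) by (simp add: d_def spinors_def)
    show "d la = 0" using la by (simp add: d_def)
    fix j \<mu> assume j: "j > 0" "enat j \<le> n" and \<mu>: "\<mu> \<in> strict_partitions n"
    have "clifford (pivot_vector s la ?c j) s = (\<lambda>\<mu>. 0)"
      by (rule bilinear_relations_kill[OF s la(1,2) j])
    moreover have "clifford (pivot_vector s la ?c j) s' = (\<lambda>\<mu>. 0)"
      using bilinear_relations_kill[OF s' la(1) _ j] la(2,3) unfolding eq[OF j] by simp
    ultimately show "clifford (pivot_vector s la ?c j) d \<mu> = 0"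
      unfolding d_def clifford_spinor_lincomb[OF pivot_vector_vectors[OF s(1) la(1) j] finite_strict_partition[OF \<mu>]]
      by simp
  qed
  then show ?thesis by (simp add: d_def fun_eq_iff)
qed

lemma bilinear_relations_scale:
  assumes "bilinear_relations n s"
  shows "bilinear_relations n (\<lambda>\<mu>. c * s \<mu>)"
  unfolding bilinear_relations_def
proof (intro ballI)
  fix \<mu> \<nu> assume \<mu>: "\<mu> \<in> strict_partitions n" and \<nu>: "\<nu> \<in> strict_partitions n"
  obtain m where m: "\<mu> \<subseteq> {..m}" "\<nu> \<subseteq> {..m}"
    using common_bound[of "{}" n "\<mu> \<union> \<nu>"] finite_strict_partition[OF \<mu>] finite_strict_partition[OF \<nu>] by auto
  have "clifford (dual_vector (\<lambda>\<mu>. c * s \<mu>) \<nu>) (\<lambda>\<mu>. c * s \<mu>) \<mu> = c * c * clifford (dual_vector s \<nu>) s \<mu>"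
    unfolding bilinear_sum[OF m] sum_distrib_left by (simp only: ac_simps)
  then show "clifford (dual_vector (\<lambda>\<mu>. c * s \<mu>) \<nu>) (\<lambda>\<mu>. c * s \<mu>) \<mu> = c * s \<nu> * (c * s \<mu>) / 2"
    using assms \<mu> \<nu> by (simp add: bilinear_relations_def)
qed

section \<open>Pfaffian minors as Cartan coordinates\<close>

text \<open>The order in which \<open>labels\<close> lists the rows: \<open>-0\<close> precedes \<open>+0\<close>.\<close>

fun label_rank :: "label \<Rightarrow> int" where
  "label_rank (NegL j) = - int j - 1"
| "label_rank (PosL j) = int j"

lemma label_rank_inject: "label_rank a = label_rank b \<longleftrightarrow> a = b"
  by (cases a; cases b) auto

instantiation label :: linorder
begin

definition less_eq_label :: "label \<Rightarrow> label \<Rightarrow> bool" where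
  "less_eq_label a b \<longleftrightarrow> label_rank a \<le> label_rank b"

definition less_label :: "label \<Rightarrow> label \<Rightarrow> bool" where
  "less_label a b \<longleftrightarrow> label_rank a < label_rank b"

instance
proof
  fix a b c :: label
  show "a < b \<longleftrightarrow> a \<le> b \<and> \<not> b \<le> a" "a \<le> a" "a \<le> b \<or> b \<le> a"
    by (auto simp: less_eq_label_def less_label_def)
  show "a \<le> c" if "a \<le> b" "b \<le> c" using that by (simp add: less_eq_label_def)
  show "a = b" if "a \<le> b" "b \<le> a"
    using that unfolding less_eq_label_def by (intro label_rank_inject[THEN iffD1]) simp
qed

end

definition label_set :: "nat \<Rightarrow> label set" where
  "label_set N = NegL ` {..N} \<union> PosL ` {..N}"

lemma finite_label_set [simp]: "finite (label_set N)"
  by (simp add: label_set_def)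

lemma label_set_iff [simp]: "NegL j \<in> label_set N \<longleftrightarrow> j \<le> N" "PosL j \<in> label_set N \<longleftrightarrow> j \<le> N"
  by (auto simp: label_set_def)

lemma set_labels: "set (labels N) = label_set N"
  by (auto simp: labels_def label_set_def)

lemma sorted_labels: "sorted_wrt (<) (labels N)"
  unfolding labels_def sorted_wrt_append
proof (intro conjI ballI)
  show "sorted_wrt (<) (map NegL (rev [0..<Suc N]))"
    unfolding sorted_wrt_map sorted_wrt_rev
    by (rule sorted_wrt_mono_rel[OF _ sorted_wrt_upt]) (simp add: less_label_def)
  show "sorted_wrt (<) (map PosL [0..<Suc N])"
    unfolding sorted_wrt_map
    by (rule sorted_wrt_mono_rel[OF _ sorted_wrt_upt]) (simp add: less_label_def)
qed (auto simp: less_label_def)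

lemma sorted_list_label_set_filter:
  "sorted_list_of_set (label_set N - S) = filter (\<lambda>a. a \<notin> S) (labels N)"
  by (intro sorted_list_of_set_eqI sorted_wrt_filter sorted_labels) (auto simp: set_labels)

lemma pfaffian_labels: "skew A \<Longrightarrow> pfaffian (labels N) A = set_pf A (label_set N)"
  using sorted_list_label_set_filter[of N "{}"] by (simp add: pfaffian_eq_rec_pf set_pf_def)

definition aug :: "nat set \<Rightarrow> nat set" where
  "aug \<mu> = (if odd (card \<mu>) then insert 0 \<mu> else \<mu>)"

lemma set_augmented: "finite \<mu> \<Longrightarrow> set (augmented \<mu>) = aug \<mu>"
  by (simp add: augmented_def aug_def)

lemma augmented_eq_descending: "augmented \<mu> = descending (aug \<mu>)"
  by (simp add: augmented_def descending_def aug_def)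

lemma finite_aug [simp]: "finite (aug \<mu>) \<longleftrightarrow> finite \<mu>"
  by (simp add: aug_def)

lemma even_card_aug: "0 \<notin> \<mu> \<Longrightarrow> even (card (aug \<mu>))"
  by (cases "finite \<mu>") (auto simp: aug_def)

definition minor_set :: "nat \<Rightarrow> nat set \<Rightarrow> label set" where
  "minor_set N K = label_set N - NegL ` K"

lemma finite_minor_set [simp]: "finite (minor_set N K)"
  by (simp add: minor_set_def)

lemma pfaffian_minor_labels:
  assumes "skew A" "finite \<mu>"
  shows "pfaffian (minor_labels N \<mu>) A = set_pf A (minor_set N (aug \<mu>))"
  using assms by (simp add: pfaffian_eq_rec_pf set_pf_def minor_labels_def minor_set_def
      sorted_list_label_set_filter set_augmented)

lemma strict_partitions_enat_iff: "\<mu> \<in> strict_partitions (enat N) \<longleftrightarrow> \<mu> \<subseteq> {1..N}"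
  by (simp add: strict_partitions_enat)

lemma aug_subset: "\<mu> \<subseteq> {1..N} \<Longrightarrow> aug \<mu> \<subseteq> {..N}"
  by (auto simp: aug_def)

text \<open>\<open>NegL k\<close> is preceded by the remaining \<open>NegL m\<close> with
  \<open>k < m \<le> N\<close>. Up to \<open>(-1) ^ (N - k)\<close>, which cancels between two
  minors, the sign in the Pfaffian is thus the sign of the Clifford action.\<close>

lemma sign_below_minor_set:
  assumes "k \<le> N" "K \<subseteq> {..N}"
  shows "sign_below (NegL k) (minor_set N K) = (-1) ^ (N - k) * sign_above k K"
proof -
  have fin: "finite K" using assms(2) finite_subset by blast
  have "{z \<in> minor_set N K. z < NegL k} = NegL ` ({k<..N} - {m \<in> K. k < m})"
    by (auto simp: minor_set_def label_set_def less_label_def)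
  then have c: "card {z \<in> minor_set N K. z < NegL k} = card ({k<..N} - {m \<in> K. k < m})"
    by (simp add: card_image inj_on_def)
  have "{m \<in> K. k < m} \<subseteq> {k<..N}" using assms(2) by auto
  then have "card {m \<in> K. k < m} \<le> N - k" "card {z \<in> minor_set N K. z < NegL k} = N - k - card {m \<in> K. k < m}"
    using card_mono[of "{k<..N}" "{m \<in> K. k < m}"] fin unfolding c by (simp_all add: card_Diff_subset)
  then have "N - k = card {m \<in> K. k < m} + card {z \<in> minor_set N K. z < NegL k}"
    by linarith
  then have e: "(-1 :: complex) ^ (N - k) = (-1) ^ card {m \<in> K. k < m} * (-1) ^ card {z \<in> minor_set N K. z < NegL k}"
    by (simp only: power_add)
  have "(-1) ^ (N - k) * (-1) ^ card {m \<in> K. k < m}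
      = (-1 :: complex) ^ card {m \<in> K. k < m} * ((-1) ^ card {m \<in> K. k < m} * (-1) ^ card {z \<in> minor_set N K. z < NegL k})"
    unfolding e by (simp only: ac_simps)
  then show ?thesis
    unfolding sign_below_def sign_above_def by (simp only: minus_one_power_cancel)
qed

text \<open>The set of odd size among \<open>\<mu>\<close> and \<open>\<mu> \<union> {0}\<close>.\<close>

definition odd_aug :: "nat set \<Rightarrow> nat set" where
  "odd_aug \<mu> = toggle 0 (aug \<mu>)"

lemma odd_aug_eq: "0 \<notin> \<mu> \<Longrightarrow> odd_aug \<mu> = (if odd (card \<mu>) then \<mu> else insert 0 \<mu>)"
  by (auto simp: odd_aug_def aug_def toggle_def)

lemma card_toggle_parity:
  assumes "finite \<mu>"
  shows "odd (card (toggle k \<mu>)) \<longleftrightarrow> even (card \<mu>)"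
proof (cases "k \<in> \<mu>")
  case True
  then have "card \<mu> = Suc (card (\<mu> - {k}))" using assms by (rule card.remove[OF _ , rotated])
  then show ?thesis using True by (simp add: toggle_def)
qed (use assms in \<open>simp add: toggle_def\<close>)

text \<open>Toggling a positive part changes the parity, so the augmenting 0 is toggled as
  well.\<close>

lemma aug_toggle:
  assumes "finite \<mu>" "0 \<notin> \<mu>" "k > 0"
  shows "aug (toggle k \<mu>) = toggle k (odd_aug \<mu>)"
  using card_toggle_parity[OF assms(1), of k] assms
  by (auto simp: aug_def odd_aug_eq toggle_def split: if_split_asm)

lemma sign_above_odd_aug: "0 \<notin> \<mu> \<Longrightarrow> sign_above k (odd_aug \<mu>) = sign_above k \<mu>"
proof -
  assume "0 \<notin> \<mu>"
  then have "{m \<in> odd_aug \<mu>. k < m} = {m \<in> \<mu>. k < m}" by (auto simp: odd_aug_eq)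
  then show ?thesis by (simp add: sign_above_def)
qed

text \<open>Removing a label from a minor adds its index to the deleted set, and conversely. In
  terms of deleted sets the two sums of the exchange identity merge into one over the symmetric
  difference.\<close>

lemma minor_exchange:
  assumes "skew A" "M \<subseteq> {..N}" "M' \<subseteq> {..N}"
  shows "(\<Sum>k\<in>sym_diff M M'. sign_above k M * sign_above k M' * set_pf A (minor_set N (toggle k M))
            * set_pf A (minor_set N (toggle k M'))) = 0"
proof -
  let ?I = "minor_set N M" and ?J = "minor_set N M'"
  let ?t = "\<lambda>k. sign_above k M * sign_above k M' * set_pf A (minor_set N (toggle k M)) * set_pf A (minor_set N (toggle k M'))"
  have fin: "finite M" "finite M'" using assms finite_subset by blast+
  have sg: "sign_below (NegL k) ?I * sign_below (NegL k) ?J = sign_above k M * sign_above k M'" if "k \<le> N" for k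
    using that assms by (simp add: sign_below_minor_set mult.assoc mult.left_commute[of "sign_above k M"] minus_one_power_cancel)
  have ij: "?I - ?J = NegL ` (M' - M)" "?J - ?I = NegL ` (M - M')"
    using assms by (auto simp: minor_set_def label_set_def)
  have r1: "minor_set N M - {NegL k} = minor_set N (toggle k M)" if "k \<notin> M" for k M
  proof -
    have "toggle k M = insert k M" using that by (simp add: toggle_def)
    then show ?thesis unfolding minor_set_def by blast
  qed
  have r2: "insert (NegL k) (minor_set N M) = minor_set N (toggle k M)" if "k \<in> M" "k \<le> N" for k M
  proof -
    have "toggle k M = M - {k}" using that by (simp add: toggle_def)
    moreover have "NegL k \<in> label_set N" using that by simp
    moreover have "NegL ` (M - {k}) = NegL ` M - {NegL k}" by auto
    ultimately show ?thesis unfolding minor_set_def by blast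
  qed
  have "(\<Sum>x\<in>?I - ?J. sign_below x ?I * sign_below x ?J * set_pf A (?I - {x}) * set_pf A (insert x ?J)) = (\<Sum>k\<in>M' - M. ?t k)"
    unfolding ij
  proof (subst sum.reindex, simp add: inj_on_def, unfold o_def, rule sum.cong[OF refl])
    fix k assume k: "k \<in> M' - M"
    then have "k \<le> N" using assms by auto
    then show "sign_below (NegL k) ?I * sign_below (NegL k) ?J * set_pf A (?I - {NegL k}) * set_pf A (insert (NegL k) ?J) = ?t k"
      using k by (simp only: sg r1[of k M] r2[of k M'] Diff_iff simp_thms)
  qed
  moreover have "(\<Sum>x\<in>?J - ?I. sign_below x ?I * sign_below x ?J * set_pf A (insert x ?I) * set_pf A (?J - {x})) = (\<Sum>k\<in>M - M'. ?t k)"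
    unfolding ij
  proof (subst sum.reindex, simp add: inj_on_def, unfold o_def, rule sum.cong[OF refl])
    fix k assume k: "k \<in> M - M'"
    then have "k \<le> N" using assms by auto
    then show "sign_below (NegL k) ?I * sign_below (NegL k) ?J * set_pf A (insert (NegL k) ?I) * set_pf A (?J - {NegL k}) = ?t k"
      using k by (simp only: sg r1[of k M'] r2[of k M] Diff_iff simp_thms)
  qed
  ultimately have "(\<Sum>k\<in>M' - M. ?t k) + (\<Sum>k\<in>M - M'. ?t k) = 0"
    using set_pf_exchange[OF assms(1), of ?I ?J] by simp
  then show ?thesis
    unfolding sym_diff_def using fin by (subst sum.union_disjoint) (auto simp: add.commute)
qed

text \<open>The generators of index \<open>k\<close> and \<open>- k\<close> contribute only if
  \<open>k\<close> lies in exactly one of \<open>\<mu>\<close> and \<open>\<nu>\<close>, and then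
  give one term of the exchange identity for \<open>odd_aug \<mu>\<close> and
  \<open>odd_aug \<nu>\<close>. In units of \<open>s \<nu> * s \<mu>\<close>: if the parities agree,
  these terms add up to 0 and index 0 gives 1/2; if they differ, index 0 gives -1/2, and the terms
  add up to 1 because the exchange identity has the further term \<open>k = 0\<close>.\<close>

lemma minor_bilinear:
  assumes A: "skew A" and \<mu>: "\<mu> \<subseteq> {1..N}" and \<nu>: "\<nu> \<subseteq> {1..N}"
    and s: "\<And>\<kappa>. \<kappa> \<subseteq> {1..N} \<Longrightarrow> s \<kappa> = set_pf A (minor_set N (aug \<kappa>))"
  shows "clifford (dual_vector s \<nu>) s \<mu> = s \<nu> * s \<mu> / 2"
proof -
  have fin: "finite \<mu>" "finite \<nu>" "0 \<notin> \<mu>" "0 \<notin> \<nu>"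
    using \<mu> \<nu> finite_subset[of _ "{1..N}"] by auto
  let ?t = "\<lambda>k. sign_above k \<mu> * sign_above k \<nu> * s (toggle k \<mu>) * s (toggle k \<nu>)"
  let ?f = "\<lambda>i. (-1) powi i * gen_coeff (- i) \<nu> * gen_coeff i \<mu> * s (gen_index (- i) \<nu>) * s (gen_index i \<mu>)"
  have zero: "?f 0 = (-1) ^ (card \<mu> + card \<nu>) / 2 * (s \<nu> * s \<mu>)"
  proof -
    have "gen_coeff 0 \<nu> * gen_coeff 0 \<mu> = (-1) ^ (card \<mu> + card \<nu>) / (complex_of_real (sqrt 2) * complex_of_real (sqrt 2))"
      by (simp add: gen_coeff_def power_add mult.commute)
    then have "gen_coeff 0 \<nu> * gen_coeff 0 \<mu> = (-1) ^ (card \<mu> + card \<nu>) / 2" unfolding sqrt_two_square .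
    moreover have "?f 0 = gen_coeff 0 \<nu> * gen_coeff 0 \<mu> * (s \<nu> * s \<mu>)" by (simp add: gen_index_def)
    ultimately show ?thesis by (simp only:)
  qed
  have pm: "?f (int k) + ?f (- int k) = (if k \<in> sym_diff \<mu> \<nu> then ?t k else 0)" if "k > 0" for k
  proof -
    have g: "gen_coeff (int k) \<kappa> = (if k \<in> \<kappa> then sign_above k \<kappa> else 0)"
      "gen_coeff (- int k) \<kappa> = (if k \<in> \<kappa> then 0 else (-1) ^ k * sign_above k \<kappa>)"
      "gen_index (int k) \<kappa> = toggle k \<kappa>" "gen_index (- int k) \<kappa> = toggle k \<kappa>" for \<kappa>
      using that by (simp_all add: gen_coeff_def gen_index_def)
    have "(-1) ^ k * ((-1) ^ k * sign_above k \<kappa>) * sign_above k \<rho> * z * z' = sign_above k \<kappa> * sign_above k \<rho> * z * z'"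
      "(-1) ^ k * sign_above k \<kappa> * ((-1) ^ k * sign_above k \<rho>) * z * z' = sign_above k \<kappa> * sign_above k \<rho> * z * z'"
      for \<kappa> \<rho> z z'
      by (cases "even k"; simp)+
    then have "?f (int k) = (if k \<in> \<mu> \<and> k \<notin> \<nu> then ?t k else 0)" "?f (- int k) = (if k \<in> \<nu> \<and> k \<notin> \<mu> then ?t k else 0)"
      by (simp_all add: g minus_one_powi_uminus)
    then show ?thesis by (simp add: sym_diff_def)
  qed
  have "{- int N..int N} = {0} \<union> (int ` {1..N} \<union> (\<lambda>k. - int k) ` {1..N})"
  proof -
    have "i \<in> {0} \<union> (int ` {1..N} \<union> (\<lambda>k. - int k) ` {1..N})" if "i \<in> {- int N..int N}" for i
      using that by (cases i rule: int_cases3) auto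
    then have "{- int N..int N} \<subseteq> {0} \<union> (int ` {1..N} \<union> (\<lambda>k. - int k) ` {1..N})" by blast
    moreover have "{0} \<union> (int ` {1..N} \<union> (\<lambda>k. - int k) ` {1..N}) \<subseteq> {- int N..int N}" by auto
    ultimately show ?thesis by (rule equalityI)
  qed
  moreover have "sum ?f ({0} \<union> (int ` {1..N} \<union> (\<lambda>k. - int k) ` {1..N}))
      = sum ?f {0} + sum ?f (int ` {1..N} \<union> (\<lambda>k. - int k) ` {1..N})"
    by (rule sum.union_disjoint) auto
  moreover have "sum ?f (int ` {1..N} \<union> (\<lambda>k. - int k) ` {1..N}) = sum ?f (int ` {1..N}) + sum ?f ((\<lambda>k. - int k) ` {1..N})"
    by (rule sum.union_disjoint) auto
  moreover have "sum ?f (int ` {1..N}) = (\<Sum>k=1..N. ?f (int k))" "sum ?f ((\<lambda>k. - int k) ` {1..N}) = (\<Sum>k=1..N. ?f (- int k))"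
    by (rule sum.reindex[unfolded o_def]; simp add: inj_on_def)+
  moreover have "sum ?f {0} = ?f 0" by (subst sum.insert) (simp_all only: finite.emptyI empty_iff sum.empty add_0_right not_False_eq_True)
  ultimately have "(\<Sum>i\<in>{- int N..int N}. ?f i) = ?f 0 + ((\<Sum>k=1..N. ?f (int k)) + (\<Sum>k=1..N. ?f (- int k)))"
    by (simp only:)
  also have "(\<Sum>k=1..N. ?f (int k)) + (\<Sum>k=1..N. ?f (- int k)) = (\<Sum>k=1..N. if k \<in> sym_diff \<mu> \<nu> then ?t k else 0)"
    unfolding sum.distrib[symmetric] by (intro sum.cong refl pm) simp
  also have "\<dots> = (\<Sum>k\<in>sym_diff \<mu> \<nu>. ?t k)"
  proof -
    have "{1..N} \<inter> sym_diff \<mu> \<nu> = sym_diff \<mu> \<nu>" using \<mu> \<nu> by (auto simp: sym_diff_def)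
    then show ?thesis by (simp add: sum.inter_restrict[symmetric])
  qed
  also have "\<dots> = (if even (card \<mu> + card \<nu>) then 0 else s \<mu> * s \<nu>)"
  proof -
    let ?M = "odd_aug \<mu>" and ?M' = "odd_aug \<nu>"
    let ?u = "\<lambda>k. sign_above k ?M * sign_above k ?M' * set_pf A (minor_set N (toggle k ?M)) * set_pf A (minor_set N (toggle k ?M'))"
    have sub: "?M \<subseteq> {..N}" "?M' \<subseteq> {..N}" using \<mu> \<nu> fin by (auto simp: odd_aug_eq)
    have tog: "toggle k \<kappa> \<subseteq> {1..N}" if "\<kappa> \<subseteq> {1..N}" "k \<in> {1..N}" for k \<kappa>
      using that by (auto simp: toggle_def)
    have u: "?u k = ?t k" if "k \<in> sym_diff \<mu> \<nu>" for k
    proof -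
      have k: "k \<in> {1..N}" using that \<mu> \<nu> by (auto simp: sym_diff_def)
      then show ?thesis
        using fin s[OF tog[OF \<mu> k]] s[OF tog[OF \<nu> k]] by (simp add: sign_above_odd_aug aug_toggle)
    qed
    have tog0: "toggle 0 (odd_aug \<kappa>) = aug \<kappa>" for \<kappa> by (simp add: odd_aug_def)
    have u0: "?u 0 = (-1) ^ (card \<mu> + card \<nu>) * (s \<mu> * s \<nu>)"
    proof -
      have "{m \<in> \<kappa>. 0 < m} = \<kappa>" if "0 \<notin> \<kappa>" for \<kappa> :: "nat set" using that by (auto intro!: gr0I)
      then have "sign_above 0 \<mu> = (-1) ^ card \<mu>" "sign_above 0 \<nu> = (-1) ^ card \<nu>"
        using fin unfolding sign_above_def by metis+
      then show ?thesis
        using fin s[OF \<mu>] s[OF \<nu>] by (simp add: sign_above_odd_aug tog0 power_add)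
    qed
    have ex: "(\<Sum>k\<in>sym_diff ?M ?M'. ?u k) = 0" by (rule minor_exchange[OF A sub])
    have fd: "finite (sym_diff \<mu> \<nu>)" "0 \<notin> sym_diff \<mu> \<nu>" using fin by (simp_all add: sym_diff_def)
    show ?thesis
    proof (cases "even (card \<mu> + card \<nu>)")
      case True
      then have "sym_diff ?M ?M' = sym_diff \<mu> \<nu>" using fin by (auto simp: odd_aug_eq sym_diff_def)
      then show ?thesis using ex u True by (simp cong: sum.cong)
    next
      case False
      then have "sym_diff ?M ?M' = insert 0 (sym_diff \<mu> \<nu>)" using fin by (auto simp: odd_aug_eq sym_diff_def)
      then have "?u 0 + (\<Sum>k\<in>sym_diff \<mu> \<nu>. ?u k) = 0" using ex fd by simp
      moreover have "(\<Sum>k\<in>sym_diff \<mu> \<nu>. ?u k) = (\<Sum>k\<in>sym_diff \<mu> \<nu>. ?t k)" by (rule sum.cong[OF refl u])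
      ultimately show ?thesis unfolding u0 using False by simp
    qed
  qed
  finally have "(\<Sum>i\<in>{- int N..int N}. ?f i) = s \<nu> * s \<mu> / 2"
    unfolding zero by (cases "even (card \<mu> + card \<nu>)") simp_all
  moreover have "clifford (dual_vector s \<nu>) s \<mu> = (\<Sum>i\<in>{- int N..int N}. ?f i)"
    by (rule bilinear_sum) (use \<mu> \<nu> in auto)
  ultimately show ?thesis by simp
qed

section \<open>Structure of the matrix without its Q-block\<close>

lemma skew_unit_sum:
  assumes "finite P"
  shows "(\<Sum>(i, j)\<in>P. f i j * skew_unit i j a b)
    = (if (a, b) \<in> P then f a b else 0) - (if (b, a) \<in> P then f b a else 0)"
proof -
  have "(\<Sum>(i, j)\<in>P. f i j * skew_unit i j a b)
      = (\<Sum>p\<in>P. if p = (a, b) then f a b else 0) - (\<Sum>p\<in>P. if p = (b, a) then f b a else 0)"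
    unfolding sum_subtractf[symmetric]
  proof (rule sum.cong[OF refl])
    fix p :: "label \<times> label"
    have 1: "f i j * matrix_unit i j a b = (if (i, j) = (a, b) then f a b else 0)" for i j
      unfolding matrix_unit_def by (cases "i = a"; cases "j = b"; simp)
    have 2: "f i j * matrix_unit j i a b = (if (i, j) = (b, a) then f b a else 0)" for i j
      unfolding matrix_unit_def by (cases "i = b"; cases "j = a"; simp)
    have "f i j * skew_unit i j a b = (if (i, j) = (a, b) then f a b else 0) - (if (i, j) = (b, a) then f b a else 0)" for i j
      unfolding skew_unit_def right_diff_distrib 1 2 by (rule refl)
    then show "(case p of (i, j) \<Rightarrow> f i j * skew_unit i j a b)
        = (if p = (a, b) then f a b else 0) - (if p = (b, a) then f b a else 0)"
      by (cases p) simp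
  qed
  then show ?thesis using assms by (simp add: sum.delta)
qed

lemma skew_unit_sum_image:
  assumes "finite Q" "inj_on (\<lambda>i. (g i, h i)) Q"
  shows "(\<Sum>i\<in>Q. skew_unit (g i) (h i) a b)
    = (if (a, b) \<in> (\<lambda>i. (g i, h i)) ` Q then 1 else 0) - (if (b, a) \<in> (\<lambda>i. (g i, h i)) ` Q then 1 else 0)"
proof -
  have "(\<Sum>i\<in>Q. skew_unit (g i) (h i) a b) = (\<Sum>(i, j)\<in>(\<lambda>i. (g i, h i)) ` Q. 1 * skew_unit i j a b)"
    by (subst sum.reindex[OF assms(2)]) simp
  then show ?thesis by (simp only: skew_unit_sum[OF finite_imageI[OF assms(1)]])
qed

lemma I_set_iff:
  assumes "finite la"
  shows "NegL j \<in> I_set N la \<longleftrightarrow> j \<le> N \<and> j \<in> aug la" "PosL j \<in> I_set N la \<longleftrightarrow> j \<le> N \<and> j \<notin> aug la"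
  using assms by (auto simp: I_set_def set_augmented)

lemma distinct_augmented: "distinct (augmented la)"
  by (simp add: augmented_def)

text \<open>The positions of the constant entries 1 above. The unit at \<open>-0\<close> and
  \<open>+0\<close> is the case \<open>i = 0\<close> of the first family.\<close>

definition unit_pairs :: "nat \<Rightarrow> nat set \<Rightarrow> (label \<times> label) set" where
  "unit_pairs N la = (\<lambda>i. (NegL i, PosL i)) ` {i. i \<le> N \<and> i \<notin> aug la}
     \<union> (\<lambda>k. (PosL (augmented la ! (2 * k + 1)), PosL (augmented la ! (2 * k)))) ` {..<length (augmented la) div 2}"

definition r_pairs :: "nat \<Rightarrow> nat set \<Rightarrow> (label \<times> label) set" where
  "r_pairs N la = {(i, j). i \<in> I_set N la \<and> j \<in> I_set N la \<and> label_val i > \<bar>label_val j\<bar>}"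

lemma core_matrix_eq:
  assumes "finite la"
  shows "core_matrix N la r a b =
      (if (a, b) \<in> unit_pairs N la then 1 else 0) - (if (b, a) \<in> unit_pairs N la then 1 else 0)
    + ((if (a, b) \<in> r_pairs N la then (-1) powi (min 0 (label_val b)) * r a b else 0)
      - (if (b, a) \<in> r_pairs N la then (-1) powi (min 0 (label_val a)) * r b a else 0))"
proof -
  let ?al = "augmented la"
  let ?P1 = "(\<lambda>i. (NegL i, PosL i)) ` {i. 0 < i \<and> PosL i \<in> I_set N la}"
  let ?P3 = "(\<lambda>k. (PosL (?al ! (2 * k + 1)), PosL (?al ! (2 * k)))) ` {..<length ?al div 2}"
  let ?P4 = "if 0 \<in> aug la then {} else {(NegL 0, PosL 0)}"
  have fI: "finite (I_set N la)" by (simp add: I_set_def)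
  have "finite {i. 0 < i \<and> PosL i \<in> I_set N la}"
    by (rule finite_subset[of _ "{..N}"]) (use assms in \<open>auto simp: I_set_iff\<close>)
  then have s1: "(\<Sum>i | 0 < i \<and> PosL i \<in> I_set N la. skew_unit (NegL i) (PosL i) a b)
      = (if (a, b) \<in> ?P1 then 1 else 0) - (if (b, a) \<in> ?P1 then 1 else 0)"
    by (rule skew_unit_sum_image) (auto simp: inj_on_def)
  have "finite (r_pairs N la)"
    by (rule finite_subset[of _ "I_set N la \<times> I_set N la"]) (use fI in \<open>auto simp: r_pairs_def\<close>)
  then have s2: "(\<Sum>(i, j) | i \<in> I_set N la \<and> j \<in> I_set N la \<and> label_val i > \<bar>label_val j\<bar>.
        (-1) powi (min 0 (label_val j)) * r i j * skew_unit i j a b)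
      = (if (a, b) \<in> r_pairs N la then (-1) powi (min 0 (label_val b)) * r a b else 0)
      - (if (b, a) \<in> r_pairs N la then (-1) powi (min 0 (label_val a)) * r b a else 0)"
    unfolding r_pairs_def by (rule skew_unit_sum)
  have s3: "(\<Sum>k<length ?al div 2. skew_unit (PosL (?al ! (2 * k + 1))) (PosL (?al ! (2 * k))) a b)
      = (if (a, b) \<in> ?P3 then 1 else 0) - (if (b, a) \<in> ?P3 then 1 else 0)"
    by (rule skew_unit_sum_image) (auto simp: inj_on_def nth_eq_iff_index_eq[OF distinct_augmented])
  have s4: "(if 0 \<in> set ?al then 0 else 1) * skew_unit (NegL 0) (PosL 0) a b
      = (if (a, b) \<in> ?P4 then 1 else 0) - (if (b, a) \<in> ?P4 then 1 else 0)"
    using assms by (auto simp: set_augmented skew_unit_def matrix_unit_def)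
  have P: "unit_pairs N la = ?P1 \<union> ?P3 \<union> ?P4"
  proof -
    have "(\<lambda>i. (NegL i, PosL i)) ` {i. i \<le> N \<and> i \<notin> aug la} = ?P1 \<union> ?P4"
      using assms by (auto simp: I_set_iff intro: gr0I)
    then show ?thesis unfolding unit_pairs_def by auto
  qed
  have ind: "(if x \<in> unit_pairs N la then 1 else 0 :: complex)
      = (if x \<in> ?P1 then 1 else 0) + (if x \<in> ?P3 then 1 else 0) + (if x \<in> ?P4 then 1 else 0)" for x
    unfolding P by (auto simp: assms I_set_iff)
  show ?thesis
    unfolding core_matrix_def s1 s2 s3 s4 ind by simp
qed

lemma unit_pairs_cases:
  assumes "(x, y) \<in> unit_pairs N la"
  obtains i where "x = NegL i" "y = PosL i" "i \<le> N" "i \<notin> aug la"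
  | k where "x = PosL (augmented la ! (2 * k + 1))" "y = PosL (augmented la ! (2 * k))" "k < length (augmented la) div 2"
  using assms unfolding unit_pairs_def by blast

lemma augmented_nth_eq:
  "k < length (augmented la) \<Longrightarrow> l < length (augmented la) \<Longrightarrow> augmented la ! k = augmented la ! l \<longleftrightarrow> k = l"
  by (rule nth_eq_iff_index_eq[OF distinct_augmented])

lemma augmented_nth_mem: "finite la \<Longrightarrow> k < length (augmented la) \<Longrightarrow> augmented la ! k \<in> aug la"
  using nth_mem[of k "augmented la"] set_augmented[of la] by simp

lemma unit_pairs_functional:
  assumes "finite la" "(x, y) \<in> unit_pairs N la" "(x, z) \<in> unit_pairs N la"
  shows "z = y"
  using assms(2)
proof (cases rule: unit_pairs_cases)
  case (1 i)
  then show ?thesis using assms(3) by (elim unit_pairs_cases) simp_all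
next
  case (2 k)
  show ?thesis
    using assms(3)
  proof (cases rule: unit_pairs_cases)
    case l: (2 l)
    then have "2 * k + 1 = 2 * l + 1"
      using 2 augmented_nth_eq[of "2 * k + 1" la "2 * l + 1"] by auto
    then show ?thesis using 2 l by simp
  qed (use 2 in simp)
qed

lemma unit_pairs_asym:
  assumes "finite la" "(x, y) \<in> unit_pairs N la"
  shows "(z, x) \<notin> unit_pairs N la"
proof
  assume z: "(z, x) \<in> unit_pairs N la"
  show False
    using assms(2)
  proof (cases rule: unit_pairs_cases)
    case (1 i)
    then show False using z by (elim unit_pairs_cases) simp_all
  next
    case (2 k)
    show False
      using z
    proof (cases rule: unit_pairs_cases)
      case (1 i)
      then have "augmented la ! (2 * k + 1) = i" using 2(1) by simp
      moreover have "2 * k + 1 < length (augmented la)" using 2(3) by linarith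
      ultimately show False using augmented_nth_mem[OF assms(1), of "2 * k + 1"] 1(4) by simp
    next
      case l: (2 l)
      have "augmented la ! (2 * k + 1) = augmented la ! (2 * l)" using 2(1) l(2) by simp
      moreover have "2 * k + 1 < length (augmented la)" "2 * l < length (augmented la)" using 2(3) l(3) by linarith+
      ultimately have "2 * k + 1 = 2 * l" using augmented_nth_eq by blast
      then show False by presburger
    qed
  qed
qed

lemma unit_pairs_notin_I_set:
  assumes "finite la" "(x, y) \<in> unit_pairs N la"
  shows "x \<notin> I_set N la"
  using assms(2)
proof (cases rule: unit_pairs_cases)
  case (2 k)
  then show ?thesis using augmented_nth_mem[OF assms(1), of "2 * k + 1"] by (simp add: I_set_iff[OF assms(1)])
qed (simp add: I_set_iff[OF assms(1)])

text \<open>The first label of a unit pair lies outside \<open>I_set\<close> and is never a second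
  label, so its row has no further entry. Second labels may carry parameters, which is why minors
  are reduced along the first labels.\<close>

lemma core_matrix_unit_row:
  assumes "finite la" "(x, y) \<in> unit_pairs N la"
  shows "core_matrix N la r x b = (if b = y then 1 else 0)"
proof -
  have "(x, b) \<in> unit_pairs N la \<longleftrightarrow> b = y"
    using assms unit_pairs_functional by blast
  moreover have "(b, x) \<notin> unit_pairs N la" by (rule unit_pairs_asym[OF assms])
  moreover have "(x, b) \<notin> r_pairs N la" "(b, x) \<notin> r_pairs N la"
    using unit_pairs_notin_I_set[OF assms] by (auto simp: r_pairs_def)
  ultimately show ?thesis unfolding core_matrix_eq[OF assms(1)] by simp
qed

definition I_label :: "nat set \<Rightarrow> nat \<Rightarrow> label" where
  "I_label la j = (if j \<in> aug la then NegL j else PosL j)"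

text \<open>A parameter needs a positive label of larger absolute value; for a part \<open>i\<close>
  of the augmented partition the label in \<open>I_set\<close> is negative.\<close>

lemma core_matrix_I_label:
  assumes "finite la" "i \<le> N" "j < i"
  shows "core_matrix N la r (I_label la i) (I_label la j)
    = (if i \<in> aug la then 0 else (-1) powi (min 0 (label_val (I_label la j))) * r (I_label la i) (I_label la j))"
proof -
  let ?a = "I_label la i" and ?b = "I_label la j"
  have I: "?a \<in> I_set N la" "?b \<in> I_set N la" using assms by (auto simp: I_label_def I_set_iff)
  have "(?a, ?b) \<notin> unit_pairs N la" "(?b, ?a) \<notin> unit_pairs N la"
    using I unit_pairs_notin_I_set[OF assms(1)] by blast+
  moreover have "(?b, ?a) \<notin> r_pairs N la" using assms by (auto simp: r_pairs_def I_label_def)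
  moreover have "(?a, ?b) \<in> r_pairs N la \<longleftrightarrow> i \<notin> aug la"
    using I assms by (auto simp: r_pairs_def I_label_def)
  ultimately show ?thesis unfolding core_matrix_eq[OF assms(1)] by simp
qed

section \<open>Compatibility of the truncations\<close>

lemma core_matrix_Suc:
  assumes "la \<subseteq> {1..N}" "a \<in> label_set N" "b \<in> label_set N"
  shows "core_matrix (Suc N) la r a b = core_matrix N la r a b"
proof -
  have fin: "finite la" using assms(1) finite_subset by blast
  have "(x, y) \<in> unit_pairs (Suc N) la \<longleftrightarrow> (x, y) \<in> unit_pairs N la"
    "(x, y) \<in> r_pairs (Suc N) la \<longleftrightarrow> (x, y) \<in> r_pairs N la"
    if "x \<in> label_set N" "y \<in> label_set N" for x y
    using that by (cases x; cases y; auto simp: unit_pairs_def r_pairs_def I_set_iff[OF fin])+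
  then show ?thesis unfolding core_matrix_eq[OF fin] using assms by simp
qed

lemma skew_core_matrix: "skew (core_matrix N la r)"
  unfolding skew_def using core_matrix_skew by blast

lemma skew_cartan_matrix: "skew (cartan_matrix N la r)"
  unfolding skew_def using cartan_matrix_skew by blast

lemma set_pf_cartan_matrix:
  "finite K \<Longrightarrow> set_pf (cartan_matrix N la r) K = (\<Prod>a\<in>K. (-1) powi label_val a) * set_pf (core_matrix N la r) K"
  using set_pf_scale[of K "\<lambda>a. (-1) powi label_val a" "core_matrix N la r"]
  by (simp add: cartan_matrix_def[abs_def])

lemma even_card_minor_set:
  assumes "\<mu> \<subseteq> {1..N}"
  shows "even (card (minor_set N (aug \<mu>)))"
proof -
  have "NegL ` aug \<mu> \<subseteq> label_set N" using aug_subset[OF assms] by auto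
  moreover have "finite (aug \<mu>)" using assms finite_subset by auto
  moreover have "card (label_set N) = 2 * (N + 1)"
    unfolding label_set_def by (subst card_Un_disjoint) (auto simp: card_image inj_on_def)
  moreover have "card (NegL ` aug \<mu>) = card (aug \<mu>)" by (rule card_image) (simp add: inj_on_def)
  moreover have "even (card (aug \<mu>))" using assms by (intro even_card_aug) auto
  ultimately show ?thesis unfolding minor_set_def by (simp add: card_Diff_subset card_mono)
qed

text \<open>The two new labels form a unit pair and are the first and the last label. Removing them
  costs no sign: nothing precedes the first, an even number of labels lies between them, and their
  two rescaling signs cancel.\<close>

lemma minor_Suc:
  assumes la: "la \<subseteq> {1..N}" and \<mu>: "\<mu> \<subseteq> {1..N}"
  shows "set_pf (cartan_matrix (Suc N) la r) (minor_set (Suc N) (aug \<mu>)) = set_pf (cartan_matrix N la r) (minor_set N (aug \<mu>))"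
proof -
  let ?A = "cartan_matrix (Suc N) la r" and ?K = "minor_set (Suc N) (aug \<mu>)" and ?x = "NegL (Suc N)" and ?y = "PosL (Suc N)"
  have fin: "finite la" using la finite_subset by blast
  have aug: "aug la \<subseteq> {..N}" "aug \<mu> \<subseteq> {..N}" using la \<mu> aug_subset by blast+
  have x: "?x \<in> ?K" "?y \<in> ?K" using aug by (auto simp: minor_set_def)
  have K: "?K - {?x, ?y} = minor_set N (aug \<mu>)"
  proof -
    have "label_set (Suc N) = insert ?x (insert ?y (label_set N))" by (auto simp: label_set_def atMost_Suc)
    moreover have "?x \<notin> label_set N" "?y \<notin> label_set N" by simp_all
    moreover have "?x \<notin> NegL ` aug \<mu>" using aug by auto
    ultimately show ?thesis unfolding minor_set_def by blast
  qed
  have row: "core_matrix (Suc N) la r ?x b = (if b = ?y then 1 else 0)" for b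
    by (rule core_matrix_unit_row[OF fin]) (use aug in \<open>auto simp: unit_pairs_def\<close>)
  have "set_pf ?A ?K = sign_below ?x ?K * sign_below ?y (?K - {?x}) * ?A ?x ?y * set_pf ?A (?K - {?x, ?y})"
    by (rule set_pf_peel[OF skew_cartan_matrix finite_minor_set x]) (simp_all add: cartan_matrix_def row)
  also have "sign_below ?x ?K = 1"
  proof -
    have "{z \<in> ?K. z < ?x} = {}" by (auto simp: minor_set_def label_set_def less_label_def)
    then show ?thesis by (simp only: sign_below_def card.empty power_0)
  qed
  also have "sign_below ?y (?K - {?x}) = 1"
  proof -
    have "z \<in> minor_set N (aug \<mu>) \<Longrightarrow> z < ?y" for z by (auto simp: minor_set_def label_set_def less_label_def)
    then have "{z \<in> ?K - {?x}. z < ?y} = minor_set N (aug \<mu>)" unfolding K[symmetric] by auto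
    then show ?thesis using even_card_minor_set[OF \<mu>] by (simp add: sign_below_def)
  qed
  also have "?A ?x ?y = 1"
    unfolding cartan_matrix_def row label_val.simps minus_one_powi_uminus mult.assoc minus_one_powi_square by simp
  also have "set_pf ?A (?K - {?x, ?y}) = set_pf (cartan_matrix N la r) (minor_set N (aug \<mu>))"
    unfolding K by (rule set_pf_cong) (auto simp: minor_set_def cartan_matrix_def core_matrix_Suc[OF la])
  finally show ?thesis by simp
qed

lemma minor_stable:
  assumes "la \<subseteq> {1..M}" "\<mu> \<subseteq> {1..M}" "M \<le> N"
  shows "set_pf (cartan_matrix N la r) (minor_set N (aug \<mu>)) = set_pf (cartan_matrix M la r) (minor_set M (aug \<mu>))"
  using assms(3)
proof (induction N rule: dec_induct)
  case (step N)
  then have "la \<subseteq> {1..N}" "\<mu> \<subseteq> {1..N}" using assms by fastforce+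
  then show ?case using step.IH by (simp only: minor_Suc)
qed simp

text \<open>A truncation in which all parts occur; for \<open>n = \<infinity>\<close> the
  coordinates are read off in the least such one, and \<open>minor_stable\<close> makes any larger
  one equivalent.\<close>

definition level :: "enat \<Rightarrow> nat set \<Rightarrow> nat" where
  "level n \<kappa> = (case n of enat N \<Rightarrow> N | \<infinity> \<Rightarrow> Max (insert 0 \<kappa>))"

definition cartan_coordinates :: "enat \<Rightarrow> nat set \<Rightarrow> (label \<Rightarrow> label \<Rightarrow> complex) \<Rightarrow> spinor" where
  "cartan_coordinates n la r \<mu> = (if \<mu> \<in> strict_partitions n then
     let N = level n (la \<union> \<mu>) in set_pf (cartan_matrix N la r) (minor_set N (aug \<mu>)) else 0)"

lemma strict_partitions_level:
  assumes "\<mu> \<in> strict_partitions n" "finite \<kappa>"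
  shows "\<mu> \<subseteq> {1..level n (\<kappa> \<union> \<mu>)}" "\<mu> \<subseteq> {1..level n (\<mu> \<union> \<kappa>)}"
proof -
  have fin: "finite \<mu>" "0 \<notin> \<mu>" using assms by (auto simp: strict_partitions_def)
  have "k \<le> level n (\<kappa> \<union> \<mu>)" if k: "k \<in> \<mu>" for k
  proof (cases n)
    case (enat N)
    then show ?thesis using assms(1) k by (auto simp: level_def strict_partitions_def)
  next
    case infinity
    then show ?thesis using k fin assms(2) by (simp add: level_def)
  qed
  moreover have "1 \<le> k" if "k \<in> \<mu>" for k using that fin(2) by (cases k) auto
  ultimately show "\<mu> \<subseteq> {1..level n (\<kappa> \<union> \<mu>)}" by auto
  then show "\<mu> \<subseteq> {1..level n (\<mu> \<union> \<kappa>)}" by (simp only: Un_commute)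
qed

lemma level_truncations: "level n \<kappa> \<in> truncations n"
  by (cases n) (auto simp: level_def truncations_def)

lemma strict_partitions_truncation:
  "N \<in> truncations n \<Longrightarrow> \<mu> \<subseteq> {1..N} \<Longrightarrow> \<mu> \<in> strict_partitions n"
  by (cases n) (auto simp: truncations_def strict_partitions_def finite_subset)

lemma cartan_coordinates_minor:
  assumes "N \<in> truncations n" "la \<subseteq> {1..N}" "\<mu> \<subseteq> {1..N}"
  shows "cartan_coordinates n la r \<mu> = set_pf (cartan_matrix N la r) (minor_set N (aug \<mu>))"
proof -
  have S: "la \<in> strict_partitions n" "\<mu> \<in> strict_partitions n"
    using assms strict_partitions_truncation by blast+
  have fin: "finite la" "finite \<mu>" using assms finite_subset by blast+
  let ?M = "level n (la \<union> \<mu>)"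
  have "?M \<le> N"
  proof (cases n)
    case (enat M)
    then show ?thesis using assms(1) by (simp add: level_def truncations_def)
  next
    case infinity
    then show ?thesis using assms fin by (auto simp: level_def)
  qed
  note minor_stable[OF strict_partitions_level(2)[OF S(1) fin(2)] strict_partitions_level(1)[OF S(2) fin(1)] this]
  then show ?thesis
    using S(2) by (simp only: cartan_coordinates_def Let_def if_True)
qed

lemma cartan_coordinates_spinors: "cartan_coordinates n la r \<in> spinors n"
  by (simp add: spinors_def cartan_coordinates_def)

lemma common_truncation:
  assumes "finite F" "F \<subseteq> strict_partitions n"
  shows "\<exists>N\<in>truncations n. \<forall>\<mu>\<in>F. \<mu> \<subseteq> {1..N}"
proof (intro bexI ballI)
  fix \<mu> assume \<mu>: "\<mu> \<in> F"
  have fin: "finite (\<Union>F)" using assms by (auto simp: strict_partitions_def)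
  have "\<Union>F \<union> \<mu> = \<Union>F" using \<mu> by auto
  then show "\<mu> \<subseteq> {1..level n (\<Union>F)}" using strict_partitions_level(1)[of \<mu> n "\<Union>F"] assms(2) \<mu> fin by auto
qed (rule level_truncations)

lemma cartan_coordinates_bilinear:
  assumes "la \<in> strict_partitions n"
  shows "bilinear_relations n (cartan_coordinates n la r)"
  unfolding bilinear_relations_def
proof (intro ballI)
  fix \<mu> \<nu> assume "\<mu> \<in> strict_partitions n" "\<nu> \<in> strict_partitions n"
  then obtain N where N: "N \<in> truncations n" "la \<subseteq> {1..N}" "\<mu> \<subseteq> {1..N}" "\<nu> \<subseteq> {1..N}"
    using common_truncation[of "{la, \<mu>, \<nu>}" n] assms by auto
  show "clifford (dual_vector (cartan_coordinates n la r) \<nu>) (cartan_coordinates n la r) \<mu>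
      = cartan_coordinates n la r \<nu> * cartan_coordinates n la r \<mu> / 2"
    by (rule minor_bilinear[OF skew_cartan_matrix N(3,4) cartan_coordinates_minor[OF N(1,2)]])
qed

section \<open>Coordinates near the pivot\<close>

lemma aug_eq_augmented_nth:
  assumes "finite la" "0 \<notin> la"
  shows "aug la = (\<lambda>k. augmented la ! (2 * k + 1)) ` {..<length (augmented la) div 2}
    \<union> (\<lambda>k. augmented la ! (2 * k)) ` {..<length (augmented la) div 2}" (is "_ = ?A \<union> ?B")
proof
  have ev: "even (length (augmented la))"
    using even_card_aug[OF assms(2)] distinct_card[OF distinct_augmented[of la]] set_augmented[OF assms(1)] by simp
  show "aug la \<subseteq> ?A \<union> ?B"
  proof
    fix x assume "x \<in> aug la"
    then obtain i where i: "i < length (augmented la)" "x = augmented la ! i"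
      using set_augmented[OF assms(1)] by (metis in_set_conv_nth)
    show "x \<in> ?A \<union> ?B"
    proof (cases "even i")
      case True
      then have "x \<in> ?B" using i ev by (intro image_eqI[of _ _ "i div 2"]) (auto elim!: evenE)
      then show ?thesis by blast
    next
      case False
      then have "x \<in> ?A" using i ev by (intro image_eqI[of _ _ "i div 2"]) (auto elim!: evenE oddE)
      then show ?thesis by blast
    qed
  qed
  show "?A \<union> ?B \<subseteq> aug la" using augmented_nth_mem[OF assms(1)] by auto
qed

text \<open>Away from \<open>aug la\<close> and \<open>T\<close> both labels of an index survive and
  are peeled off as a unit pair; the positive labels of \<open>aug la\<close> are peeled off among
  themselves. What remains of the minor is one label of \<open>I_set\<close> for each element of
  \<open>T\<close>.\<close>

lemma core_minor:
  assumes "la \<subseteq> {1..N}" "T \<subseteq> {..N}"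
  shows "\<exists>\<epsilon>. (\<epsilon> = 1 \<or> \<epsilon> = -1) \<and> (\<forall>r. set_pf (core_matrix N la r) (minor_set N (sym_diff (aug la) T))
      = \<epsilon> * set_pf (core_matrix N la r) (I_label la ` T))"
proof -
  have fin: "finite la" "0 \<notin> la" using assms(1) finite_subset by auto
  have aug: "aug la \<subseteq> {..N}" by (rule aug_subset[OF assms(1)])
  let ?al = "augmented la" and ?K = "minor_set N (sym_diff (aug la) T)"
  define D where "D = {i. i \<le> N \<and> i \<notin> aug la \<and> i \<notin> T}"
  define U where "U = (\<lambda>i. (NegL i, PosL i)) ` D
     \<union> (\<lambda>k. (PosL (?al ! (2 * k + 1)), PosL (?al ! (2 * k)))) ` {..<length ?al div 2}"
  have UU: "U \<subseteq> unit_pairs N la" by (auto simp: U_def D_def unit_pairs_def)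
  have "finite U" by (simp add: U_def D_def)
  then obtain ps where ps: "set ps = U" "distinct ps" using finite_distinct_list by blast
  have fst: "fst ` U = NegL ` D \<union> PosL ` (\<lambda>k. ?al ! (2 * k + 1)) ` {..<length ?al div 2}"
    and snd: "snd ` U = PosL ` D \<union> PosL ` (\<lambda>k. ?al ! (2 * k)) ` {..<length ?al div 2}"
    by (auto simp: U_def image_Un image_image)
  have un: "fst ` U \<union> snd ` U = NegL ` D \<union> PosL ` (D \<union> aug la)"
    unfolding fst snd aug_eq_augmented_nth[OF fin] by auto
  have "inj_on fst U"
    using UU unit_pairs_functional[OF fin(1)] by (fastforce simp: inj_on_def)
  moreover have "inj_on snd U"
  proof (rule inj_onI)
    fix p q assume pq: "p \<in> U" "q \<in> U" "snd p = snd q"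
    obtain x y x' where p: "p = (x, y)" "q = (x', y)" using pq(3) by (cases p; cases q) auto
    then have xy: "(x, y) \<in> unit_pairs N la" "(x', y) \<in> unit_pairs N la" using pq UU by auto
    show "p = q"
      using xy(1)
    proof (cases rule: unit_pairs_cases)
      case (1 i)
      show ?thesis
        using xy(2)
      proof (cases rule: unit_pairs_cases)
        case (2 k)
        have "augmented la ! (2 * k) = i" using 1(2) 2(2) by simp
        moreover have "2 * k < length (augmented la)" using 2(3) by linarith
        ultimately show ?thesis using augmented_nth_mem[OF fin(1), of "2 * k"] 1(4) by simp
      qed (use p 1 in simp)
    next
      case (2 k)
      show ?thesis
        using xy(2)
      proof (cases rule: unit_pairs_cases)
        case (1 i)
        then have "augmented la ! (2 * k) = i" using 2(2) by simp
        moreover have "2 * k < length (augmented la)" using 2(3) by linarith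
        ultimately show ?thesis using augmented_nth_mem[OF fin(1), of "2 * k"] 1(4) by simp
      next
        case l: (2 l)
        have "augmented la ! (2 * k) = augmented la ! (2 * l)" using 2(2) l(2) by simp
        moreover have "2 * k < length (augmented la)" "2 * l < length (augmented la)" using 2(3) l(3) by linarith+
        ultimately have "2 * k = 2 * l" using augmented_nth_eq by blast
        then show ?thesis using p 2(1,2) l(1,2) by simp
      qed
    qed
  qed
  moreover have "fst ` U \<inter> snd ` U = {}"
  proof (rule equals0I)
    fix a assume "a \<in> fst ` U \<inter> snd ` U"
    then obtain y z where "(a, y) \<in> U" "(z, a) \<in> U" by force
    then show False using UU unit_pairs_asym[OF fin(1)] by blast
  qed
  ultimately have dist: "distinct (map fst ps @ map snd ps)"
    using ps by (simp add: distinct_map)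
  have sub: "fst ` set ps \<union> snd ` set ps \<subseteq> ?K"
    unfolding ps un using aug by (auto simp: minor_set_def D_def sym_diff_def)
  have rest: "?K - (fst ` set ps \<union> snd ` set ps) = I_label la ` T"
    unfolding ps un
  proof (intro set_eqI)
    fix a
    show "a \<in> ?K - (NegL ` D \<union> PosL ` (D \<union> aug la)) \<longleftrightarrow> a \<in> I_label la ` T"
      using aug assms(2) by (cases a) (auto simp: minor_set_def label_set_def D_def sym_diff_def I_label_def image_iff)
  qed
  obtain \<epsilon> where \<epsilon>: "\<epsilon> = 1 \<or> \<epsilon> = -1"
    "\<forall>A. skew A \<longrightarrow> (\<forall>(x, y)\<in>set ps. A x y = 1 \<and> (\<forall>z\<in>?K. z \<noteq> y \<longrightarrow> A x z = 0)) \<longrightarrow>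
            set_pf A ?K = \<epsilon> * set_pf A (?K - (fst ` set ps \<union> snd ` set ps))"
    using set_pf_peel_pairs[OF finite_minor_set dist sub] by blast
  have rows: "\<forall>(x, y)\<in>set ps. core_matrix N la r x y = 1 \<and> (\<forall>z\<in>?K. z \<noteq> y \<longrightarrow> core_matrix N la r x z = 0)" for r
    using UU core_matrix_unit_row[OF fin(1)] unfolding ps(1) by auto
  have "set_pf (core_matrix N la r) ?K = \<epsilon> * set_pf (core_matrix N la r) (I_label la ` T)" for r
    by (rule \<epsilon>(2)[THEN spec, THEN mp, THEN mp, OF skew_core_matrix rows, unfolded rest])
  then show ?thesis using \<epsilon>(1) by (intro exI[of _ \<epsilon>]) simp
qed

lemma prod_signs: "(\<Prod>a\<in>K. (-1 :: complex) powi f a) = 1 \<or> (\<Prod>a\<in>K. (-1 :: complex) powi f a) = -1"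
proof (induction K rule: infinite_finite_induct)
  case (insert a K)
  have "(-1 :: complex) powi f a = 1 \<or> (-1 :: complex) powi f a = -1"
    by (cases "even (f a)") (simp_all add: power_int_minus_left)
  then show ?case using insert by auto
qed simp_all

lemma cartan_coordinates_near:
  assumes "la \<in> strict_partitions n" "\<mu> \<in> strict_partitions n" "aug \<mu> = sym_diff (aug la) T"
  shows "\<exists>\<epsilon>. (\<epsilon> = 1 \<or> \<epsilon> = -1) \<and> (\<forall>r. cartan_coordinates n la r \<mu>
      = \<epsilon> * set_pf (core_matrix (level n (la \<union> \<mu>)) la r) (I_label la ` T))"
proof -
  let ?N = "level n (la \<union> \<mu>)"
  have fin: "finite la" "finite \<mu>" using assms by (auto simp: strict_partitions_def)
  have sub: "la \<subseteq> {1..?N}" "\<mu> \<subseteq> {1..?N}"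
    using strict_partitions_level(2)[OF assms(1) fin(2)] strict_partitions_level(1)[OF assms(2) fin(1)] by auto
  have "T \<subseteq> aug la \<union> aug \<mu>" unfolding assms(3) sym_diff_def by blast
  then have T: "T \<subseteq> {..?N}" using aug_subset[OF sub(1)] aug_subset[OF sub(2)] by blast
  obtain \<epsilon> where \<epsilon>: "\<epsilon> = 1 \<or> \<epsilon> = -1" "\<forall>r. set_pf (core_matrix ?N la r) (minor_set ?N (sym_diff (aug la) T))
      = \<epsilon> * set_pf (core_matrix ?N la r) (I_label la ` T)"
    using core_minor[OF sub(1) T] by blast
  let ?d = "\<Prod>a\<in>minor_set ?N (aug \<mu>). (-1 :: complex) powi label_val a"
  have "cartan_coordinates n la r \<mu> = ?d * \<epsilon> * set_pf (core_matrix ?N la r) (I_label la ` T)" for r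
    unfolding cartan_coordinates_minor[OF level_truncations sub] set_pf_cartan_matrix[OF finite_minor_set]
      assms(3) using \<epsilon>(2) by simp
  moreover have "?d * \<epsilon> = 1 \<or> ?d * \<epsilon> = -1" using \<epsilon>(1) prod_signs[where f = label_val and K = "minor_set ?N (aug \<mu>)"]
    by (elim disjE) simp_all
  ultimately show ?thesis by blast
qed

section \<open>Expansion along the block of Schur Q-functions\<close>

definition label_index :: "label \<Rightarrow> nat" where
  "label_index a = nat \<bar>label_val a\<bar>"

lemma label_index_simps [simp]: "label_index (NegL j) = j" "label_index (PosL j) = j"
  by (simp_all add: label_index_def)

lemma Q_block_eq:
  "Q_block N t a b = (if (a, b) \<in> {(NegL i, NegL j) | i j. i < j \<and> j \<le> N} then Q_two t (label_index b) (label_index a) else 0)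
    - (if (b, a) \<in> {(NegL i, NegL j) | i j. i < j \<and> j \<le> N} then Q_two t (label_index a) (label_index b) else 0)"
proof -
  let ?g = "\<lambda>(j, i). (NegL i, NegL j)" and ?D = "Sigma {..N} (\<lambda>j. {..<j})"
  have im: "?g ` ?D = {(NegL i, NegL j) | i j. i < j \<and> j \<le> N}" by force
  have inj: "inj_on ?g ?D" by (auto simp: inj_on_def)
  have "Q_block N t a b = (\<Sum>(j, i)\<in>?D. Q_two t j i * skew_unit (NegL i) (NegL j) a b)"
    unfolding Q_block_def by (rule sum.Sigma) auto
  also have "\<dots> = (\<Sum>(x, y)\<in>?g ` ?D. Q_two t (label_index y) (label_index x) * skew_unit x y a b)"
    by (subst sum.reindex[OF inj]) (simp add: case_prod_unfold)
  also have "\<dots> = (if (a, b) \<in> ?g ` ?D then Q_two t (label_index b) (label_index a) else 0)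
    - (if (b, a) \<in> ?g ` ?D then Q_two t (label_index a) (label_index b) else 0)"
    by (rule skew_unit_sum) auto
  finally show ?thesis unfolding im .
qed

lemma Q_block_NegL:
  assumes "p \<le> N" "q \<le> N"
  shows "Q_block N t (NegL p) (NegL q) = - Q_two t p q"
proof (cases p q rule: linorder_cases)
  case less
  then have "Q_block N t (NegL p) (NegL q) = Q_two t q p" using assms by (simp add: Q_block_eq)
  then show ?thesis using skewD[OF Q_two_skew] by metis
next
  case equal
  then show ?thesis using skew_diag[OF Q_two_skew] by (simp add: Q_block_eq)
next
  case greater
  then show ?thesis using assms by (simp add: Q_block_eq)
qed

lemma Q_block_PosL: "Q_block N t (PosL j) b = 0"
  by (simp add: Q_block_eq)

definition scaled_Q_block :: "nat \<Rightarrow> (nat \<Rightarrow> complex) \<Rightarrow> label \<Rightarrow> label \<Rightarrow> complex" where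
  "scaled_Q_block N t a b = (-1) powi (label_val a) * (-1) powi (label_val b) * Q_block N t a b"

lemma skew_scaled_Q_block: "skew (scaled_Q_block N t)"
proof -
  have "scaled_Q_block N t b a = - scaled_Q_block N t a b" for a b
  proof -
    have q: "Q_block N t b a = - Q_block N t a b"
      unfolding Q_block_eq[of N t b a] Q_block_eq[of N t a b] by (rule minus_diff_eq[symmetric])
    show ?thesis
      unfolding scaled_Q_block_def q mult_minus_right by (simp only: mult.commute[of "(-1) powi label_val b"])
  qed
  then show ?thesis unfolding skew_def by blast
qed

lemma set_pf_scaled_Q_block_PosL:
  assumes "finite S" "PosL j \<in> S"
  shows "set_pf (scaled_Q_block N t) S = 0"
proof -
  have "insert (PosL j) (S - {PosL j}) = S" using assms(2) by auto
  then show ?thesis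
    using set_pf_insert[OF skew_scaled_Q_block, of "S - {PosL j}" "PosL j"] assms(1)
    by (simp add: scaled_Q_block_def Q_block_PosL)
qed

text \<open>The signs multiply to -1 to the power of the number of two-element subsets of
  \<open>K\<close>. For even size this equals \<open>\<i> ^ card K\<close>, which is itself a sign,
  so the product is 1.\<close>

lemma prod_sign_above:
  assumes "finite K"
  shows "(\<Prod>k\<in>K. \<i> * sign_above k K) = (if even (card K) then 1 else \<i>)"
  using assms
proof (induction K rule: finite_linorder_max_induct)
  case (insert m K)
  have m: "m \<notin> K" using insert by auto
  have "sign_above m (insert m K) = 1"
  proof -
    have "{k \<in> insert m K. m < k} = {}" using insert by force
    then show ?thesis unfolding sign_above_def by (simp only: card.empty power_0)
  qed
  moreover have "(\<Prod>k\<in>K. \<i> * sign_above k (insert m K)) = (\<Prod>k\<in>K. (-1) * (\<i> * sign_above k K))"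
    using insert m by (intro prod.cong refl) (simp add: sign_above_insert)
  moreover have "\<dots> = (-1) ^ card K * (if even (card K) then 1 else \<i>)"
    unfolding insert.IH[symmetric] prod_constant[symmetric] by (rule prod.distrib)
  ultimately show ?case
    using m insert.hyps(1) by (cases "even (card K)") simp_all
qed simp

text \<open>Three signs meet. \<open>Q_block\<close> holds \<open>- Q_two\<close>, written as a
  factor \<open>\<i>\<close> per row; the rescaling gives \<open>(-1) ^ p\<close> per row; the
  shuffle gives \<open>(-1) ^ (N - k) * sign_above k K\<close>. Their product over \<open>K\<close>
  is 1, so the rescaled minors are the coefficients without any sign.\<close>

lemma set_pf_scaled_Q_block:
  assumes "K \<subseteq> {..N}" "even (card K)"
  shows "shuffle_sign (NegL ` K) (minor_set N K) * set_pf (scaled_Q_block N t) (NegL ` K) = rec_pf (Q_two t) (descending K)"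
proof -
  have fin: "finite K" using assms(1) finite_subset by blast
  have "sorted_list_of_set (NegL ` K) = map NegL (descending K)"
  proof (rule sorted_list_of_set_eqI)
    show "sorted_wrt (<) (map NegL (descending K))"
      unfolding sorted_wrt_map by (rule sorted_wrt_mono_rel[OF _ sorted_descending]) (simp add: less_label_def)
  qed (simp add: set_descending fin)
  then have "set_pf (scaled_Q_block N t) (NegL ` K) = rec_pf (\<lambda>p q. scaled_Q_block N t (NegL p) (NegL q)) (descending K)"
    by (simp only: set_pf_def rec_pf_map)
  also have "\<dots> = rec_pf (\<lambda>p q. (\<i> * (-1) ^ p) * (\<i> * (-1) ^ q) * Q_two t p q) (descending K)"
  proof (rule rec_pf_cong)
    fix p q assume "p \<in> set (descending K)" "q \<in> set (descending K)"
    then have "p \<le> N" "q \<le> N" using assms(1) set_descending[OF fin] by auto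
    moreover have "(\<i> * x) * (\<i> * y) * z = x * y * (- z)" for x y z
    proof -
      have "(\<i> * x) * (\<i> * y) * z = (\<i> * \<i>) * (x * y * z)" by (simp only: ac_simps)
      then show ?thesis by simp
    qed
    ultimately show "scaled_Q_block N t (NegL p) (NegL q) = (\<i> * (-1) ^ p) * (\<i> * (-1) ^ q) * Q_two t p q"
      by (simp only: scaled_Q_block_def Q_block_NegL label_val.simps minus_one_powi_uminus power_int_of_nat)
  qed
  also have "\<dots> = (\<Prod>p\<in>K. \<i> * (-1) ^ p) * rec_pf (Q_two t) (descending K)"
  proof -
    have "distinct (descending K)" by (simp add: descending_def)
    then have "prod_list (map (\<lambda>p. \<i> * (-1) ^ p) (descending K)) = (\<Prod>p\<in>K. \<i> * (-1) ^ p)"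
      using prod.distinct_set_conv_list[of "descending K" "\<lambda>p. \<i> * (-1) ^ p"] set_descending[OF fin] by simp
    then show ?thesis by (simp only: rec_pf_scale)
  qed
  finally have B: "set_pf (scaled_Q_block N t) (NegL ` K) = (\<Prod>p\<in>K. \<i> * (-1) ^ p) * rec_pf (Q_two t) (descending K)" .
  have "shuffle_sign (NegL ` K) (minor_set N K) = (\<Prod>k\<in>K. (-1) ^ (N - k) * sign_above k K)"
    unfolding shuffle_sign_def
  proof (subst prod.reindex, simp add: inj_on_def, unfold o_def, rule prod.cong[OF refl])
    fix k assume "k \<in> K"
    then have "k \<le> N" using assms(1) by blast
    then show "sign_below (NegL k) (minor_set N K) = (-1) ^ (N - k) * sign_above k K"
      by (rule sign_below_minor_set[OF _ assms(1)])
  qed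
  then have one: "shuffle_sign (NegL ` K) (minor_set N K) * (\<Prod>p\<in>K. \<i> * (-1) ^ p)
      = (\<Prod>k\<in>K. ((-1) ^ (N - k) * sign_above k K) * (\<i> * (-1) ^ k))"
    by (simp only: prod.distrib)
  also have "\<dots> = (\<Prod>k\<in>K. (-1) ^ N * (\<i> * sign_above k K))"
  proof (rule prod.cong[OF refl])
    fix k assume "k \<in> K"
    then have "N = (N - k) + k" using assms(1) by auto
    then have "(-1 :: complex) ^ N = (-1) ^ (N - k) * (-1) ^ k" by (metis power_add)
    then show "((-1) ^ (N - k) * sign_above k K) * (\<i> * (-1) ^ k) = (-1) ^ N * (\<i> * sign_above k K)"
      by (simp only: ac_simps)
  qed
  also have "\<dots> = ((-1) ^ N) ^ card K * (\<Prod>k\<in>K. \<i> * sign_above k K)" by (simp only: prod.distrib prod_constant)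
  also have "\<dots> = 1" using assms(2) prod_sign_above[OF fin] by (cases "even N") simp_all
  finally show ?thesis unfolding B by (simp only: mult.assoc[symmetric] mult_1)
qed

text \<open>The two labels of an index contribute equal signs, so the conjugation leaves the full
  Pfaffian unchanged.\<close>

lemma prod_label_set: "(\<Prod>a\<in>label_set N. (-1 :: complex) powi label_val a) = 1"
proof -
  have "(\<Prod>a\<in>label_set N. (-1 :: complex) powi label_val a)
      = (\<Prod>a\<in>NegL ` {..N}. (-1) powi label_val a) * (\<Prod>a\<in>PosL ` {..N}. (-1) powi label_val a)"
    unfolding label_set_def by (rule prod.union_disjoint) auto
  also have "\<dots> = (\<Prod>j\<le>N. (-1) powi (- int j)) * (\<Prod>j\<le>N. (-1) powi int j)"
    by (simp add: prod.reindex inj_on_def)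
  also have "\<dots> = (\<Prod>j\<le>N. (-1) powi int j * ((-1) powi int j * 1))"
    by (simp only: prod.distrib[symmetric] minus_one_powi_uminus mult_1_right)
  also have "\<dots> = 1" by (simp only: minus_one_powi_square prod.neutral_const)
  finally show ?thesis .
qed

lemma skew_W_matrix: "skew (W_matrix N la r t)"
  unfolding skew_def using W_matrix_skew by blast

lemma aug_remove_zero: "even (card K) \<Longrightarrow> finite K \<Longrightarrow> aug (K - {0}) = K"
  by (cases "0 \<in> K") (auto simp: aug_def card_Diff_singleton insert_absorb card_gt_0_iff)

text \<open>In the expansion of the Pfaffian of the sum, only sets of negative labels survive, since
  the block is 0 elsewhere, and only those of even size. The even subsets of \<open>{..N}\<close>
  are exactly the augmented strict partitions.\<close>

lemma tau_expansion:
  "tau N la r t = (\<Sum>\<mu>\<in>strict_partitions (enat N). set_pf (cartan_matrix N la r) (minor_set N (aug \<mu>)) * schur_Q t \<mu>)"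
proof -
  let ?L = "label_set N" and ?d = "\<lambda>a. (-1 :: complex) powi label_val a"
  let ?B = "scaled_Q_block N t" and ?C = "cartan_matrix N la r" and ?P = "strict_partitions (enat N)"
  let ?f = "\<lambda>S. shuffle_sign S (?L - S) * set_pf ?B S * set_pf ?C (?L - S)"
  have "tau N la r t = set_pf (W_matrix N la r t) ?L"
    unfolding tau_def by (rule pfaffian_labels[OF skew_W_matrix])
  also have "\<dots> = set_pf (\<lambda>a b. ?d a * ?d b * W_matrix N la r t a b) ?L"
    by (simp only: set_pf_scale[OF finite_label_set] prod_label_set mult_1)
  also have "(\<lambda>a b. ?d a * ?d b * W_matrix N la r t a b) = (\<lambda>a b. ?B a b + ?C a b)"
    by (intro ext) (simp add: W_matrix_def scaled_Q_block_def cartan_matrix_def distrib_left)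
  also have "set_pf (\<lambda>a b. ?B a b + ?C a b) ?L = (\<Sum>S\<in>Pow ?L. ?f S)"
    by (rule set_pf_add[OF skew_scaled_Q_block skew_cartan_matrix finite_label_set])
  also have "\<dots> = (\<Sum>S\<in>(\<lambda>\<mu>. NegL ` aug \<mu>) ` ?P. ?f S)"
  proof (rule sum.mono_neutral_right)
    show "(\<lambda>\<mu>. NegL ` aug \<mu>) ` ?P \<subseteq> Pow ?L"
    proof
      fix S assume "S \<in> (\<lambda>\<mu>. NegL ` aug \<mu>) ` ?P"
      then obtain \<mu> where "S = NegL ` aug \<mu>" "\<mu> \<subseteq> {1..N}" unfolding strict_partitions_enat by blast
      then show "S \<in> Pow ?L" using aug_subset[of \<mu> N] by auto
    qed
    show "\<forall>S\<in>Pow ?L - (\<lambda>\<mu>. NegL ` aug \<mu>) ` ?P. ?f S = 0"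
    proof
      fix S assume S: "S \<in> Pow ?L - (\<lambda>\<mu>. NegL ` aug \<mu>) ` ?P"
      then have fS: "finite S" using finite_subset[OF _ finite_label_set] by blast
      have "set_pf ?B S = 0"
      proof (cases "\<exists>j. PosL j \<in> S")
        case True
        then show ?thesis using set_pf_scaled_Q_block_PosL[OF fS] by blast
      next
        case False
        define K where "K = {k. NegL k \<in> S}"
        have SK: "S = NegL ` K"
        proof (rule set_eqI)
          fix a show "a \<in> S \<longleftrightarrow> a \<in> NegL ` K" using False by (cases a) (auto simp: K_def)
        qed
        have K: "K \<subseteq> {..N}" using S by (auto simp: K_def)
        then have fK: "finite K" using finite_subset by blast
        have "odd (card K)"
        proof (rule ccontr)
          assume "\<not> odd (card K)"
          then have "aug (K - {0}) = K" using fK by (simp add: aug_remove_zero)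
          moreover have "K - {0} \<subseteq> {1..N}" using K by auto
          ultimately have "S \<in> (\<lambda>\<mu>. NegL ` aug \<mu>) ` ?P"
            unfolding SK by (intro image_eqI[of _ _ "K - {0}"]) (simp_all add: strict_partitions_enat)
          then show False using S by blast
        qed
        then show ?thesis unfolding SK by (intro set_pf_odd) (simp add: card_image inj_on_def)
      qed
      then show "?f S = 0" by simp
    qed
  qed simp
  also have "\<dots> = (\<Sum>\<mu>\<in>?P. ?f (NegL ` aug \<mu>))"
  proof (rule sum.reindex[unfolded o_def])
    show "inj_on (\<lambda>\<mu>. NegL ` aug \<mu>) ?P"
    proof (rule inj_onI)
      fix \<mu> \<nu> assume \<mu>: "\<mu> \<in> ?P" "\<nu> \<in> ?P" and "NegL ` aug \<mu> = NegL ` aug \<nu>"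
      then have e: "aug \<mu> = aug \<nu>" by (simp add: inj_image_eq_iff inj_def)
      have "aug \<kappa> - {0} = \<kappa>" if "\<kappa> \<in> ?P" for \<kappa> using that by (auto simp: aug_def strict_partitions_def)
      then show "\<mu> = \<nu>" using \<mu> e by metis
    qed
  qed
  also have "\<dots> = (\<Sum>\<mu>\<in>?P. set_pf ?C (minor_set N (aug \<mu>)) * schur_Q t \<mu>)"
  proof (rule sum.cong[OF refl])
    fix \<mu> assume "\<mu> \<in> ?P"
    then have \<mu>: "\<mu> \<subseteq> {1..N}" by (simp add: strict_partitions_enat)
    then have "0 \<notin> \<mu>" by auto
    then have "shuffle_sign (NegL ` aug \<mu>) (minor_set N (aug \<mu>)) * set_pf ?B (NegL ` aug \<mu>) = schur_Q t \<mu>"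
      unfolding schur_Q_def pfaffian_eq_rec_pf[OF Q_two_skew] augmented_eq_descending
      using aug_subset[OF \<mu>] even_card_aug by (intro set_pf_scaled_Q_block)
    then show "?f (NegL ` aug \<mu>) = set_pf ?C (minor_set N (aug \<mu>)) * schur_Q t \<mu>"
      unfolding minor_set_def by simp
  qed
  finally show ?thesis .
qed

lemma schur_Q_expansion_cartan_coordinates: "schur_Q_expansion n la r (cartan_coordinates n la r)"
  unfolding schur_Q_expansion_def
proof (intro conjI ballI impI allI cartan_coordinates_spinors)
  fix N t assume N: "N \<in> truncations n" and "la \<in> strict_partitions (enat N)"
  then have "la \<subseteq> {1..N}" by (simp add: strict_partitions_enat)
  then show "tau N la r t = (\<Sum>\<mu>\<in>strict_partitions (enat N). cartan_coordinates n la r \<mu> * schur_Q t \<mu>)"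
    unfolding tau_expansion
    by (intro sum.cong refl) (simp add: cartan_coordinates_minor[OF N] strict_partitions_enat)
qed

text \<open>Some truncation contains both \<open>la\<close> and \<open>\<mu>\<close>; there the two
  finite expansions of \<open>tau\<close> are compared by linear independence. What is shown for
  \<open>cartan_coordinates\<close> thereby holds for every expansion.\<close>

lemma schur_Q_expansion_unique:
  assumes "la \<in> strict_partitions n" "schur_Q_expansion n la r R" "schur_Q_expansion n la r R'"
  shows "R = R'"
proof
  fix \<mu>
  show "R \<mu> = R' \<mu>"
  proof (cases "\<mu> \<in> strict_partitions n")
    case True
    then obtain N where N: "N \<in> truncations n" "la \<subseteq> {1..N}" "\<mu> \<subseteq> {1..N}"
      using common_truncation[of "{la, \<mu>}" n] assms(1) by auto
    have eq: "tau N la r t = (\<Sum>\<mu>\<in>strict_partitions (enat N). R \<mu> * schur_Q t \<mu>)"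
      "tau N la r t = (\<Sum>\<mu>\<in>strict_partitions (enat N). R' \<mu> * schur_Q t \<mu>)" for t
      using assms(2,3) N(1,2) unfolding schur_Q_expansion_def strict_partitions_enat_iff by blast+
    have "(\<Sum>\<mu>\<in>strict_partitions (enat N). (R \<mu> - R' \<mu>) * schur_Q t \<mu>) = 0" for t
      unfolding left_diff_distrib sum_subtractf eq[symmetric] by simp
    then have "R \<mu> - R' \<mu> = 0"
      by (rule schur_Q_independent) (unfold strict_partitions_enat, rule PowI[OF N(3)])
    then show ?thesis by simp
  next
    case False
    then show ?thesis using assms(2,3) by (simp add: schur_Q_expansion_def spinors_def)
  qed
qed

section \<open>Parametrisation of pure spinors\<close>

lemma cartan_coordinates_pivot:
  assumes "la \<in> strict_partitions n"
  shows "\<exists>\<epsilon>. \<epsilon> \<noteq> 0 \<and> (\<forall>r. cartan_coordinates n la r la = \<epsilon>)"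
  using cartan_coordinates_near[OF assms assms, of "{}"] by (auto simp: sym_diff_def)

text \<open>The coordinate at \<open>la\<close> is, up to sign, a Pfaffian over the empty set, so
  the spinor is nonzero for every \<open>r\<close>.\<close>

lemma cartan_coordinates_pure:
  assumes "la \<in> strict_partitions n"
  shows "pure_spinor n (cartan_coordinates n la r)"
proof (rule bilinear_relations_imp_pure[OF cartan_coordinates_spinors _ cartan_coordinates_bilinear[OF assms]])
  show "cartan_coordinates n la r \<noteq> (\<lambda>\<mu>. 0)" using cartan_coordinates_pivot[OF assms] by metis
qed

text \<open>The set whose augmentation differs from that of \<open>\<lambda>\<close> in \<open>i > j \<ge> 0\<close>.\<close>

definition neighbour :: "nat set \<Rightarrow> nat \<Rightarrow> nat \<Rightarrow> nat set" where
  "neighbour la i j = (if j = 0 then toggle i la else toggle j (toggle i la))"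

text \<open>Each toggle of a positive part also toggles 0 in the augmentation. Two toggles cancel
  there; a single one is the case \<open>j = 0\<close>.\<close>

lemma aug_neighbour:
  assumes "finite la" "0 \<notin> la" "j < i"
  shows "aug (neighbour la i j) = sym_diff (aug la) {i, j}"
proof -
  have 1: "aug (toggle i la) = toggle i (toggle 0 (aug la))"
    using aug_toggle[of la i] assms by (simp add: odd_aug_def)
  have 2: "0 \<notin> toggle i la" using assms by (simp add: mem_toggle)
  show ?thesis
  proof (cases "j = 0")
    case True
    have "x \<in> toggle i (toggle 0 (aug la)) \<longleftrightarrow> x \<in> sym_diff (aug la) {i, 0}" for x
      using assms(3) by (cases "x = 0"; cases "x = i") (simp_all add: mem_toggle sym_diff_def)
    then show ?thesis using True by (simp add: neighbour_def 1 set_eq_iff)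
  next
    case False
    then have "aug (toggle j (toggle i la)) = toggle j (toggle 0 (toggle i (toggle 0 (aug la))))"
      using aug_toggle[of "toggle i la" j] assms(1) 2 by (simp add: odd_aug_def 1)
    moreover have "x \<in> toggle j (toggle 0 (toggle i (toggle 0 (aug la)))) \<longleftrightarrow> x \<in> sym_diff (aug la) {i, j}" for x
      using assms(3) False by (cases "x = 0"; cases "x = i"; cases "x = j") (simp_all add: mem_toggle sym_diff_def)
    ultimately show ?thesis using False by (simp add: neighbour_def set_eq_iff)
  qed
qed

lemma neighbour_strict_partitions:
  "la \<in> strict_partitions n \<Longrightarrow> enat i \<le> n \<Longrightarrow> j < i \<Longrightarrow> neighbour la i j \<in> strict_partitions n"
  unfolding neighbour_def
  by (auto intro!: toggle_strict_partitions intro: order_trans[of "enat j" "enat i"])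

text \<open>For a difference of two indices the remaining Pfaffian is a single entry: a parameter,
  or 0 if \<open>i\<close> is a part of \<open>la\<close>. The factor \<open>\<delta>\<close>
  precedes the quantifier over \<open>r\<close>, so that \<open>r\<close> can be defined by dividing
  by it.\<close>

lemma cartan_coordinates_neighbour:
  assumes "la \<in> strict_partitions n" "enat i \<le> n" "j < i"
  shows "\<exists>\<delta>. \<delta> \<noteq> 0 \<and> (\<forall>r. cartan_coordinates n la r (neighbour la i j)
      = (if i \<in> la then 0 else \<delta> * r (I_label la i) (I_label la j)))"
proof -
  let ?\<mu> = "neighbour la i j" and ?a = "I_label la i" and ?b = "I_label la j"
  let ?N = "level n (la \<union> ?\<mu>)"
  have fin: "finite la" "0 \<notin> la" using assms(1) by (auto simp: strict_partitions_def)
  have \<mu>: "?\<mu> \<in> strict_partitions n" by (rule neighbour_strict_partitions[OF assms])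
  obtain \<epsilon> where \<epsilon>: "\<epsilon> = 1 \<or> \<epsilon> = -1"
    "\<And>r. cartan_coordinates n la r ?\<mu> = \<epsilon> * set_pf (core_matrix ?N la r) (I_label la ` {i, j})"
    using cartan_coordinates_near[OF assms(1) \<mu> aug_neighbour[OF fin assms(3)]] by blast
  have "i \<in> la \<union> ?\<mu>" using assms(3) by (auto simp: neighbour_def mem_toggle)
  moreover have "la \<subseteq> {1..?N}" "?\<mu> \<subseteq> {1..?N}"
    using strict_partitions_level(2)[OF assms(1) finite_strict_partition[OF \<mu>]] strict_partitions_level(1)[OF \<mu> fin(1)] by auto
  ultimately have N: "i \<le> ?N" by auto
  have ne: "?a \<noteq> ?b" using assms(3) by (auto simp: I_label_def)
  let ?\<sigma> = "sign_below ?a {?b}" and ?\<rho> = "(-1 :: complex) powi (min 0 (label_val ?b))"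
  have val: "cartan_coordinates n la r ?\<mu> = (if i \<in> la then 0 else (\<epsilon> * ?\<sigma> * ?\<rho>) * r ?a ?b)" for r
  proof -
    have "i \<in> aug la \<longleftrightarrow> i \<in> la" using assms(3) by (auto simp: aug_def)
    then show ?thesis
      unfolding \<epsilon>(2) image_insert image_empty set_pf_pair[OF skew_core_matrix ne] core_matrix_I_label[OF fin(1) N assms(3)]
      by simp
  qed
  have "\<epsilon> * ?\<sigma> * ?\<rho> \<noteq> 0" using \<epsilon>(1) by (auto simp: sign_below_def)
  then show ?thesis using val by blast
qed

text \<open>Removing \<open>i\<close> lowers this weight even if some \<open>j < i\<close> is added.\<close>

definition binary_weight :: "nat set \<Rightarrow> nat" where
  "binary_weight \<mu> = (\<Sum>k\<in>\<mu>. 2 ^ k)"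

lemma binary_weight_neighbour:
  assumes "finite la" "i \<in> la" "j < i"
  shows "binary_weight (neighbour la i j) < binary_weight la"
proof -
  have r: "binary_weight la = 2 ^ i + binary_weight (la - {i})"
    unfolding binary_weight_def using assms by (simp add: sum.remove)
  have "binary_weight (toggle j \<mu>) \<le> binary_weight \<mu> + 2 ^ j" if "finite \<mu>" for \<mu>
    using that by (cases "j \<in> \<mu>") (auto simp: toggle_def binary_weight_def sum.remove)
  from this[of "la - {i}"] have "binary_weight (toggle j (la - {i})) \<le> binary_weight (la - {i}) + 2 ^ j"
    using assms(1) by simp
  also have "\<dots> < binary_weight la" using assms(3) r by simp
  finally have "binary_weight (toggle j (la - {i})) < binary_weight la" .
  moreover have "binary_weight (la - {i}) < binary_weight la" using r by simp
  moreover have "toggle i la = la - {i}" using assms(2) by (simp add: toggle_def)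
  ultimately have "binary_weight (toggle j (toggle i la)) < binary_weight la" "binary_weight (toggle i la) < binary_weight la"
    by simp_all
  then show ?thesis by (simp add: neighbour_def)
qed

lemma pure_spinor_parametrized:
  assumes "pure_spinor n s"
  shows "\<exists>la\<in>strict_partitions n. \<exists>r c. c \<noteq> 0 \<and> s = (\<lambda>\<mu>. c * cartan_coordinates n la r \<mu>)"
proof -
  have s: "s \<in> spinors n" "s \<noteq> (\<lambda>\<mu>. 0)" using assms by (auto simp: pure_spinor_def)
  then obtain \<mu> where "s \<mu> \<noteq> 0" by blast
  then obtain la where la: "s la \<noteq> 0" and least: "\<And>\<kappa>. s \<kappa> \<noteq> 0 \<Longrightarrow> binary_weight la \<le> binary_weight \<kappa>"
    using ex_has_least_nat[of "\<lambda>\<mu>. s \<mu> \<noteq> 0" \<mu> binary_weight] by blast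
  have laS: "la \<in> strict_partitions n" "finite la"
    using la s(1) by (auto simp: spinors_def strict_partitions_def)
  obtain \<epsilon> where \<epsilon>: "\<epsilon> \<noteq> 0" "\<And>r. cartan_coordinates n la r la = \<epsilon>"
    using cartan_coordinates_pivot[OF laS(1)] by blast
  \<comment> \<open>The scale matches \<open>s\<close> at the pivot, where the coordinate is the
    same for all \<open>r\<close>.\<close>
  define c where "c = s la / \<epsilon>"
  have c: "c \<noteq> 0" using la \<epsilon>(1) by (simp add: c_def)
  have "\<forall>i j. \<exists>\<delta>. enat i \<le> n \<and> j < i \<longrightarrow> \<delta> \<noteq> 0 \<and> (\<forall>r. cartan_coordinates n la r (neighbour la i j)
      = (if i \<in> la then 0 else \<delta> * r (I_label la i) (I_label la j)))"
    using cartan_coordinates_neighbour[OF laS(1)] by blast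
  then obtain \<delta> where \<delta>: "\<forall>i j. enat i \<le> n \<and> j < i \<longrightarrow> \<delta> i j \<noteq> 0 \<and> (\<forall>r. cartan_coordinates n la r (neighbour la i j)
      = (if i \<in> la then 0 else \<delta> i j * r (I_label la i) (I_label la j)))"
    by metis
  define r where "r a b = s (neighbour la (label_index a) (label_index b)) / (c * \<delta> (label_index a) (label_index b))" for a b
  have near: "c * cartan_coordinates n la r (neighbour la i j) = s (neighbour la i j)" if ij: "enat i \<le> n" "j < i" for i j
  proof (cases "i \<in> la")
    case True
    \<comment> \<open>No parameter is available here; the neighbour has smaller weight than
      \<open>la\<close>, so its coordinate vanishes by the choice of \<open>la\<close>.\<close>
    have "s (neighbour la i j) = 0"
      using least[of "neighbour la i j"] binary_weight_neighbour[OF laS(2) True ij(2)] by force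
    then show ?thesis using \<delta> ij True by simp
  next
    case False
    have "label_index (I_label la k) = k" for k by (simp add: I_label_def)
    then show ?thesis using \<delta> ij False c by (simp add: r_def)
  qed
  have "(\<lambda>\<mu>. c * cartan_coordinates n la r \<mu>) = s"
  proof (rule bilinear_relations_agree[OF s(1) pure_imp_bilinear_relations[OF assms] _
        bilinear_relations_scale[OF cartan_coordinates_bilinear[OF laS(1)]] laS(1) la])
    show "(\<lambda>\<mu>. c * cartan_coordinates n la r \<mu>) \<in> spinors n"
      using cartan_coordinates_spinors[of n la r] by (simp add: spinors_def)
    show "c * cartan_coordinates n la r la = s la" using \<epsilon> by (simp add: c_def)
  next
    fix j :: nat assume "j > 0" "enat j \<le> n"
    then show "c * cartan_coordinates n la r (toggle j la) = s (toggle j la)"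
      using near[of j 0] by (simp add: neighbour_def)
  next
    fix j k :: nat assume "enat j \<le> n" "k > 0" "k < j"
    then show "c * cartan_coordinates n la r (toggle k (toggle j la)) = s (toggle k (toggle j la))"
      using near[of j k] by (simp add: neighbour_def)
  qed
  then show ?thesis using laS(1) c by metis
qed

theorem theorem1p4:
  fixes n :: enat
  assumes "n \<ge> 1"
  shows
    "(\<forall>la \<in> strict_partitions n. \<forall>r.
        (\<exists>R. schur_Q_expansion n la r R) \<and>
        (\<forall>R. schur_Q_expansion n la r R \<longrightarrow> satisfies_cartan_pluecker n R \<and> pure_spinor n R)) \<and>
     (\<forall>s \<in> spinors n. s \<noteq> (\<lambda>\<mu>. 0) \<longrightarrow> (satisfies_cartan_pluecker n s \<longleftrightarrow> pure_spinor n s)) \<and>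
     (\<forall>s. pure_spinor n s \<longrightarrow>
        (\<exists>la \<in> strict_partitions n. \<exists>r R c.
           schur_Q_expansion n la r R \<and> c \<noteq> 0 \<and> (\<forall>\<mu>. s \<mu> = c * R \<mu>) \<and>
           (\<forall>\<mu> \<in> strict_partitions n. \<forall>N \<in> truncations n.
              la \<in> strict_partitions (enat N) \<and> \<mu> \<in> strict_partitions (enat N) \<longrightarrow>
              s \<mu> = c * pfaffian (minor_labels N \<mu>) (cartan_matrix N la r))))"
proof (intro conjI ballI allI impI)
  fix la r assume la: "la \<in> strict_partitions n"
  show "\<exists>R. schur_Q_expansion n la r R"
    using schur_Q_expansion_cartan_coordinates by blast
  fix R assume "schur_Q_expansion n la r R"
  \<comment> \<open>By uniqueness an arbitrary expansion is the one built from the minors.\<close>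
  then have R: "R = cartan_coordinates n la r"
    using schur_Q_expansion_unique[OF la _ schur_Q_expansion_cartan_coordinates] by blast
  show pure: "pure_spinor n R" unfolding R by (rule cartan_coordinates_pure[OF la])
  then show "satisfies_cartan_pluecker n R"
    by (simp add: satisfies_cartan_pluecker_def cartan_pluecker_relation_def)
next
  fix s assume "s \<in> spinors n" "s \<noteq> (\<lambda>\<mu>. 0)"
  then show "satisfies_cartan_pluecker n s \<longleftrightarrow> pure_spinor n s"
    by (rule satisfies_cartan_pluecker_iff_pure)
next
  fix s assume "pure_spinor n s"
  then obtain la r c where la: "la \<in> strict_partitions n" and c: "c \<noteq> 0"
    and s: "s = (\<lambda>\<mu>. c * cartan_coordinates n la r \<mu>)"
    using pure_spinor_parametrized by blast
  have minor: "s \<mu> = c * pfaffian (minor_labels N \<mu>) (cartan_matrix N la r)"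
    if "N \<in> truncations n" "la \<in> strict_partitions (enat N) \<and> \<mu> \<in> strict_partitions (enat N)" for \<mu> N
  proof -
    have "la \<subseteq> {1..N}" "\<mu> \<subseteq> {1..N}" using that(2) by (simp_all add: strict_partitions_enat)
    moreover have "finite \<mu>" using that(2) by (simp add: strict_partitions_def)
    ultimately show ?thesis
      by (simp only: s cartan_coordinates_minor[OF that(1)] pfaffian_minor_labels[OF skew_cartan_matrix])
  qed
  show "\<exists>la \<in> strict_partitions n. \<exists>r R c.
           schur_Q_expansion n la r R \<and> c \<noteq> 0 \<and> (\<forall>\<mu>. s \<mu> = c * R \<mu>) \<and>
           (\<forall>\<mu> \<in> strict_partitions n. \<forall>N \<in> truncations n.
              la \<in> strict_partitions (enat N) \<and> \<mu> \<in> strict_partitions (enat N) \<longrightarrow>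
              s \<mu> = c * pfaffian (minor_labels N \<mu>) (cartan_matrix N la r))"
    using la c minor schur_Q_expansion_cartan_coordinates[of n la r]
    by (intro bexI[of _ la] exI[of _ r] exI[of _ "cartan_coordinates n la r"] exI[of _ c] conjI ballI allI impI) (simp_all add: s)
qed

end
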